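(* Let $P$ be a poset and $K\in\mathrm{sSet}_P$ a stratified simplicial set. Then the natural map $\iota_K\colon K\to\mathrm{Ex}_P(K)$ is a trivial cofibration in $\mathrm{sSet}_P$.
   Context: $N(P)$ is the nerve of the poset $P$. A flag of $P$ is a finite sequence $\mathcal J=[p_0\le\dots\le p_n]$; it is regular if all inequalities are strict. $\mathrm{sSet}_P$ is the category of simplicial sets with a simplicial map to $N(P)$ and simplicial maps over $N(P)$; equivalently presheaves on the category of flags of $P$, the representables being the stratified simplices $\Delta^{\mathcal J}$, i.e. $\Delta^n$ with the map to $N(P)$ sending vertex $i$ to $p_i$. Model structure: an admissible horn inclusion is an inclusion $\Lambda^{\mathcal J}_k\to\Delta^{\mathcal J}$ (union of all codimension one faces except the $k$-th) with $\mathcal J=[p_0\le\dots\le p_n]$ and $p_k=p_{k+1}$ or $p_k=p_{k-1}$. $\mathrm{sSet}_P$ has a cofibrantly generated model structure whose cofibrations are the monomorphisms and whose generating trivial cofibrations are the admissible horn inclusions; so trivial cofibrations are exactly the retracts of transfinite compositions of pushouts of (coproducts of) admissible horn inclusions. Stratified subdivision: for $\mathcal J=[p_0\le\dots\le p_n]$, $\mathrm{sd}_P(\Delta^{\mathcal J})\subset\mathrm{sd}(\Delta^n)\times N(P)$ consists of the simplices $[(\sigma_0,q_0),\dots,(\sigma_k,q_k)]$ with $\emptyset\ne\sigma_0\subset\dots\subset\sigma_k\subset\{0,\dots,n\}$, $q_0\le\dots\le q_k$ in $P$ and $\{q_0,\dots,q_k\}\subset\{p_i\mid i\in\sigma_0\}$,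 stratified by the second projection. This extends by left Kan extension to a functor $\mathrm{sd}_P\colon\mathrm{sSet}_P\to\mathrm{sSet}_P$, with right adjoint $\mathrm{Ex}_P(K)_{\mathcal J}=\mathrm{sSet}_P(\mathrm{sd}_P(\Delta^{\mathcal J}),K)$. The natural transformation $\mathrm{lv}_P\colon\mathrm{sd}_P\to\mathrm{id}$ is given on vertices of $\mathrm{sd}_P(\Delta^{\mathcal J})$ by $(\sigma,q)\mapsto\max\{i\in\sigma\mid p_i=q\}$; $\iota_K$ is the adjoint of $\mathrm{lv}_P\colon\mathrm{sd}_P(K)\to K$. *)

theory Defs
  imports Main
begin

section \<open>Simplicial sets over the nerve of a poset\<close>

text \<open>
  A monotone map \<open>[m] \<rightarrow> [n]\<close> is the list of its values, so composition \<open>\<theta> \<circ> \<phi>\<close> is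
  \<open>map ((!) \<theta>) \<phi>\<close>. The simplices of all concrete simplicial sets below are lists as well
  (the list of their vertices), and precomposition with \<open>\<theta>\<close> is again \<open>map ((!) x) \<theta>\<close>.
\<close>

definition simplex_maps :: "nat \<Rightarrow> nat \<Rightarrow> nat list set" where
  "simplex_maps m n = {\<theta>. length \<theta> = Suc m \<and> sorted \<theta> \<and> set \<theta> \<subseteq> {..n}}"

text \<open>
  \<open>act X n x \<theta>\<close> is the image of the \<open>n\<close>-simplex \<open>x\<close> under \<open>X(\<theta>)\<close>. The sets \<open>cells X n\<close> for
  different \<open>n\<close> may overlap, hence the degree is always passed along.
\<close>

record 'a sset =
  cells :: "nat \<Rightarrow> 'a set"
  act :: "nat \<Rightarrow> 'a \<Rightarrow> nat list \<Rightarrow> 'a"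

definition simplicial_set :: "('a, 'z) sset_scheme \<Rightarrow> bool" where
  "simplicial_set X \<longleftrightarrow>
     (\<forall>n. \<forall>x\<in>cells X n. act X n x [0..<Suc n] = x) \<and>
     (\<forall>n. \<forall>x\<in>cells X n. \<forall>m. \<forall>\<theta>\<in>simplex_maps m n. act X n x \<theta> \<in> cells X m \<and>
        (\<forall>l. \<forall>\<phi>\<in>simplex_maps l m. act X m (act X n x \<theta>) \<phi> = act X n x (map ((!) \<theta>) \<phi>)))"

type_synonym ('a, 'b) smap = "nat \<Rightarrow> 'a \<Rightarrow> 'b"

definition simplicial_map ::
  "('a, 'y) sset_scheme \<Rightarrow> ('b, 'z) sset_scheme \<Rightarrow> ('a, 'b) smap \<Rightarrow> bool" where
  "simplicial_map X Y f \<longleftrightarrow>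
     (\<forall>n. \<forall>x\<in>cells X n. f n x \<in> cells Y n \<and>
        (\<forall>m. \<forall>\<theta>\<in>simplex_maps m n. f m (act X n x \<theta>) = act Y n (f n x) \<theta>))"

text \<open>
  The poset is a subset \<open>P\<close> of an ordered type (so that it may be empty). The \<open>n\<close>-simplices of
  its nerve are the flags \<open>[p\<^sub>0 \<le> \<dots> \<le> p\<^sub>n]\<close>.
\<close>

definition nerve :: "'p::order set \<Rightarrow> 'p list sset" where
  "nerve P = \<lparr>cells = \<lambda>n. {J. length J = Suc n \<and> set J \<subseteq> P \<and> sorted_wrt (\<le>) J},
              act = \<lambda>n J \<theta>. map ((!) J) \<theta>\<rparr>"

record ('a, 'p) strat_sset = "'a sset" +
  strat :: "nat \<Rightarrow> 'a \<Rightarrow> 'p list"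

definition stratified :: "'p::order set \<Rightarrow> ('a, 'p) strat_sset \<Rightarrow> bool" where
  "stratified P X \<longleftrightarrow> simplicial_set X \<and> simplicial_map X (nerve P) (strat X)"

definition strat_map :: "('a, 'p) strat_sset \<Rightarrow> ('b, 'p) strat_sset \<Rightarrow> ('a, 'b) smap \<Rightarrow> bool" where
  "strat_map X Y f \<longleftrightarrow>
     simplicial_map X Y f \<and> (\<forall>n. \<forall>x\<in>cells X n. strat Y n (f n x) = strat X n x)"

text \<open>Representing each morphism by a unique function: \<open>undefined\<close> outside the simplices of \<open>X\<close>.\<close>

definition strat_hom :: "('a, 'p) strat_sset \<Rightarrow> ('b, 'p) strat_sset \<Rightarrow> ('a, 'b) smap set" where
  "strat_hom X Y = {f. strat_map X Y f \<and> (\<forall>n x. x \<notin> cells X n \<longrightarrow> f n x = undefined)}"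

section \<open>Stratified simplices and admissible horns\<close>

definition flag_dim :: "'p list \<Rightarrow> nat" where
  "flag_dim J = length J - 1"

definition strat_simplex :: "'p list \<Rightarrow> (nat list, 'p) strat_sset" where
  "strat_simplex J = \<lparr>cells = \<lambda>m. simplex_maps m (flag_dim J),
                      act = \<lambda>m x \<theta>. map ((!) x) \<theta>,
                      strat = \<lambda>m x. map ((!) J) x\<rparr>"

text \<open>The \<open>i\<close>-th codimension one face consists of the simplices that miss the vertex \<open>i\<close>.\<close>

definition horn :: "'p list \<Rightarrow> nat \<Rightarrow> (nat list, 'p) strat_sset" where
  "horn J k = (strat_simplex J)
     \<lparr>cells := \<lambda>m. {x \<in> cells (strat_simplex J) m. \<exists>i\<le>flag_dim J. i \<noteq> k \<and> i \<notin> set x}\<rparr>"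

definition admissible :: "'p::order set \<Rightarrow> 'p list \<Rightarrow> nat \<Rightarrow> bool" where
  "admissible P J k \<longleftrightarrow>
     J \<in> cells (nerve P) (flag_dim J) \<and> k \<le> flag_dim J \<and>
     (k < flag_dim J \<and> J ! k = J ! (k + 1) \<or> 0 < k \<and> J ! k = J ! (k - 1))"

section \<open>Trivial cofibrations\<close>

definition coproduct :: "'i set \<Rightarrow> ('i \<Rightarrow> ('a, 'p) strat_sset) \<Rightarrow> ('i \<times> 'a, 'p) strat_sset" where
  "coproduct I X = \<lparr>cells = \<lambda>n. SIGMA i:I. cells (X i) n,
                    act = \<lambda>n (i, x) \<theta>. (i, act (X i) n x \<theta>),
                    strat = \<lambda>n (i, x). strat (X i) n x\<rparr>"

definition equiv_closure :: "('a \<times> 'a) set \<Rightarrow> ('a \<times> 'a) set" where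
  "equiv_closure r = (r \<union> r\<inverse>)\<^sup>*"

text \<open>
  A square \<open>u : A \<rightarrow> B\<close>, \<open>v : A \<rightarrow> C\<close>, \<open>v' : B \<rightarrow> D\<close>, \<open>u' : C \<rightarrow> D\<close>. Colimits over \<open>N(P)\<close> are formed
  degreewise, so it is a pushout iff in each degree \<open>C \<squnion> B \<rightarrow> D\<close> is surjective and identifies
  exactly what the equivalence relation generated by \<open>v a \<sim> u a\<close> does. (A universal property
  could only be tested against objects over a fixed type.)
\<close>

definition is_pushout ::
  "'p::order set \<Rightarrow> ('a, 'p) strat_sset \<Rightarrow> ('b, 'p) strat_sset \<Rightarrow> ('c, 'p) strat_sset \<Rightarrow>
   ('d, 'p) strat_sset \<Rightarrow> ('a, 'b) smap \<Rightarrow> ('a, 'c) smap \<Rightarrow> ('c, 'd) smap \<Rightarrow> ('b, 'd) smap \<Rightarrow> bool"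
  where
  "is_pushout P A B C D u v u' v' \<longleftrightarrow>
     stratified P A \<and> stratified P B \<and> stratified P C \<and> stratified P D \<and>
     strat_map A B u \<and> strat_map A C v \<and> strat_map C D u' \<and> strat_map B D v' \<and>
     (\<forall>n. case_sum (u' n) (v' n) ` (cells C n <+> cells B n) = cells D n \<and>
          (\<forall>x \<in> cells C n <+> cells B n. \<forall>y \<in> cells C n <+> cells B n.
             case_sum (u' n) (v' n) x = case_sum (u' n) (v' n) y \<longleftrightarrow>
             (x, y) \<in> equiv_closure {(Inl (v n a), Inr (u n a)) |a. a \<in> cells A n}))"

definition horn_attachment ::
  "'i itself \<Rightarrow> 'p::order set \<Rightarrow> ('c, 'p) strat_sset \<Rightarrow> ('d, 'p) strat_sset \<Rightarrow> ('c, 'd) smap \<Rightarrow> bool"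
  where
  "horn_attachment T P C D s \<longleftrightarrow>
     (\<exists>(I :: 'i set) J k v v'.
        (\<forall>i\<in>I. admissible P (J i) (k i)) \<and>
        is_pushout P (coproduct I (\<lambda>i. horn (J i) (k i))) (coproduct I (\<lambda>i. strat_simplex (J i)))
          C D (\<lambda>n x. x) v s v')"

definition is_successor :: "'i rel \<Rightarrow> 'i \<Rightarrow> 'i \<Rightarrow> bool" where
  "is_successor r i j \<longleftrightarrow>
     (i, j) \<in> r \<and> i \<noteq> j \<and> (\<forall>l. (i, l) \<in> r \<and> (l, j) \<in> r \<longrightarrow> l = i \<or> l = j)"

text \<open>
  \<open>F\<close> with transition maps \<open>t\<close> is a transfinite sequence indexed by the well-order \<open>r\<close> with least
  element \<open>a\<close> and greatest element \<open>b\<close>, continuous at every limit stage; its composition is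
  \<open>t a b\<close>. A sequence indexed by a limit ordinal \<open>\<lambda>\<close> together with its colimit is a sequence
  indexed by \<open>\<lambda> + 1\<close>. The last clause is the degreewise description of a directed colimit.
\<close>

definition transfinite_sequence ::
  "'p::order set \<Rightarrow> 'i rel \<Rightarrow> 'i \<Rightarrow> 'i \<Rightarrow> ('i \<Rightarrow> ('a, 'p) strat_sset) \<Rightarrow>
   ('i \<Rightarrow> 'i \<Rightarrow> ('a, 'a) smap) \<Rightarrow> bool" where
  "transfinite_sequence P r a b F t \<longleftrightarrow>
     Well_order r \<and> a \<in> Field r \<and> b \<in> Field r \<and> (\<forall>i\<in>Field r. (a, i) \<in> r \<and> (i, b) \<in> r) \<and>
     (\<forall>i\<in>Field r. stratified P (F i)) \<and>
     (\<forall>(i, j)\<in>r. strat_map (F i) (F j) (t i j)) \<and>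
     (\<forall>i\<in>Field r. \<forall>n. \<forall>x\<in>cells (F i) n. t i i n x = x) \<and>
     (\<forall>i j l. (i, j) \<in> r \<and> (j, l) \<in> r \<longrightarrow>
        (\<forall>n. \<forall>x\<in>cells (F i) n. t j l n (t i j n x) = t i l n x)) \<and>
     (\<forall>j\<in>Field r. j \<noteq> a \<and> \<not> (\<exists>i. is_successor r i j) \<longrightarrow>
        (\<forall>n. cells (F j) n = (\<Union>i\<in>underS r j. t i j n ` cells (F i) n) \<and>
             (\<forall>i\<in>underS r j. \<forall>x\<in>cells (F i) n. \<forall>i'\<in>underS r j. \<forall>x'\<in>cells (F i') n.
                t i j n x = t i' j n x' \<longrightarrow>
                (\<exists>l\<in>underS r j. (i, l) \<in> r \<and> (i', l) \<in> r \<and> t i l n x = t i' l n x'))))"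

definition is_retract ::
  "('a, 'p) strat_sset \<Rightarrow> ('b, 'p) strat_sset \<Rightarrow> ('a, 'b) smap \<Rightarrow>
   ('c, 'p) strat_sset \<Rightarrow> ('d, 'p) strat_sset \<Rightarrow> ('c, 'd) smap \<Rightarrow> bool" where
  "is_retract A B f X Y g \<longleftrightarrow>
     (\<exists>i r i' r'. strat_map A X i \<and> strat_map X A r \<and> strat_map B Y i' \<and> strat_map Y B r' \<and>
        (\<forall>n. (\<forall>x\<in>cells A n. r n (i n x) = x \<and> g n (i n x) = i' n (f n x)) \<and>
             (\<forall>x\<in>cells X n. f n (r n x) = r' n (g n x)) \<and>
             (\<forall>y\<in>cells B n. r' n (i' n y) = y)))"

text \<open>
  Retracts of transfinite compositions of pushouts of coproducts of admissible horn inclusions.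
  HOL cannot quantify over types, so the type \<open>'u\<close> provides the simplices of the objects in the
  transfinite sequence, its indices and the indices of the coproducts. If \<open>'u\<close> is infinite and
  \<open>A\<close>, \<open>B\<close> and \<open>P\<close> are at most as large as \<open>'u\<close>, this is no restriction: all that matters can be
  cut down to that size.
\<close>

definition trivial_cofibration ::
  "'u itself \<Rightarrow> 'p::order set \<Rightarrow> ('a, 'p) strat_sset \<Rightarrow> ('b, 'p) strat_sset \<Rightarrow> ('a, 'b) smap \<Rightarrow> bool"
  where
  "trivial_cofibration T P A B f \<longleftrightarrow>
     stratified P A \<and> stratified P B \<and> strat_map A B f \<and>
     (\<exists>(r :: 'u rel) a b (F :: 'u \<Rightarrow> ('u, 'p) strat_sset) t.
        transfinite_sequence P r a b F t \<and>
        (\<forall>i j. is_successor r i j \<longrightarrow> horn_attachment T P (F i) (F j) (t i j)) \<and>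
        is_retract A B f (F a) (F b) (t a b))"

section \<open>Stratified subdivision and its right adjoint\<close>

type_synonym 'p sd_simplex = "(nat set \<times> 'p) list"

definition sd_flag :: "'p::order list \<Rightarrow> ('p sd_simplex, 'p) strat_sset" where
  "sd_flag J =
     \<lparr>cells = \<lambda>k. {s. length s = Suc k \<and>
                      (\<forall>(\<sigma>, q)\<in>set s. \<sigma> \<noteq> {} \<and> \<sigma> \<subseteq> {..flag_dim J}) \<and>
                      sorted_wrt (\<lambda>(\<sigma>, q) (\<tau>, r). \<sigma> \<subseteq> \<tau> \<and> q \<le> r) s \<and>
                      snd ` set s \<subseteq> (!) J ` fst (hd s)},
      act = \<lambda>k s \<theta>. map ((!) s) \<theta>,
      strat = \<lambda>k s. map snd s\<rparr>"

text \<open>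
  Functoriality of \<open>sd_flag\<close>: the map from \<open>sd_flag (map ((!) J) \<alpha>)\<close> to \<open>sd_flag J\<close> induced by
  \<open>\<alpha> : [m] \<rightarrow> [n]\<close>.
\<close>

definition sd_flag_map :: "nat list \<Rightarrow> 'p sd_simplex \<Rightarrow> 'p sd_simplex" where
  "sd_flag_map \<alpha> s = map (\<lambda>(\<sigma>, q). ((!) \<alpha> ` \<sigma>, q)) s"

definition lv_flag :: "'p list \<Rightarrow> 'p sd_simplex \<Rightarrow> nat list" where
  "lv_flag J s = map (\<lambda>(\<sigma>, q). Max {i \<in> \<sigma>. J ! i = q}) s"

text \<open>
  Left Kan extension: \<open>sd\<^sub>P(K)\<close> is the colimit of \<open>sd\<^sub>P(\<Delta>\<^sup>J)\<close> over all simplices \<open>x\<close> of \<open>K\<close>, where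
  \<open>J\<close> is the flag of \<open>x\<close>. In degree \<open>k\<close> it is the set of triples \<open>(m, x, s)\<close>, with \<open>x\<close> an
  \<open>m\<close>-simplex of \<open>K\<close> and \<open>s\<close> a \<open>k\<close>-simplex of \<open>sd\<^sub>P(\<Delta>\<^sup>J)\<close>, modulo \<open>(x \<circ> \<alpha>, s) \<sim> (x, \<alpha>\<^sub>* s)\<close>.
\<close>

definition sd_pre :: "('a, 'p::order) strat_sset \<Rightarrow> nat \<Rightarrow> (nat \<times> 'a \<times> 'p sd_simplex) set" where
  "sd_pre K k = {(m, x, s). x \<in> cells K m \<and> s \<in> cells (sd_flag (strat K m x)) k}"

definition sd_rel :: "('a, 'p::order) strat_sset \<Rightarrow> nat \<Rightarrow> (nat \<times> 'a \<times> 'p sd_simplex) rel" where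
  "sd_rel K k = equiv_closure
     {((l, act K m x \<alpha>, s), (m, x, sd_flag_map \<alpha> s)) |l m x \<alpha> s.
        x \<in> cells K m \<and> \<alpha> \<in> simplex_maps l m \<and> s \<in> cells (sd_flag (strat K l (act K m x \<alpha>))) k}"

definition sd_P ::
  "('a, 'p::order) strat_sset \<Rightarrow> ((nat \<times> 'a \<times> 'p sd_simplex) set, 'p) strat_sset" where
  "sd_P K =
     \<lparr>cells = \<lambda>k. sd_pre K k // sd_rel K k,
      act = \<lambda>k c \<theta>. sd_rel K (length \<theta> - 1) `` ((\<lambda>(m, x, s). (m, x, map ((!) s) \<theta>)) ` c),
      strat = \<lambda>k c. the_elem ((\<lambda>(m, x, s). map snd s) ` c)\<rparr>"

text \<open>The class of \<open>(x, s)\<close> goes to the image of \<open>lv(s)\<close> under \<open>x : \<Delta>\<^sup>J \<rightarrow> K\<close>.\<close>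

definition lv_P :: "('a, 'p::order) strat_sset \<Rightarrow> ((nat \<times> 'a \<times> 'p sd_simplex) set, 'a) smap" where
  "lv_P K k c = the_elem ((\<lambda>(m, x, s). act K m x (lv_flag (strat K m x) s)) ` c)"

type_synonym ('a, 'p) Ex_simplex = "'p list \<times> ('p sd_simplex, 'a) smap"

definition Ex_P :: "'p::order set \<Rightarrow> ('a, 'p) strat_sset \<Rightarrow> (('a, 'p) Ex_simplex, 'p) strat_sset" where
  "Ex_P P K =
     \<lparr>cells = \<lambda>n. SIGMA J : cells (nerve P) n. strat_hom (sd_flag J) K,
      act = \<lambda>n (J, f) \<theta>. (map ((!) J) \<theta>,
              \<lambda>k s. if s \<in> cells (sd_flag (map ((!) J) \<theta>)) k then f k (sd_flag_map \<theta> s) else undefined),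
      strat = \<lambda>n (J, f). J\<rparr>"

text \<open>The adjunct \<open>K \<rightarrow> Ex\<^sub>P(L)\<close> of \<open>g : sd\<^sub>P(K) \<rightarrow> L\<close>.\<close>

definition adjunct ::
  "('a, 'p::order) strat_sset \<Rightarrow> ((nat \<times> 'a \<times> 'p sd_simplex) set, 'b) smap \<Rightarrow>
   ('a, ('b, 'p) Ex_simplex) smap" where
  "adjunct K g n x =
     (strat K n x,
      \<lambda>k s. if s \<in> cells (sd_flag (strat K n x)) k then g k (sd_rel K k `` {(n, x, s)}) else undefined)"

definition iota :: "('a, 'p::order) strat_sset \<Rightarrow> ('a, ('a, 'p) Ex_simplex) smap" where
  "iota K = adjunct K (lv_P K)"

end

theory Submission
  imports Defs "HOL-Library.Extended_Nat" "HOL-Library.Countable"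
begin

text \<open>
  The simplices of \<open>Ex\<^sub>P(K)\<close> outside \<open>K\<close> are attached in pairs, each pair filling one admissible
  horn. The method is that of Moss for the ordinary \<open>Ex\<close>: a pairing of nondegenerate simplices together
  with a rank along which the horns can be filled one after another.

  An \<open>n\<close>-simplex of \<open>Ex\<^sub>P(K)\<close> over a flag \<open>J\<close> is a map \<open>f\<close> from \<open>sd\<^sub>P(\<Delta>\<^sup>J)\<close> to \<open>K\<close>. Write \<open>l\<close> for the
  vertex that \<open>lv\<close> assigns to a vertex \<open>(\<sigma>, q)\<close> of the subdivision. The map \<open>lv\<close> has a section, and the
  idempotent belonging to it replaces \<open>\<sigma>\<close> by \<open>{..l}\<close> together with the first vertices of all strata
  of \<open>J\<close>; these have to be present because the strata of a simplex of the subdivision must all meet its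
  smallest subset. Hence \<open>f\<close> comes from \<open>K\<close> exactly if this idempotent leaves it unchanged
  (\<open>iota_in_image\<close>, \<open>iota_evaluate\<close>).

  The identity is joined to the idempotent by three moves: add \<open>{..l}\<close> to \<open>\<sigma>\<close>; add the first vertices
  of the strata; remove everything else. Each move is carried out for one value of \<open>l\<close> at a time, in
  descending order of \<open>l\<close> while subsets grow and in ascending order while they shrink, as the intermediate
  maps have to be monotone. Let \<open>(p, r)\<close> be the first step (move \<open>p\<close>, vertex \<open>l = r\<close>) that changes
  \<open>f\<close>. The partner of \<open>f\<close> is an \<open>(n + 1)\<close>-simplex over the flag in which the vertex \<open>r\<close> is repeated: the
  step is applied at one of the two copies of \<open>r\<close> only (at the larger one if it enlarges subsets, at the smaller
  one if it shrinks them). Omitting one copy gives back \<open>f\<close>, omitting the other gives the result of the step.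
  As both copies lie in the same stratum, the horn that lacks the face \<open>f\<close> is admissible.

  Partners of degenerate simplices and partners of partners are degenerate, and a nondegenerate \<open>f\<close> that is not
  a partner has a nondegenerate partner (\<open>extend_degenerate\<close>, \<open>extend_extend_degenerate\<close>,
  \<open>extend_nondegenerate\<close>). So the nondegenerate simplices outside \<open>K\<close> fall into pairs. It remains to see that
  every other face of a partner is available when its horn is filled. Usually it is the partner of a face of \<open>f\<close>
  (\<open>face_natural\<close>), hence attached together with a simplex of lower dimension. The exceptions
  (\<open>other_face_rank\<close>) are as follows. The face that omits the other copy of \<open>r\<close> is unchanged by the step, so it is
  further down the list of steps; the same holds in the first move if a vertex below \<open>r\<close> is omitted. In the other two moves,
  omitting the first vertex of a stratum above that of \<open>r\<close> changes what \<open>first vertex\<close> means; but then the new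
  flag arises from \<open>J\<close> by trading a vertex of a higher stratum for another one in the stratum of \<open>r\<close>, which
  lowers a weight. Thus a rank that is bounded in every dimension decreases, and ordering by dimension and rank
  gives a countable filtration of \<open>Ex\<^sub>P(K)\<close> by subcomplexes. By the Eilenberg-Zilber lemma its steps are
  pushouts of horn inclusions (\<open>stage_attachment\<close>).
\<close>

section \<open>Monotone maps\<close>

text \<open>
  The list that encodes a map on \<open>[m]\<close> given as a function. With \<open>skip k\<close> and \<open>merge r\<close>
  below it encodes the coface that omits \<open>k\<close> and the codegeneracy that takes the value \<open>r\<close> twice.
\<close>

definition mk :: "nat \<Rightarrow> (nat \<Rightarrow> nat) \<Rightarrow> nat list" where
  "mk m g = map g [0..<Suc m]"

definition skip :: "nat \<Rightarrow> nat \<Rightarrow> nat" where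
  "skip k i = (if i < k then i else Suc i)"

definition merge :: "nat \<Rightarrow> nat \<Rightarrow> nat" where
  "merge r i = (if i \<le> r then i else i - 1)"

lemma length_mk [simp]: "length (mk m g) = Suc m"
  by (simp add: mk_def)

lemma nth_mk [simp]: "i \<le> m \<Longrightarrow> mk m g ! i = g i"
  unfolding mk_def by (subst nth_map) (auto simp del: upt_Suc)

lemma set_mk: "set (mk m g) = g ` {..m}"
  unfolding mk_def by (auto simp del: upt_Suc)

lemma map_mk: "map h (mk m g) = mk m (\<lambda>i. h (g i))"
  by (simp add: mk_def)

lemma mk_cong: "(\<And>i. i \<le> m \<Longrightarrow> g i = h i) \<Longrightarrow> mk m g = mk m h"
  unfolding mk_def by (rule map_cong) auto

lemma simplex_mapsD:
  assumes "\<theta> \<in> simplex_maps m n"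
  shows "length \<theta> = Suc m" "i \<le> m \<Longrightarrow> \<theta> ! i \<le> n" "i \<le> j \<Longrightarrow> j \<le> m \<Longrightarrow> \<theta> ! i \<le> \<theta> ! j"
        "set \<theta> = (!) \<theta> ` {..m}"
proof -
  show *: "length \<theta> = Suc m" using assms by (simp add: simplex_maps_def)
  show "i \<le> m \<Longrightarrow> \<theta> ! i \<le> n"
    using assms * nth_mem[of i \<theta>] unfolding simplex_maps_def by force
  show "i \<le> j \<Longrightarrow> j \<le> m \<Longrightarrow> \<theta> ! i \<le> \<theta> ! j"
    using assms by (auto simp: simplex_maps_def intro: sorted_nth_mono)
  show "set \<theta> = (!) \<theta> ` {..m}"
    using * by (auto simp: set_conv_nth image_def less_Suc_eq_le)
qed

lemma mk_nth: "\<theta> \<in> simplex_maps m n \<Longrightarrow> mk m ((!) \<theta>) = \<theta>"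
  using map_nth[of \<theta>] simplex_mapsD(1)[of \<theta> m n] by (simp add: mk_def)

lemma mk_simplex_maps:
  assumes "\<And>i. i \<le> m \<Longrightarrow> g i \<le> n" "\<And>i j. i \<le> j \<Longrightarrow> j \<le> m \<Longrightarrow> g i \<le> g j"
  shows "mk m g \<in> simplex_maps m n"
proof -
  have "sorted (mk m g)"
    unfolding sorted_iff_nth_mono by (auto simp: assms less_Suc_eq_le)
  thus ?thesis using assms by (auto simp: simplex_maps_def set_mk)
qed

lemma simplex_maps_eqI:
  assumes "\<theta> \<in> simplex_maps m n" "\<phi> \<in> simplex_maps m n'" "\<And>i. i \<le> m \<Longrightarrow> \<theta> ! i = \<phi> ! i"
  shows "\<theta> = \<phi>"
  using assms by (intro nth_equalityI) (auto simp: simplex_mapsD(1) less_Suc_eq_le)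

lemma comp_simplex_maps:
  assumes "\<theta> \<in> simplex_maps m n" "\<phi> \<in> simplex_maps l m"
  shows "map ((!) \<theta>) \<phi> \<in> simplex_maps l n"
proof -
  have "map ((!) \<theta>) \<phi> = mk l (\<lambda>i. \<theta> ! (\<phi> ! i))"
    using map_mk[of "(!) \<theta>" l "(!) \<phi>"] mk_nth[OF assms(2)] by simp
  moreover have "mk l (\<lambda>i. \<theta> ! (\<phi> ! i)) \<in> simplex_maps l n"
    using simplex_mapsD[OF assms(1)] simplex_mapsD[OF assms(2)] by (intro mk_simplex_maps) auto
  ultimately show ?thesis by simp
qed

lemma id_simplex_maps: "[0..<Suc n] \<in> simplex_maps n n"
  by (auto simp: simplex_maps_def simp del: upt_Suc)

lemma mk_id: "mk n (\<lambda>i. i) = [0..<Suc n]"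
  by (simp add: mk_def)

lemma skip_simplex_maps: "mk n (skip k) \<in> simplex_maps n (Suc n)"
  by (rule mk_simplex_maps) (auto simp: skip_def)

lemma merge_simplex_maps: "r \<le> n \<Longrightarrow> mk (Suc n) (merge r) \<in> simplex_maps (Suc n) n"
  by (rule mk_simplex_maps) (auto simp: merge_def)

lemma surjective_endo_id:
  assumes "\<theta> \<in> simplex_maps n n" "set \<theta> = {..n}"
  shows "\<theta> = [0..<Suc n]"
proof (rule sorted_distinct_set_unique)
  show "sorted \<theta>" using assms by (simp add: simplex_maps_def)
  show "distinct \<theta>"
    using assms simplex_mapsD(1)[OF assms(1)] by (intro card_distinct) simp
qed (use assms in \<open>auto simp: atLeast0LessThan[symmetric] simp del: upt_Suc\<close>)

text \<open>
  The description of the image of \<open>\<theta>'\<close> is what later recognises the faces of a horn: \<open>\<theta>'\<close> is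
  surjective if \<open>\<theta>\<close> omits nothing but \<open>j\<close>.
\<close>

lemma factor_through_face:
  assumes "\<theta> \<in> simplex_maps d (Suc n)" "j \<le> Suc n" "j \<notin> set \<theta>"
  obtains \<theta>' where "\<theta>' \<in> simplex_maps d n" "\<theta> = map ((!) (mk n (skip j))) \<theta>'"
    "set \<theta>' = {i. i \<le> n \<and> skip j i \<in> set \<theta>}"
proof -
  note D = simplex_mapsD[OF assms(1)]
  define g where "g i = (if \<theta> ! i < j then \<theta> ! i else \<theta> ! i - 1)" for i
  have ne: "\<theta> ! i \<noteq> j" if "i \<le> d" for i using assms(3) D(4) that by auto
  have g: "skip j (g i) = \<theta> ! i" "g i \<le> n" if "i \<le> d" for i
    using ne[OF that] D(2)[OF that] assms(2) by (auto simp: g_def skip_def)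
  have mono: "g i \<le> g i'" if "i \<le> i'" "i' \<le> d" for i i'
    using D(3)[OF that] ne[of i] that by (auto simp: g_def)
  have 1: "mk d g \<in> simplex_maps d n" using g mono by (intro mk_simplex_maps) auto
  have 2: "\<theta> = map ((!) (mk n (skip j))) (mk d g)"
    using g D(1) by (intro nth_equalityI) (auto simp: map_mk less_Suc_eq_le)
  have 3: "set (mk d g) = {i. i \<le> n \<and> skip j i \<in> set \<theta>}"
  proof -
    have "i \<in> g ` {..d}" if "i \<le> n" "skip j i \<in> (!) \<theta> ` {..d}" for i
    proof -
      obtain i' where "i' \<le> d" "skip j i = \<theta> ! i'" using \<open>skip j i \<in> (!) \<theta> ` {..d}\<close> by auto
      with g(1)[of i'] have "skip j i = skip j (g i')" by simp
      hence "i = g i'" by (auto simp: skip_def split: if_splits)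
      thus ?thesis using \<open>i' \<le> d\<close> by auto
    qed
    thus ?thesis using g D(4) by (auto simp: set_mk)
  qed
  show ?thesis by (rule that[OF 1 2 3])
qed

section \<open>Degenerate simplices\<close>

lemma simplicial_setD:
  assumes "simplicial_set X" "x \<in> cells X n"
  shows "act X n x [0..<Suc n] = x"
    "\<theta> \<in> simplex_maps m n \<Longrightarrow> act X n x \<theta> \<in> cells X m"
    "\<theta> \<in> simplex_maps m n \<Longrightarrow> \<phi> \<in> simplex_maps l m \<Longrightarrow>
       act X m (act X n x \<theta>) \<phi> = act X n x (map ((!) \<theta>) \<phi>)"
  using assms unfolding simplicial_set_def by blast+

text \<open>
  Any map \<open>\<theta>\<close> from a larger to a smaller dimension counts, surjective or not, since factoring it through its
  image only lowers the dimension further.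
\<close>

definition degenerate :: "('a, 'z) sset_scheme \<Rightarrow> nat \<Rightarrow> 'a \<Rightarrow> bool" where
  "degenerate X n x \<longleftrightarrow> (\<exists>m<n. \<exists>y\<in>cells X m. \<exists>\<theta>\<in>simplex_maps n m. x = act X m y \<theta>)"

lemma degenerate_merge:
  assumes "y \<in> cells X n" "i \<le> n"
  shows "degenerate X (Suc n) (act X n y (mk (Suc n) (merge i)))"
  unfolding degenerate_def using assms merge_simplex_maps by blast

text \<open>
  A map to a simplex of smaller dimension takes the same value at two consecutive vertices \<open>i\<close> and \<open>i + 1\<close>, so it
  is unchanged if one of them is replaced by the other.
\<close>

lemma degenerate_faces:
  assumes X: "simplicial_set X" and x: "x \<in> cells X (Suc n)" and deg: "degenerate X (Suc n) x"
  obtains i where "i \<le> n" "act X (Suc n) x (mk n (skip i)) = act X (Suc n) x (mk n (skip (Suc i)))"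
    "x = act X n (act X (Suc n) x (mk n (skip i))) (mk (Suc n) (merge i))"
proof -
  obtain m y \<theta> where m: "m < Suc n" "y \<in> cells X m" "\<theta> \<in> simplex_maps (Suc n) m" "x = act X m y \<theta>"
    using deg unfolding degenerate_def by blast
  note D = simplex_mapsD[OF m(3)]
  have "\<exists>i\<le>n. \<theta> ! i = \<theta> ! Suc i"
  proof (rule ccontr)
    assume "\<not> ?thesis"
    hence s: "\<theta> ! i < \<theta> ! Suc i" if "i \<le> n" for i using D(3)[of i "Suc i"] that by force
    have "i \<le> \<theta> ! i" if "i \<le> Suc n" for i using that
    proof (induction i)
      case (Suc i)
      then show ?case using s[of i] by simp
    qed simp
    from this[of "Suc n"] D(2)[of "Suc n"] m(1) show False by simp
  qed
  then obtain i where i: "i \<le> n" "\<theta> ! i = \<theta> ! Suc i" by blast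
  have f: "act X (Suc n) x (mk n (skip j)) = act X m y (mk n (\<lambda>l. \<theta> ! skip j l))" for j
    using simplicial_setD(3)[OF X m(2,3) skip_simplex_maps] m(4) by (simp add: map_mk)
  have "\<theta> ! skip i l = \<theta> ! skip (Suc i) l" for l
    using i(2) by (cases "l = i") (auto simp: skip_def less_Suc_eq)
  hence 1: "act X (Suc n) x (mk n (skip i)) = act X (Suc n) x (mk n (skip (Suc i)))"
    unfolding f by simp
  have "act X n (act X (Suc n) x (mk n (skip i))) (mk (Suc n) (merge i))
      = act X (Suc n) x (mk (Suc n) (\<lambda>l. skip i (merge i l)))"
  proof -
    have "map ((!) (mk n (skip i))) (mk (Suc n) (merge i)) = mk (Suc n) (\<lambda>l. skip i (merge i l))"
      unfolding map_mk by (rule mk_cong) (use i(1) in \<open>auto simp: merge_def\<close>)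
    thus ?thesis using simplicial_setD(3)[OF X x skip_simplex_maps merge_simplex_maps[OF i(1)]] by simp
  qed
  also have "\<dots> = act X m y (mk (Suc n) (\<lambda>l. \<theta> ! (skip i (merge i l))))"
  proof -
    have "mk (Suc n) (\<lambda>l. skip i (merge i l)) \<in> simplex_maps (Suc n) (Suc n)"
      using i(1) by (intro mk_simplex_maps) (auto simp: skip_def merge_def)
    from simplicial_setD(3)[OF X m(2,3) this] show ?thesis using m(4) by (simp add: map_mk)
  qed
  also have "mk (Suc n) (\<lambda>l. \<theta> ! (skip i (merge i l))) = mk (Suc n) ((!) \<theta>)"
  proof (rule mk_cong)
    fix l assume "l \<le> Suc n"
    consider "l < i" | "l = i" | "l = Suc i" | "l > Suc i" by linarith
    thus "\<theta> ! (skip i (merge i l)) = \<theta> ! l"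
      by cases (use i(2) in \<open>auto simp: skip_def merge_def\<close>)
  qed
  also have "\<dots> = \<theta>" by (rule mk_nth[OF m(3)])
  finally have "x = act X n (act X (Suc n) x (mk n (skip i))) (mk (Suc n) (merge i))" using m(4) by simp
  with i(1) 1 show ?thesis by (rule that)
qed

lemma act_missing_degenerate:
  assumes X: "simplicial_set X" and y: "y \<in> cells X m" and \<theta>: "\<theta> \<in> simplex_maps n m" "set \<theta> \<noteq> {..m}"
  obtains m' y' \<theta>' where "m = Suc m'" "y' \<in> cells X m'" "\<theta>' \<in> simplex_maps n m'"
    "act X m y \<theta> = act X m' y' \<theta>'"
proof -
  have sub: "set \<theta> \<subseteq> {..m}" using \<theta> by (simp add: simplex_maps_def)
  then obtain j where j: "j \<le> m" "j \<notin> set \<theta>" using \<theta>(2) by auto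
  have "\<theta> ! 0 \<le> m" "\<theta> ! 0 \<in> set \<theta>" using simplex_mapsD[OF \<theta>(1)] by auto
  hence "m \<noteq> 0" using j by (metis le_zero_eq)
  then obtain m' where m': "m = Suc m'" by (cases m) auto
  obtain \<theta>' where t: "\<theta>' \<in> simplex_maps n m'" "\<theta> = map ((!) (mk m' (skip j))) \<theta>'"
    using factor_through_face[of \<theta> n m' j] \<theta> j m' by metis
  show ?thesis
    using that[OF m' _ t(1), of "act X m y (mk m' (skip j))"] simplicial_setD[OF X y] skip_simplex_maps t m'
    by metis
qed

text \<open>
  Take the decomposition of smallest dimension.
\<close>

lemma Eilenberg_Zilber_ex:
  assumes X: "simplicial_set X" and x: "x \<in> cells X n"
  obtains m y \<theta> where "m \<le> n" "y \<in> cells X m" "\<not> degenerate X m y" "\<theta> \<in> simplex_maps n m"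
    "set \<theta> = {..m}" "x = act X m y \<theta>"
proof -
  let ?Q = "\<lambda>m. \<exists>y\<in>cells X m. \<exists>\<theta>\<in>simplex_maps n m. x = act X m y \<theta>"
  have Qn: "?Q n" using x simplicial_setD(1)[OF X x] id_simplex_maps by metis
  define m where "m = (LEAST m. ?Q m)"
  have Qm: "?Q m" unfolding m_def by (rule LeastI[of ?Q, OF Qn])
  have least: "m \<le> m'" if "?Q m'" for m' unfolding m_def by (rule Least_le[of ?Q, OF that])
  obtain y \<theta> where y: "y \<in> cells X m" "\<theta> \<in> simplex_maps n m" "x = act X m y \<theta>" using Qm by blast
  have "set \<theta> = {..m}"
  proof (rule ccontr)
    assume "set \<theta> \<noteq> {..m}"
    with act_missing_degenerate[OF X y(1,2)] obtain m' where "m = Suc m'" "?Q m'" using y(3) by metis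
    with least show False by fastforce
  qed
  moreover have "\<not> degenerate X m y"
  proof
    assume "degenerate X m y"
    then obtain m' y' \<phi> where d: "m' < m" "y' \<in> cells X m'" "\<phi> \<in> simplex_maps m m'" "y = act X m' y' \<phi>"
      unfolding degenerate_def by blast
    have "x = act X m' y' (map ((!) \<phi>) \<theta>)" using simplicial_setD(3)[OF X d(2,3) y(2)] d y by simp
    hence "?Q m'" using d comp_simplex_maps[OF d(3) y(2)] by blast
    with least d(1) show False by force
  qed
  ultimately show ?thesis using that[OF least[OF Qn] y(1) _ y(2) _ y(3)] by simp
qed

text \<open>
  A section may be chosen to pass through any given vertex. Letting that vertex vary is what makes the
  surjection of an Eilenberg-Zilber decomposition unique.
\<close>

lemma section_through:
  assumes \<theta>: "\<theta> \<in> simplex_maps n m" "set \<theta> = {..m}" and i: "i \<le> n"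
  obtains \<epsilon> where "\<epsilon> \<in> simplex_maps m n" "map ((!) \<theta>) \<epsilon> = [0..<Suc m]" "\<epsilon> ! (\<theta> ! i) = i"
proof -
  note D = simplex_mapsD[OF \<theta>(1)]
  define g where "g j = (if j = \<theta> ! i then i else (SOME l. l \<le> n \<and> \<theta> ! l = j))" for j
  have g: "g j \<le> n \<and> \<theta> ! g j = j" if "j \<le> m" for j
  proof (cases "j = \<theta> ! i")
    case False
    have "\<exists>l. l \<le> n \<and> \<theta> ! l = j" using that \<theta>(2) D(4) by (metis atMost_iff imageE)
    from someI_ex[OF this] show ?thesis using False by (simp add: g_def)
  qed (use i in \<open>simp add: g_def\<close>)
  have mono: "g j \<le> g j'" if "j \<le> j'" "j' \<le> m" for j j'
  proof (rule ccontr)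
    assume "\<not> g j \<le> g j'"
    with D(3)[of "g j'" "g j"] g[of j] g[of j'] that show False by (metis le_antisym le_trans nat_le_linear)
  qed
  have 1: "mk m g \<in> simplex_maps m n" using g mono by (intro mk_simplex_maps) auto
  have "map ((!) \<theta>) (mk m g) = [0..<Suc m]" using g mk_cong[of m "\<lambda>j. \<theta> ! g j" "\<lambda>j. j"]
    by (simp add: map_mk mk_id)
  moreover have "mk m g ! (\<theta> ! i) = i" using D(2)[OF i] by (simp add: g_def)
  ultimately show ?thesis using that 1 by blast
qed

text \<open>
  Pulling back along a section of \<open>\<theta>\<close> writes \<open>y\<close> as a pullback of \<open>y'\<close>, and conversely. Nondegeneracy then
  forces equal dimensions, and each composite \<open>\<theta>' \<circ> \<epsilon>\<close> with a section \<open>\<epsilon>\<close> of \<open>\<theta>\<close> must be a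
  surjective endomorphism, so the identity.
\<close>

lemma Eilenberg_Zilber_unique:
  assumes X: "simplicial_set X"
    and y: "y \<in> cells X m" "\<not> degenerate X m y" "\<theta> \<in> simplex_maps n m" "set \<theta> = {..m}"
    and y': "y' \<in> cells X m'" "\<not> degenerate X m' y'" "\<theta>' \<in> simplex_maps n m'" "set \<theta>' = {..m'}"
    and eq: "act X m y \<theta> = act X m' y' \<theta>'"
  shows "m = m' \<and> y = y' \<and> \<theta> = \<theta>'"
proof -
  have one: "y = act X m' y' (map ((!) \<theta>') \<epsilon>)"
    if "\<epsilon> \<in> simplex_maps m n" "map ((!) \<theta>) \<epsilon> = [0..<Suc m]" for \<epsilon>
    using simplicial_setD(3)[OF X y(1,3) that(1)] simplicial_setD(3)[OF X y'(1,3) that(1)]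
      simplicial_setD(1)[OF X y(1)] eq that(2) by simp
  have two: "y' = act X m y (map ((!) \<theta>) \<epsilon>)"
    if "\<epsilon> \<in> simplex_maps m' n" "map ((!) \<theta>') \<epsilon> = [0..<Suc m']" for \<epsilon>
    using simplicial_setD(3)[OF X y(1,3) that(1)] simplicial_setD(3)[OF X y'(1,3) that(1)]
      simplicial_setD(1)[OF X y'(1)] eq that(2) by simp
  obtain \<epsilon>0 where e0: "\<epsilon>0 \<in> simplex_maps m n" "map ((!) \<theta>) \<epsilon>0 = [0..<Suc m]"
    using section_through[OF y(3,4), of 0] by blast
  obtain \<epsilon>1 where e1: "\<epsilon>1 \<in> simplex_maps m' n" "map ((!) \<theta>') \<epsilon>1 = [0..<Suc m']"
    using section_through[OF y'(3,4), of 0] by blast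
  have "\<not> m' < m" using one[OF e0] y(2) y'(1) comp_simplex_maps[OF y'(3) e0(1)]
    unfolding degenerate_def by blast
  moreover have "\<not> m < m'" using two[OF e1] y'(2) y(1) comp_simplex_maps[OF y(3) e1(1)]
    unfolding degenerate_def by blast
  ultimately have mm: "m' = m" by simp
  have id: "map ((!) \<theta>') \<epsilon> = [0..<Suc m]"
    if e: "\<epsilon> \<in> simplex_maps m n" "map ((!) \<theta>) \<epsilon> = [0..<Suc m]" for \<epsilon>
  proof (rule surjective_endo_id)
    show "map ((!) \<theta>') \<epsilon> \<in> simplex_maps m m" using comp_simplex_maps[OF y'(3) e(1)] mm by simp
    show "set (map ((!) \<theta>') \<epsilon>) = {..m}"
    proof (rule ccontr)
      assume "set (map ((!) \<theta>') \<epsilon>) \<noteq> {..m}"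
      from act_missing_degenerate[OF X, of y' m "map ((!) \<theta>') \<epsilon>" m] this comp_simplex_maps[OF y'(3) e(1)]
      obtain m'' y'' \<theta>'' where "m = Suc m''" "y'' \<in> cells X m''" "\<theta>'' \<in> simplex_maps m m''"
        "act X m y' (map ((!) \<theta>') \<epsilon>) = act X m'' y'' \<theta>''" using y'(1) mm by metis
      hence "degenerate X m y" using one[OF e] mm unfolding degenerate_def by auto
      with y(2) show False by simp
    qed
  qed
  have "y = y'" using one[OF e0] id[OF e0] simplicial_setD(1)[OF X y'(1)] mm by simp
  moreover have "\<theta> = \<theta>'"
  proof (rule simplex_maps_eqI[OF y(3) y'(3)])
    fix i assume i: "i \<le> n"
    obtain \<epsilon> where e: "\<epsilon> \<in> simplex_maps m n" "map ((!) \<theta>) \<epsilon> = [0..<Suc m]" "\<epsilon> ! (\<theta> ! i) = i"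
      using section_through[OF y(3,4) i] by blast
    have le: "\<theta> ! i \<le> m" using simplex_mapsD(2)[OF y(3) i] .
    have "map ((!) \<theta>') \<epsilon> ! (\<theta> ! i) = \<theta>' ! i"
      using e le simplex_mapsD(1)[OF e(1)] by simp
    thus "\<theta> ! i = \<theta>' ! i" using id[OF e(1,2)] le by (simp del: upt_Suc)
  qed
  ultimately show ?thesis using mm by simp
qed

section \<open>Attaching horns along a pairing\<close>

lemma stratifiedD:
  assumes "stratified P X"
  shows "simplicial_set X" "simplicial_map X (nerve P) (strat X)"
  using assms by (auto simp: stratified_def)

lemma simplicial_mapD:
  assumes "simplicial_map X Y f" "x \<in> cells X n"
  shows "f n x \<in> cells Y n" "\<theta> \<in> simplex_maps m n \<Longrightarrow> f m (act X n x \<theta>) = act Y n (f n x) \<theta>"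
  using assms unfolding simplicial_map_def by blast+

lemma stratified_subcomplex:
  assumes X: "stratified P X" and "\<And>n. C n \<subseteq> cells X n"
    and "\<And>n m x \<theta>. x \<in> C n \<Longrightarrow> \<theta> \<in> simplex_maps m n \<Longrightarrow> act X n x \<theta> \<in> C m"
  shows "stratified P (X\<lparr>cells := C\<rparr>)"
proof -
  have "x \<in> cells X n" if "x \<in> C n" for x n using assms(2) that by blast
  thus ?thesis
    using simplicial_setD[OF stratifiedD(1)[OF X]] simplicial_mapD[OF stratifiedD(2)[OF X]] assms(3)
    unfolding stratified_def simplicial_set_def simplicial_map_def by simp
qed

lemma strat_map_inclusion:
  assumes "\<And>n. C n \<subseteq> D n"
  shows "strat_map (X\<lparr>cells := C\<rparr>) (X\<lparr>cells := D\<rparr>) (\<lambda>n x. x)"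
  using assms unfolding strat_map_def simplicial_map_def by auto

lemma simplicial_set_strat_simplex: "simplicial_set (strat_simplex J)"
proof -
  have 1: "map ((!) x) [0..<Suc n] = x" if "x \<in> simplex_maps n m" for x n m
    using mk_nth[OF that] by (simp add: mk_def)
  have 2: "map ((!) (map ((!) x) \<theta>)) \<phi> = map ((!) x) (map ((!) \<theta>) \<phi>)"
    if "\<theta> \<in> simplex_maps m n" "\<phi> \<in> simplex_maps l m" for x \<theta> \<phi> :: "nat list" and l m n
  proof -
    have "i < length \<theta>" if "i \<in> set \<phi>" for i
      using that \<open>\<phi> \<in> _\<close> simplex_mapsD(1)[OF \<open>\<theta> \<in> _\<close>] by (auto simp: simplex_maps_def)
    thus ?thesis by auto
  qed
  show ?thesis unfolding simplicial_set_def strat_simplex_def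
    using 1 2 comp_simplex_maps by (simp del: upt_Suc map_map)
qed

lemma stratified_strat_simplex:
  assumes "J \<in> cells (nerve P) (flag_dim J)"
  shows "stratified P (strat_simplex J)"
proof -
  have J: "length J = Suc (flag_dim J)" "set J \<subseteq> P" "sorted_wrt (\<le>) J"
    using assms by (auto simp: nerve_def)
  have le: "J ! i \<le> J ! j" if "i \<le> j" "j \<le> flag_dim J" for i j
    using J(1,3) that by (cases "i = j") (auto simp: sorted_wrt_iff_nth_less)
  have mem: "map ((!) J) \<theta> \<in> cells (nerve P) m" if t: "\<theta> \<in> simplex_maps m (flag_dim J)" for \<theta> m
  proof -
    note D = simplex_mapsD[OF t]
    have "J ! (\<theta> ! i) \<in> P" if "i \<le> m" for i
      using D(2)[OF that] J(1,2) nth_mem[of "\<theta> ! i" J] by auto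
    moreover have "sorted_wrt (\<le>) (map ((!) J) \<theta>)"
      unfolding sorted_wrt_iff_nth_less using D(1) le D(2,3) by auto
    ultimately show ?thesis using D(1,4) by (auto simp: nerve_def)
  qed
  have "simplicial_map (strat_simplex J) (nerve P) (strat (strat_simplex J))"
    unfolding simplicial_map_def
  proof (intro allI ballI conjI)
    fix n x assume x: "x \<in> cells (strat_simplex J) n"
    thus "strat (strat_simplex J) n x \<in> cells (nerve P) n"
      using mem by (simp add: strat_simplex_def)
    fix m \<theta> assume t: "\<theta> \<in> simplex_maps m n"
    have "i < length x" if "i \<in> set \<theta>" for i
      using that t x simplex_mapsD(1)[of x n "flag_dim J"]
      by (auto simp: simplex_maps_def strat_simplex_def)
    thus "strat (strat_simplex J) m (act (strat_simplex J) n x \<theta>)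
        = act (nerve P) n (strat (strat_simplex J) n x) \<theta>"
      by (auto simp: strat_simplex_def nerve_def)
  qed
  thus ?thesis using simplicial_set_strat_simplex by (simp add: stratified_def)
qed

lemma stratified_horn:
  assumes "J \<in> cells (nerve P) (flag_dim J)"
  shows "stratified P (horn J k)"
  unfolding horn_def
proof (rule stratified_subcomplex[OF stratified_strat_simplex[OF assms]])
  fix n m x \<theta>
  assume x: "x \<in> {x \<in> cells (strat_simplex J) n. \<exists>i\<le>flag_dim J. i \<noteq> k \<and> i \<notin> set x}"
    and t: "\<theta> \<in> simplex_maps m n"
  hence x': "x \<in> simplex_maps n (flag_dim J)" by (simp add: strat_simplex_def)
  have "set (map ((!) x) \<theta>) \<subseteq> set x"
    using t simplex_mapsD(1)[OF x'] by (auto simp: simplex_maps_def intro!: nth_mem)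
  thus "act (strat_simplex J) n x \<theta> \<in> {x \<in> cells (strat_simplex J) m. \<exists>i\<le>flag_dim J. i \<noteq> k \<and> i \<notin> set x}"
    using x x' t comp_simplex_maps by (auto simp: strat_simplex_def)
qed auto

lemma stratified_coproduct:
  assumes "\<And>i. i \<in> I \<Longrightarrow> stratified P (Y i)"
  shows "stratified P (coproduct I Y)"
  using simplicial_setD[OF stratifiedD(1)[OF assms]] simplicial_mapD[OF stratifiedD(2)[OF assms]]
  unfolding stratified_def simplicial_set_def simplicial_map_def coproduct_def by auto

lemma equiv_closure_invariant:
  assumes "(x, y) \<in> equiv_closure R" "\<And>a b. (a, b) \<in> R \<Longrightarrow> f a = f b"
  shows "f x = f y"
  using assms(1) unfolding equiv_closure_def by (induction rule: rtrancl_induct) (use assms(2) in auto)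

lemma equiv_closure_intros:
  "(a, b) \<in> R \<Longrightarrow> (a, b) \<in> equiv_closure R"
  "(a, a) \<in> equiv_closure R"
  "(a, b) \<in> equiv_closure R \<Longrightarrow> (b, a) \<in> equiv_closure R"
  "(a, b) \<in> equiv_closure R \<Longrightarrow> (b, c) \<in> equiv_closure R \<Longrightarrow> (a, c) \<in> equiv_closure R"
  unfolding equiv_closure_def
  using sym_rtrancl[of "R \<union> R\<inverse>"] by (auto simp: sym_def)

text \<open>
  The combinatorial core. \<open>A\<close> is a subcomplex of \<open>X\<close>, and \<open>H\<close> assigns to each \<open>n\<close>-simplex \<open>f\<close> outside \<open>A\<close> a partner
  of dimension \<open>n + 1\<close>, of which \<open>f\<close> is the face number \<open>k n f\<close>. The conditions on degeneracy say that \<open>H\<close>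
  restricts to a bijection from the nondegenerate simplices that are not partners to the nondegenerate ones that
  are. All other faces of a partner must be dealt with before: a face in \<open>A\<close>, a degenerate one, or a partner is
  generated by \<open>A\<close> and pairs of lower dimension; any other face needs a rank below that of \<open>f\<close>. The bound
  \<open>N\<close> makes it possible to count the stages by natural numbers, through the dimensions and then through the ranks.
\<close>

locale pairing =
  fixes P :: "'p::order set" and X :: "('u, 'p) strat_sset" and A :: "nat \<Rightarrow> 'u set"
    and H :: "nat \<Rightarrow> 'u \<Rightarrow> 'u" and k :: "nat \<Rightarrow> 'u \<Rightarrow> nat" and rank :: "nat \<Rightarrow> 'u \<Rightarrow> nat" and N :: "nat \<Rightarrow> nat"
  assumes X: "stratified P X"
    and A_sub: "A n \<subseteq> cells X n"
    and A_act: "x \<in> A n \<Longrightarrow> \<theta> \<in> simplex_maps m n \<Longrightarrow> act X n x \<theta> \<in> A m"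
    and H_cell: "f \<in> cells X n - A n \<Longrightarrow> H n f \<in> cells X (Suc n) - A (Suc n)"
    and k_admissible: "f \<in> cells X n - A n \<Longrightarrow> admissible P (strat X (Suc n) (H n f)) (k n f)"
    and H_face: "f \<in> cells X n - A n \<Longrightarrow> act X (Suc n) (H n f) (mk n (skip (k n f))) = f"
    and H_degenerate: "f \<in> cells X n - A n \<Longrightarrow> degenerate X n f \<Longrightarrow> degenerate X (Suc n) (H n f)"
    and HH_degenerate: "f \<in> cells X n - A n \<Longrightarrow> degenerate X (Suc (Suc n)) (H (Suc n) (H n f))"
    and k_determined: "f \<in> cells X n - A n \<Longrightarrow> f' \<in> cells X n - A n \<Longrightarrow> H n f = H n f' \<Longrightarrow> k n f = k n f'"
    and H_nondegenerate: "f \<in> cells X n - A n \<Longrightarrow> \<not> degenerate X n f \<Longrightarrow> degenerate X (Suc n) (H n f) \<Longrightarrow>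
      \<exists>m. n = Suc m \<and> f \<in> H m ` (cells X m - A m)"
    and H_other_face: "f \<in> cells X n - A n \<Longrightarrow> j \<le> Suc n \<Longrightarrow> j \<noteq> k n f \<Longrightarrow>
      g = act X (Suc n) (H n f) (mk n (skip j)) \<Longrightarrow> g \<notin> A n \<Longrightarrow> \<not> degenerate X n g \<Longrightarrow>
      \<not> (\<exists>m. n = Suc m \<and> g \<in> H m ` (cells X m - A m)) \<Longrightarrow> rank n g < rank n f"
    and rank_less: "f \<in> cells X n - A n \<Longrightarrow> rank n f < N n"
begin

definition bases :: "nat \<Rightarrow> 'u set" where
  "bases n = {f \<in> cells X n - A n. \<not> degenerate X n f \<and> \<not> (\<exists>m. n = Suc m \<and> f \<in> H m ` (cells X m - A m))}"

definition stage :: "nat \<Rightarrow> 'u \<Rightarrow> nat" where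
  "stage n f = sum N {..<n} + rank n f"

text \<open>
  The subcomplex generated by \<open>A\<close> and the pairs of stage below \<open>s\<close>. The bases themselves need not be listed, being
  faces of their partners. Stages range over the extended naturals, so that \<open>layer \<infinity>\<close> is the colimit.
\<close>

definition layer :: "enat \<Rightarrow> nat \<Rightarrow> 'u set" where
  "layer s d = A d \<union> {act X (Suc n) (H n f) \<theta> |n f \<theta>.
     f \<in> bases n \<and> enat (stage n f) < s \<and> \<theta> \<in> simplex_maps d (Suc n)}"

lemmas SX = stratifiedD(1)[OF X]

lemma basesD:
  assumes "f \<in> bases n"
  shows "f \<in> cells X n - A n" "f \<in> cells X n" "f \<notin> A n" "\<not> degenerate X n f"
    "H n f \<in> cells X (Suc n)" "H n f \<notin> A (Suc n)" "\<not> degenerate X (Suc n) (H n f)"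
    "act X (Suc n) (H n f) (mk n (skip (k n f))) = f"
  using assms H_cell[of f n] H_nondegenerate[of f n] H_face[of f n] unfolding bases_def by auto

lemma k_le: "f \<in> bases n \<Longrightarrow> k n f \<le> Suc n"
  using k_admissible[of f n] basesD(1,5)[of f n] simplicial_mapD(1)[OF stratifiedD(2)[OF X], of "H n f" "Suc n"]
  unfolding admissible_def by (auto simp: nerve_def flag_dim_def)

lemma stage_bounds:
  assumes "f \<in> cells X n - A n"
  shows "sum N {..<n} \<le> stage n f" "stage n f < sum N {..<Suc n}"
  using rank_less[OF assms] by (auto simp: stage_def)

lemma sum_N_mono: "m \<le> n \<Longrightarrow> sum N {..<m} \<le> sum N {..<n}"
  by (rule sum_mono2) auto

lemma stage_dim:
  assumes "f \<in> cells X n - A n" "f' \<in> cells X n' - A n'" "stage n f = stage n' f'"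
  shows "n = n'"
  using stage_bounds[OF assms(1)] stage_bounds[OF assms(2)] assms(3)
    sum_N_mono[of "Suc n" n'] sum_N_mono[of "Suc n'" n] by (metis not_less_eq_eq le_antisym le_trans not_less)

text \<open>
  Every nondegenerate simplex outside \<open>A\<close> belongs to a pair. If it is a partner \<open>H n f\<close>, then \<open>f\<close> is a basis because
  partners of degenerate simplices and of partners are degenerate.
\<close>

lemma root_cases:
  assumes "y \<in> cells X m" "\<not> degenerate X m y"
  obtains "y \<in> A m" | "y \<in> bases m" | n f where "m = Suc n" "f \<in> bases n" "y = H n f"
proof (cases "y \<in> A m \<or> y \<in> bases m")
  case False
  then obtain n f where n: "m = Suc n" "f \<in> cells X n - A n" "y = H n f"
    using assms unfolding bases_def by blast
  have "f \<in> bases n"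
    unfolding bases_def using n H_degenerate[OF n(2)] HH_degenerate assms(2) by blast
  with n that show ?thesis by blast
qed (use that in blast)

lemma layer_mono: "s \<le> s' \<Longrightarrow> layer s d \<subseteq> layer s' d"
  unfolding layer_def by (blast intro: order.strict_trans2)

lemma layer_0: "layer 0 = A"
  by (auto simp: layer_def)

lemma layer_sub: "layer s d \<subseteq> cells X d"
  unfolding layer_def using A_sub simplicial_setD(2)[OF SX] basesD(5) by blast

lemma H_in_layer:
  "f \<in> bases n \<Longrightarrow> enat (stage n f) < s \<Longrightarrow> \<theta> \<in> simplex_maps d (Suc n) \<Longrightarrow> act X (Suc n) (H n f) \<theta> \<in> layer s d"
  unfolding layer_def by blast

lemma base_in_layer:
  assumes "f \<in> bases n" "enat (stage n f) < s" "\<theta> \<in> simplex_maps d n"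
  shows "act X n f \<theta> \<in> layer s d"
  using simplicial_setD(3)[OF SX basesD(5)[OF assms(1)] skip_simplex_maps assms(3), of "k n f"]
    H_in_layer[OF assms(1,2) comp_simplex_maps[OF skip_simplex_maps assms(3)], of "k n f"]
    basesD(8)[OF assms(1)] by simp

lemma layer_act:
  assumes "x \<in> layer s d" "\<phi> \<in> simplex_maps e d"
  shows "act X d x \<phi> \<in> layer s e"
proof (cases "x \<in> A d")
  case False
  then obtain n f \<theta> where x: "x = act X (Suc n) (H n f) \<theta>" "f \<in> bases n" "enat (stage n f) < s"
    "\<theta> \<in> simplex_maps d (Suc n)" using assms(1) unfolding layer_def by blast
  show ?thesis
    using H_in_layer[OF x(2,3) comp_simplex_maps[OF x(4) assms(2)]]
      simplicial_setD(3)[OF SX basesD(5)[OF x(2)] x(4) assms(2)] x(1) by simp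
qed (use A_act assms(2) in \<open>auto simp: layer_def\<close>)

text \<open>
  If the root of a simplex has dimension below \<open>n\<close>, or dimension \<open>n\<close> without being a basis, then it
  belongs to \<open>A\<close> or to a pair with basis of dimension below \<open>n\<close>, and those come before all stages of dimension \<open>n\<close>.
\<close>

lemma layer_dimension:
  assumes "y \<in> cells X m" "\<not> degenerate X m y" "\<theta> \<in> simplex_maps d m"
    and "y \<in> A m \<or> m < n \<or> (m = n \<and> y \<notin> bases m)"
  shows "act X m y \<theta> \<in> layer (enat (sum N {..<n})) d"
  using assms(1,2)
proof (cases rule: root_cases)
  case 1
  then show ?thesis using A_act assms(3) by (auto simp: layer_def)
next
  case 2
  hence "m < n" using assms(4) basesD(3)[OF 2] by blast
  hence "stage m y < sum N {..<n}"
    using stage_bounds(2)[OF basesD(1)[OF 2]] sum_N_mono[of "Suc m" n] by linarith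
  thus ?thesis using base_in_layer[OF 2 _ assms(3)] by simp
next
  case (3 n' f)
  hence "n' < n" using assms(4) basesD(6)[of f n'] by auto
  hence "stage n' f < sum N {..<n}"
    using stage_bounds(2)[OF basesD(1)[OF 3(2)]] sum_N_mono[of "Suc n'" n] by linarith
  thus ?thesis using H_in_layer[OF 3(2)] 3 assms(3) by simp
qed

lemma layer_infinity: "layer \<infinity> d = cells X d"
proof (intro equalityI subsetI)
  fix x assume "x \<in> cells X d"
  from Eilenberg_Zilber_ex[OF SX this] obtain m y \<theta> where e: "m \<le> d" "y \<in> cells X m"
    "\<not> degenerate X m y" "\<theta> \<in> simplex_maps d m" "set \<theta> = {..m}" "x = act X m y \<theta>" .
  show "x \<in> layer \<infinity> d"
    using layer_dimension[OF e(2-4), of "Suc m"] layer_mono[of _ \<infinity> d] e(6) by (auto simp: subset_iff)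
qed (use layer_sub in blast)

text \<open>
  By the Eilenberg-Zilber lemma the face has a nondegenerate root. Unless the root is an \<open>n\<close>-dimensional basis,
  dimension decides; in that case it is the face itself, and its rank is smaller.
\<close>

lemma other_face_in_layer:
  assumes f: "f \<in> bases n" and j: "j \<le> Suc n" "j \<noteq> k n f"
  shows "act X (Suc n) (H n f) (mk n (skip j)) \<in> layer (enat (stage n f)) n"
proof -
  let ?g = "act X (Suc n) (H n f) (mk n (skip j))"
  have g: "?g \<in> cells X n" using simplicial_setD(2)[OF SX basesD(5)[OF f] skip_simplex_maps] .
  obtain m y \<theta> where e: "m \<le> n" "y \<in> cells X m" "\<not> degenerate X m y" "\<theta> \<in> simplex_maps n m"
    "set \<theta> = {..m}" "?g = act X m y \<theta>" using Eilenberg_Zilber_ex[OF SX g] .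
  show ?thesis
  proof (cases "m < n \<or> y \<in> A m \<or> y \<notin> bases m")
    case True
    hence "y \<in> A m \<or> m < n \<or> (m = n \<and> y \<notin> bases m)" using e(1) by auto
    from layer_dimension[OF e(2-4) this] show ?thesis
      using e(6) layer_mono[of "enat (sum N {..<n})" "enat (stage n f)"]
        stage_bounds(1)[OF basesD(1)[OF f]] by auto
  next
    case False
    hence mn: "m = n" and y: "y \<in> bases n" using e(1) by auto
    have "\<theta> = [0..<Suc n]" using e(4,5) mn surjective_endo_id by simp
    hence gy: "?g = y" using e(6) mn simplicial_setD(1)[OF SX basesD(2)[OF y]] by simp
    have "rank n y < rank n f"
      using H_other_face[OF basesD(1)[OF f] j gy[symmetric]] y unfolding bases_def by blast
    hence "stage n y < stage n f" by (simp add: stage_def)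
    thus ?thesis using base_in_layer[OF y _ e(4)[unfolded mn], of "enat (stage n f)"] e(6) mn by simp
  qed
qed

text \<open>
  For a simplex \<open>\<theta>\<close> of the standard simplex: membership in the horn along which \<open>f\<close> and its partner are attached.
\<close>

definition in_horn :: "nat \<Rightarrow> 'u \<Rightarrow> nat list \<Rightarrow> bool" where
  "in_horn n f \<theta> \<longleftrightarrow> (\<exists>j\<le>Suc n. j \<noteq> k n f \<and> j \<notin> set \<theta>)"

lemma horn_in_layer:
  assumes f: "f \<in> bases n" and t: "\<theta> \<in> simplex_maps d (Suc n)" "in_horn n f \<theta>"
  shows "act X (Suc n) (H n f) \<theta> \<in> layer (enat (stage n f)) d"
proof -
  obtain j where j: "j \<le> Suc n" "j \<noteq> k n f" "j \<notin> set \<theta>" using t(2) unfolding in_horn_def by blast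
  obtain \<theta>' where t': "\<theta>' \<in> simplex_maps d n" "\<theta> = map ((!) (mk n (skip j))) \<theta>'"
    using factor_through_face[OF t(1) j(1,3)] .
  show ?thesis
    using simplicial_setD(3)[OF SX basesD(5)[OF f] skip_simplex_maps t'(1), of j] t'(2)
      layer_act[OF other_face_in_layer[OF f j(1,2)] t'(1)] by simp
qed

text \<open>
  A simplex outside the horn hits all vertices with the possible exception of \<open>k n f\<close>. So its image in \<open>X\<close> is a
  degeneration of the partner or of \<open>f\<close>, which identifies the root.
\<close>

lemma root_outside_horn:
  assumes f: "f \<in> bases n" and t: "\<theta> \<in> simplex_maps d (Suc n)" "\<not> in_horn n f \<theta>"
  obtains (top) "set \<theta> = {..Suc n}"
  | (face) \<eta> where "\<theta> = map ((!) (mk n (skip (k n f)))) \<eta>" "\<eta> \<in> simplex_maps d n" "set \<eta> = {..n}"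
    "act X (Suc n) (H n f) \<theta> = act X n f \<eta>"
proof (cases "k n f \<in> set \<theta>")
  case True
  hence "set \<theta> = {..Suc n}" using t unfolding in_horn_def simplex_maps_def by auto
  with top show ?thesis .
next
  case False
  obtain \<eta> where e: "\<eta> \<in> simplex_maps d n" "\<theta> = map ((!) (mk n (skip (k n f)))) \<eta>"
    "set \<eta> = {i. i \<le> n \<and> skip (k n f) i \<in> set \<theta>}"
    using factor_through_face[OF t(1) k_le[OF f] False] .
  have "skip (k n f) i \<in> set \<theta>" if "i \<le> n" for i
  proof -
    have "skip (k n f) i \<le> Suc n" "skip (k n f) i \<noteq> k n f" using that by (auto simp: skip_def)
    thus ?thesis using t(2) unfolding in_horn_def by blast
  qed
  hence "set \<eta> = {..n}" using e(3) by auto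
  moreover have "act X (Suc n) (H n f) \<theta> = act X n f \<eta>"
    using simplicial_setD(3)[OF SX basesD(5)[OF f] skip_simplex_maps e(1), of "k n f"]
      basesD(8)[OF f] e(2) by simp
  ultimately show ?thesis using face e by blast
qed

text \<open>
  By uniqueness of roots. A root that is a partner cannot agree with one that is a basis.
\<close>

lemma outside_horn_unique:
  assumes f: "f \<in> bases n" and t: "\<theta> \<in> simplex_maps d (Suc n)" "\<not> in_horn n f \<theta>"
    and f': "f' \<in> bases n'" and t': "\<theta>' \<in> simplex_maps d (Suc n')" "\<not> in_horn n' f' \<theta>'"
    and eq: "act X (Suc n) (H n f) \<theta> = act X (Suc n') (H n' f') \<theta>'"
  shows "n = n' \<and> f = f' \<and> \<theta> = \<theta>'"
proof -
  note U = Eilenberg_Zilber_unique[OF SX]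
  have mixed: False
    if g: "g \<in> bases m" "\<phi> \<in> simplex_maps d (Suc m)" "set \<phi> = {..Suc m}"
      "g' \<in> bases m'" "\<eta> \<in> simplex_maps d m'" "set \<eta> = {..m'}"
      "act X (Suc m) (H m g) \<phi> = act X m' g' \<eta>" for m g \<phi> m' g' \<eta>
  proof -
    have "Suc m = m' \<and> H m g = g'"
      using U[OF basesD(5,7)[OF g(1)] g(2,3) basesD(2,4)[OF g(4)] g(5,6,7)] by blast
    thus False using g(4) basesD(1)[OF g(1)] unfolding bases_def by blast
  qed
  from f t show ?thesis
  proof (cases rule: root_outside_horn)
    case top
    from f' t' show ?thesis
    proof (cases rule: root_outside_horn)
      case top': top
      have *: "n = n'" "H n f = H n' f'" "\<theta> = \<theta>'"
        using U[OF basesD(5,7)[OF f] t(1) top basesD(5,7)[OF f'] t'(1) top' eq] by blast+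
      hence "k n f = k n' f'" using k_determined basesD(1)[OF f] basesD(1)[OF f'] by blast
      thus ?thesis using * basesD(8)[OF f] basesD(8)[OF f'] by metis
    next
      case (face \<eta>)
      thus ?thesis using mixed[OF f t(1) top f' face(2,3)] eq by simp
    qed
  next
    case (face \<eta>)
    from f' t' show ?thesis
    proof (cases rule: root_outside_horn)
      case top
      thus ?thesis using mixed[OF f' t'(1) top f face(2,3)] eq face(4) by simp
    next
      case face': (face \<eta>')
      have "n = n' \<and> f = f' \<and> \<eta> = \<eta>'"
        using U[OF basesD(2,4)[OF f] face(2,3) basesD(2,4)[OF f'] face'(2,3)] eq face(4) face'(4) by simp
      thus ?thesis using face(1) face'(1) by auto
    qed
  qed
qed

lemma outside_horn_not_A:
  assumes f: "f \<in> bases n" and t: "\<theta> \<in> simplex_maps d (Suc n)" "\<not> in_horn n f \<theta>"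
  shows "act X (Suc n) (H n f) \<theta> \<notin> A d"
proof
  assume a: "act X (Suc n) (H n f) \<theta> \<in> A d"
  have aux: "y \<in> A m"
    if y: "y \<in> cells X m" and e: "\<eta> \<in> simplex_maps d m" "set \<eta> = {..m}" and a: "act X m y \<eta> \<in> A d"
    for m y \<eta>
  proof -
    obtain \<epsilon> where "\<epsilon> \<in> simplex_maps m d" "map ((!) \<eta>) \<epsilon> = [0..<Suc m]"
      using section_through[OF e, of 0] by blast
    thus ?thesis
      using A_act[OF a] simplicial_setD(1)[OF SX y] simplicial_setD(3)[OF SX y e(1)] by metis
  qed
  from f t show False
    by (cases rule: root_outside_horn) (use aux a basesD[OF f] t in auto)
qed

text \<open>
  Were the simplex already in an earlier layer, it would be in the image of a pair attached before; outside the
  horn of that pair this contradicts uniqueness, and inside it the simplex lies in a still earlier layer.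
\<close>

lemma outside_horn_new:
  assumes f: "f \<in> bases n" and t: "\<theta> \<in> simplex_maps d (Suc n)" "\<not> in_horn n f \<theta>"
  shows "s \<le> stage n f \<Longrightarrow> act X (Suc n) (H n f) \<theta> \<notin> layer (enat s) d"
proof (induction s rule: less_induct)
  case (less s)
  show ?case
  proof
    assume "act X (Suc n) (H n f) \<theta> \<in> layer (enat s) d"
    then obtain n' f' \<theta>' where e: "act X (Suc n) (H n f) \<theta> = act X (Suc n') (H n' f') \<theta>'"
      "f' \<in> bases n'" "stage n' f' < s" "\<theta>' \<in> simplex_maps d (Suc n')"
      using outside_horn_not_A[OF f t] unfolding layer_def by auto
    show False
    proof (cases "in_horn n' f' \<theta>'")
      case True
      thus False using horn_in_layer[OF e(2,4)] less e(1,3) by force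
    next
      case False
      thus False using outside_horn_unique[OF f t e(2,4) _ e(1)] e(3) less.prems by auto
    qed
  qed
qed

definition stage_X :: "enat \<Rightarrow> ('u, 'p) strat_sset" where
  "stage_X s = X\<lparr>cells := layer s\<rparr>"

lemma cells_stage: "cells (stage_X s) = layer s"
  by (simp add: stage_X_def)

lemma stratified_stage: "stratified P (stage_X s)"
  unfolding stage_X_def by (rule stratified_subcomplex[OF X layer_sub layer_act])

text \<open>
  The simplices outside the horns of the pairs attached at stage \<open>s\<close> are new and pairwise distinct, which is what a
  degreewise pushout requires.
\<close>

lemma stage_attachment:
  "horn_attachment T P (stage_X (enat s)) (stage_X (enat (Suc s))) (\<lambda>n x. x)" for T :: "'u itself"
proof -
  \<comment> \<open>The rank is bounded in each dimension, so a stage attaches horns of one dimension only.\<close>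
  obtain n where n: "\<forall>n' f. f \<in> bases n' \<and> stage n' f = s \<longrightarrow> n' = n"
  proof (cases "\<exists>n f. f \<in> bases n \<and> stage n f = s")
    case True
    then obtain n f where f: "f \<in> bases n" "stage n f = s" by blast
    show ?thesis
      by (rule that[of n]) (use stage_dim[OF basesD(1) basesD(1)[OF f(1)]] f(2) in auto)
  qed (use that in blast)
  define I where "I = {f \<in> bases n. stage n f = s}"
  have I: "f \<in> bases n" "stage n f = s" if "f \<in> I" for f using that by (auto simp: I_def)
  have I': "n' = n \<and> f \<in> I" if "f \<in> bases n'" "stage n' f = s" for n' f
    using n that by (auto simp: I_def)
  define J where "J f = strat X (Suc n) (H n f)" for f
  have J: "J f \<in> cells (nerve P) (Suc n)" if "f \<in> I" for f
    unfolding J_def using simplicial_mapD(1)[OF stratifiedD(2)[OF X] basesD(5)[OF I(1)[OF that]]] .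
  have dim: "flag_dim (J f) = Suc n" if "f \<in> I" for f
    using J[OF that] by (auto simp: nerve_def flag_dim_def)
  have JP: "J f \<in> cells (nerve P) (flag_dim (J f))" if "f \<in> I" for f using J dim that by simp
  define v where "v d = (\<lambda>(f, \<theta>). act X (Suc n) (H n f) \<theta>)" for d :: nat
  let ?B = "coproduct I (\<lambda>f. strat_simplex (J f))"
  let ?C = "coproduct I (\<lambda>f. horn (J f) (k n f))"
  have B: "cells ?B d = {(f, \<theta>). f \<in> I \<and> \<theta> \<in> simplex_maps d (Suc n)}" for d
    by (auto simp: coproduct_def strat_simplex_def dim)
  have C: "cells ?C d = {(f, \<theta>). f \<in> I \<and> \<theta> \<in> simplex_maps d (Suc n) \<and> in_horn n f \<theta>}" for d
    by (auto simp: coproduct_def strat_simplex_def horn_def dim in_horn_def)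
  have vB: "v d (f, \<theta>) \<in> layer (enat (Suc s)) d" if "f \<in> I" "\<theta> \<in> simplex_maps d (Suc n)" for d f \<theta>
    unfolding v_def using H_in_layer[OF I(1)[OF that(1)] _ that(2)] I(2)[OF that(1)] by simp
  have vC: "v d (f, \<theta>) \<in> layer (enat s) d"
    if "f \<in> I" "\<theta> \<in> simplex_maps d (Suc n)" "in_horn n f \<theta>" for d f \<theta>
    unfolding v_def using horn_in_layer[OF I(1)[OF that(1)] that(2,3)] I(2)[OF that(1)] by simp
  have v_act: "v e (f, map ((!) \<theta>) \<phi>) = act X d (v d (f, \<theta>)) \<phi>"
    if "f \<in> I" "\<theta> \<in> simplex_maps d (Suc n)" "\<phi> \<in> simplex_maps e d" for e d f \<theta> \<phi>
    unfolding v_def using simplicial_setD(3)[OF SX basesD(5)[OF I(1)[OF that(1)]] that(2,3)] by simp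
  have v_strat: "strat X d (v d (f, \<theta>)) = map ((!) (J f)) \<theta>"
    if "f \<in> I" "\<theta> \<in> simplex_maps d (Suc n)" for d f \<theta>
    unfolding v_def J_def
    using simplicial_mapD(2)[OF stratifiedD(2)[OF X] basesD(5)[OF I(1)[OF that(1)]] that(2)]
    by (simp add: nerve_def)
  have mapC: "strat_map ?C (stage_X (enat s)) v"
    unfolding strat_map_def simplicial_map_def
  proof (intro conjI allI ballI)
    fix d x assume "x \<in> cells ?C d"
    then obtain f \<theta> where x: "x = (f, \<theta>)" "f \<in> I" "\<theta> \<in> simplex_maps d (Suc n)" "in_horn n f \<theta>"
      unfolding C by blast
    show "v d x \<in> cells (stage_X (enat s)) d" unfolding x(1) cells_stage by (rule vC[OF x(2-4)])
    show "strat (stage_X (enat s)) d (v d x) = strat ?C d x"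
      unfolding x(1) stage_X_def using v_strat[OF x(2,3)]
      by (simp add: coproduct_def horn_def strat_simplex_def)
    fix e \<phi> assume p: "\<phi> \<in> simplex_maps e d"
    show "v e (act ?C d x \<phi>) = act (stage_X (enat s)) d (v d x) \<phi>"
      unfolding x(1) stage_X_def using v_act[OF x(2,3) p]
      by (simp add: coproduct_def horn_def strat_simplex_def)
  qed
  have mapB: "strat_map ?B (stage_X (enat (Suc s))) v"
    unfolding strat_map_def simplicial_map_def
  proof (intro conjI allI ballI)
    fix d x assume "x \<in> cells ?B d"
    then obtain f \<theta> where x: "x = (f, \<theta>)" "f \<in> I" "\<theta> \<in> simplex_maps d (Suc n)"
      unfolding B by blast
    show "v d x \<in> cells (stage_X (enat (Suc s))) d" unfolding x(1) cells_stage by (rule vB[OF x(2,3)])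
    show "strat (stage_X (enat (Suc s))) d (v d x) = strat ?B d x"
      unfolding x(1) stage_X_def using v_strat[OF x(2,3)] by (simp add: coproduct_def strat_simplex_def)
    fix e \<phi> assume p: "\<phi> \<in> simplex_maps e d"
    show "v e (act ?B d x \<phi>) = act (stage_X (enat (Suc s))) d (v d x) \<phi>"
      unfolding x(1) stage_X_def using v_act[OF x(2,3) p] by (simp add: coproduct_def strat_simplex_def)
  qed
  have incl: "strat_map ?C ?B (\<lambda>n x. x)"
    unfolding strat_map_def simplicial_map_def by (auto simp: coproduct_def horn_def)
  have inclX: "strat_map (stage_X (enat s)) (stage_X (enat (Suc s))) (\<lambda>n x. x)"
    unfolding stage_X_def by (intro strat_map_inclusion layer_mono) simp
  have degreewise: "case_sum (\<lambda>x. x) (v d) ` (layer (enat s) d <+> cells ?B d) = layer (enat (Suc s)) d \<and>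
      (\<forall>x\<in>layer (enat s) d <+> cells ?B d. \<forall>y\<in>layer (enat s) d <+> cells ?B d.
        case_sum (\<lambda>x. x) (v d) x = case_sum (\<lambda>x. x) (v d) y \<longleftrightarrow>
        (x, y) \<in> equiv_closure {(Inl (v d a), Inr a) |a. a \<in> cells ?C d})" for d
  proof (intro conjI ballI)
    show "case_sum (\<lambda>x. x) (v d) ` (layer (enat s) d <+> cells ?B d) = layer (enat (Suc s)) d"
    proof (intro equalityI subsetI)
      fix x assume "x \<in> layer (enat (Suc s)) d"
      show "x \<in> case_sum (\<lambda>x. x) (v d) ` (layer (enat s) d <+> cells ?B d)"
      proof (cases "x \<in> layer (enat s) d")
        case True
        thus ?thesis by (intro image_eqI[of _ _ "Inl x"]) auto
      next
        case False
        then obtain n' f \<theta> where f: "x = act X (Suc n') (H n' f) \<theta>" "f \<in> bases n'" "stage n' f = s"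
          "\<theta> \<in> simplex_maps d (Suc n')"
          using \<open>x \<in> layer (enat (Suc s)) d\<close> unfolding layer_def by (auto simp: less_Suc_eq)
        thus ?thesis using I'[OF f(2,3)]
          by (intro image_eqI[of _ _ "Inr (f, \<theta>)"]) (auto simp: B v_def)
      qed
    qed (use vB layer_mono[of "enat s" "enat (Suc s)" d] in \<open>auto simp: B\<close>)
  next
    fix x y
    assume xy: "x \<in> layer (enat s) d <+> cells ?B d" "y \<in> layer (enat s) d <+> cells ?B d"
    let ?R = "{(Inl (v d a), Inr a) |a. a \<in> cells ?C d}"
    have norm: "(Inl (v d (f, \<theta>)), Inr (f, \<theta>)) \<in> equiv_closure ?R"
      if "f \<in> I" "\<theta> \<in> simplex_maps d (Suc n)" "v d (f, \<theta>) \<in> layer (enat s) d" for f \<theta>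
    proof -
      have "in_horn n f \<theta>"
        using outside_horn_new[OF I(1)[OF that(1)] that(2), of s] that(3) I(2)[OF that(1)]
        by (auto simp: v_def)
      thus ?thesis using that by (intro equiv_closure_intros(1)) (auto simp: C)
    qed
    show "(case_sum (\<lambda>x. x) (v d) x = case_sum (\<lambda>x. x) (v d) y) \<longleftrightarrow> (x, y) \<in> equiv_closure ?R"
    proof
      assume "(x, y) \<in> equiv_closure ?R"
      thus "case_sum (\<lambda>x. x) (v d) x = case_sum (\<lambda>x. x) (v d) y"
        by (rule equiv_closure_invariant) auto
    next
      assume eq: "case_sum (\<lambda>x. x) (v d) x = case_sum (\<lambda>x. x) (v d) y"
      show "(x, y) \<in> equiv_closure ?R"
      proof (cases "case_sum (\<lambda>x. x) (v d) x \<in> layer (enat s) d")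
        case True
        have "(Inl (case_sum (\<lambda>x. x) (v d) z), z) \<in> equiv_closure ?R"
          if "z \<in> layer (enat s) d <+> cells ?B d" "case_sum (\<lambda>x. x) (v d) z \<in> layer (enat s) d" for z
          using that norm equiv_closure_intros(2) by (auto simp: B)
        note collapse = this
        have "(x, Inl (case_sum (\<lambda>x. x) (v d) x)) \<in> equiv_closure ?R"
          by (rule equiv_closure_intros(3)[OF collapse[OF xy(1) True]])
        moreover have "(Inl (case_sum (\<lambda>x. x) (v d) x), y) \<in> equiv_closure ?R"
          unfolding eq by (rule collapse[OF xy(2) True[unfolded eq]])
        ultimately show ?thesis by (rule equiv_closure_intros(4))
      next
        case False
        have new: "\<exists>f \<theta>. z = Inr (f, \<theta>) \<and> f \<in> I \<and> \<theta> \<in> simplex_maps d (Suc n)"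
          if "z \<in> layer (enat s) d <+> cells ?B d" "case_sum (\<lambda>x. x) (v d) z \<notin> layer (enat s) d" for z
          using that unfolding B by (cases z) auto
        obtain f \<theta> where x: "x = Inr (f, \<theta>)" "f \<in> I" "\<theta> \<in> simplex_maps d (Suc n)"
          using new[OF xy(1) False] by blast
        obtain f' \<theta>' where y: "y = Inr (f', \<theta>')" "f' \<in> I" "\<theta>' \<in> simplex_maps d (Suc n)"
          using new[OF xy(2) False[unfolded eq]] by blast
        note f = x y
        have v_eq: "v d (f, \<theta>) = v d (f', \<theta>')" using eq unfolding f by simp
        have not_s: "v d (f, \<theta>) \<notin> layer (enat s) d" using False unfolding f by simp
        have "\<not> in_horn n f \<theta>" using vC[OF f(2,3)] not_s by blast
        moreover have "\<not> in_horn n f' \<theta>'" using vC[OF f(5,6)] not_s unfolding v_eq by blast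
        ultimately have "f = f' \<and> \<theta> = \<theta>'"
          using outside_horn_unique[OF I(1)[OF f(2)] f(3) _ I(1)[OF f(5)] f(6)] v_eq unfolding v_def by simp
        thus ?thesis unfolding f by (simp only: equiv_closure_intros(2))
      qed
    qed
  qed
  have "is_pushout P ?C ?B (stage_X (enat s)) (stage_X (enat (Suc s))) (\<lambda>n x. x) v (\<lambda>n x. x) v"
    unfolding is_pushout_def
  proof (intro conjI allI)
    show "stratified P ?B" by (rule stratified_coproduct) (rule stratified_strat_simplex[OF JP])
    show "stratified P ?C" by (rule stratified_coproduct) (rule stratified_horn[OF JP])
    fix d
    show "case_sum (\<lambda>x. x) (v d) ` (cells (stage_X (enat s)) d <+> cells ?B d) = cells (stage_X (enat (Suc s))) d"
      unfolding cells_stage by (rule degreewise[THEN conjunct1])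
    show "\<forall>x\<in>cells (stage_X (enat s)) d <+> cells ?B d. \<forall>y\<in>cells (stage_X (enat s)) d <+> cells ?B d.
        case_sum (\<lambda>x. x) (v d) x = case_sum (\<lambda>x. x) (v d) y \<longleftrightarrow>
        (x, y) \<in> equiv_closure {(Inl (v d a), Inr a) |a. a \<in> cells ?C d}"
      unfolding cells_stage by (rule degreewise[THEN conjunct2])
  qed (rule mapC mapB incl inclX stratified_stage)+
  moreover have "\<forall>f\<in>I. admissible P (J f) (k n f)"
    using k_admissible basesD(1) I(1) unfolding J_def by blast
  ultimately show ?thesis unfolding horn_attachment_def by blast
qed

text \<open>
  The extended naturals, of order type \<open>\<omega> + 1\<close>, serve as the index set of the filtration; they embed into
  the infinite type of simplices. The only limit stage is \<open>\<infinity>\<close>.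
\<close>

theorem trivial_cofibration_inclusion:
  assumes inf: "infinite (UNIV :: 'u set)"
  obtains r :: "'u rel" and a b F where
    "transfinite_sequence P r a b F (\<lambda>i j n x. x)"
    "\<forall>i j. is_successor r i j \<longrightarrow> horn_attachment TYPE('u) P (F i) (F j) (\<lambda>n x. x)"
    "F a = X\<lparr>cells := A\<rparr>" "F b = X"
proof -
  obtain e :: "enat \<Rightarrow> 'u" where e: "inj e"
  proof -
    obtain g :: "nat \<Rightarrow> 'u" where "inj g" using infinite_countable_subset[OF inf] by blast
    moreover obtain h :: "enat \<Rightarrow> nat" where "inj h" using ex_inj[where 'a = enat] by blast
    ultimately show ?thesis using that inj_compose by blast
  qed
  have e_eq [simp]: "e x = e y \<longleftrightarrow> x = y" for x y using inj_eq[OF e] .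
  define r where "r = {(e i, e j) |i j. i \<le> j}"
  have r: "(e i, e j) \<in> r \<longleftrightarrow> i \<le> j" for i j by (auto simp: r_def)
  have Field: "Field r = range e" by (auto simp: r_def Field_def)
  have wo: "Well_order r"
  proof -
    have "r - Id \<subseteq> inv_image {(i, j). i < j} (inv e)"
      by (auto simp: r_def inv_f_f[OF e])
    hence "wf (r - Id)" by (rule wf_subset[OF wf_inv_image[OF wf]])
    moreover have "Linear_order r"
      unfolding linear_order_on_def partial_order_on_def preorder_on_def Field
      by (auto simp: refl_on_def trans_def antisym_def total_on_def r_def)
    ultimately show ?thesis by (simp add: well_order_on_def)
  qed
  define F where "F u = stage_X (inv e u)" for u
  have F: "F (e i) = stage_X i" for i by (simp add: F_def e)
  have top: "stage_X \<infinity> = X"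
  proof -
    have "layer \<infinity> = cells X" using layer_infinity by blast
    thus ?thesis by (simp add: stage_X_def)
  qed
  have succ: "\<exists>s. i = e (enat s) \<and> j = e (enat (Suc s))" if sij: "is_successor r i j" for i j
  proof -
    obtain i' j' where ij: "i = e i'" "j = e j'" "i' \<le> j'" "i \<noteq> j"
      using sij unfolding is_successor_def r_def by blast
    hence lt: "i' < j'" by (auto intro: le_neq_trans)
    then obtain s where s: "i' = enat s" by (cases i') auto
    have "enat (Suc s) \<le> j'" using lt s by (simp add: Suc_ile_eq)
    hence "(i, e (enat (Suc s))) \<in> r" "(e (enat (Suc s)), j) \<in> r" using ij s by (auto simp: r)
    hence "e (enat (Suc s)) = i \<or> e (enat (Suc s)) = j" using that unfolding is_successor_def by blast
    thus ?thesis using ij s by auto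
  qed
  have succ': "is_successor r (e (enat s)) (e (enat (Suc s)))" for s
  proof -
    have "l = e (enat s) \<or> l = e (enat (Suc s))"
      if l: "(e (enat s), l) \<in> r" "(l, e (enat (Suc s))) \<in> r" for l
    proof -
      obtain x where x: "l = e x" using l(1) unfolding r_def by blast
      hence "enat s \<le> x" "x \<le> enat (Suc s)" using l by (simp_all add: r)
      thus ?thesis using x by (cases x) auto
    qed
    thus ?thesis unfolding is_successor_def by (auto simp: r)
  qed
  have limit: "j = \<infinity>" if j0: "j \<noteq> 0" and "\<not> (\<exists>i. is_successor r i (e j))" for j
  proof (cases j)
    case (enat m)
    then obtain s where "m = Suc s" using j0 by (cases m) (auto simp: zero_enat_def)
    thus ?thesis using that succ' enat by blast
  qed
  have seq: "transfinite_sequence P r (e 0) (e \<infinity>) F (\<lambda>i j n x. x)"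
    unfolding transfinite_sequence_def
  proof (intro conjI)
    show "\<forall>(i, j)\<in>r. strat_map (F i) (F j) (\<lambda>n x. x)"
    proof (clarify)
      fix i j assume "(i, j) \<in> r"
      then obtain i' j' where ij: "i = e i'" "j = e j'" "i' \<le> j'" unfolding r_def by blast
      show "strat_map (F i) (F j) (\<lambda>n x. x)"
        unfolding ij F stage_X_def by (intro strat_map_inclusion layer_mono ij(3))
    qed
    show "\<forall>j\<in>Field r. j \<noteq> e 0 \<and> \<not> (\<exists>i. is_successor r i j) \<longrightarrow>
      (\<forall>n. cells (F j) n = (\<Union>i\<in>underS r j. (\<lambda>x. x) ` cells (F i) n) \<and>
         (\<forall>i\<in>underS r j. \<forall>x\<in>cells (F i) n. \<forall>i'\<in>underS r j. \<forall>x'\<in>cells (F i') n. x = x' \<longrightarrow>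
           (\<exists>l\<in>underS r j. (i, l) \<in> r \<and> (i', l) \<in> r \<and> x = x')))"
    proof (intro ballI impI allI)
      fix j n assume jF: "j \<in> Field r" and nsucc: "j \<noteq> e 0 \<and> \<not> (\<exists>i. is_successor r i j)"
      obtain x where x: "j = e x" using jF unfolding Field by blast
      have "x = \<infinity>" by (rule limit) (use nsucc x in auto)
      hence j: "j = e \<infinity>" using x by simp
      have under: "underS r j = range (\<lambda>s. e (enat s))"
      proof -
        have "\<exists>s. i = enat s" if "i \<noteq> \<infinity>" for i using that by (cases i) auto
        moreover have "underS r j = e ` {i. i \<noteq> \<infinity>}" unfolding underS_def j r_def by auto
        ultimately show ?thesis by (auto simp: image_iff)
      qed
      have "layer \<infinity> n = (\<Union>s. layer (enat s) n)"
      proof (intro equalityI subsetI)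
        fix x assume x: "x \<in> layer \<infinity> n"
        show "x \<in> (\<Union>s. layer (enat s) n)"
        proof (cases "x \<in> A n")
          case False
          then obtain m f \<theta> where "x = act X (Suc m) (H m f) \<theta>" "f \<in> bases m" "\<theta> \<in> simplex_maps n (Suc m)"
            using x unfolding layer_def by blast
          thus ?thesis using H_in_layer[of f m "enat (Suc (stage m f))"] by auto
        qed (auto simp: layer_def)
      next
        fix x assume "x \<in> (\<Union>s. layer (enat s) n)"
        thus "x \<in> layer \<infinity> n" using layer_mono[of _ \<infinity> n] enat_ord_code(3) by blast
      qed
      hence "cells (F j) n = (\<Union>i\<in>underS r j. cells (F i) n)"
        unfolding under by (simp add: j F stage_X_def)
      moreover have "\<exists>l\<in>underS r j. (i, l) \<in> r \<and> (i', l) \<in> r"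
        if ii: "i \<in> underS r j" "i' \<in> underS r j" for i i'
      proof -
        obtain s s' where "i = e (enat s)" "i' = e (enat s')" using ii unfolding under by blast
        thus ?thesis unfolding under by (intro bexI[of _ "e (enat (max s s'))"]) (auto simp: r)
      qed
      ultimately show "cells (F j) n = (\<Union>i\<in>underS r j. (\<lambda>x. x) ` cells (F i) n) \<and>
         (\<forall>i\<in>underS r j. \<forall>x\<in>cells (F i) n. \<forall>i'\<in>underS r j. \<forall>x'\<in>cells (F i') n. x = x' \<longrightarrow>
           (\<exists>l\<in>underS r j. (i, l) \<in> r \<and> (i', l) \<in> r \<and> x = x'))" by simp
    qed
    show "\<forall>i\<in>Field r. stratified P (F i)" by (simp add: F_def stratified_stage)
  qed (use wo in \<open>auto simp: Field r\<close>)
  have att: "\<forall>i j. is_successor r i j \<longrightarrow> horn_attachment TYPE('u) P (F i) (F j) (\<lambda>n x. x)"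
  proof (intro allI impI)
    fix i j assume "is_successor r i j"
    then obtain s where s: "i = e (enat s)" "j = e (enat (Suc s))" using succ by blast
    show "horn_attachment TYPE('u) P (F i) (F j) (\<lambda>n x. x)" unfolding s F by (rule stage_attachment)
  qed
  show ?thesis
  proof (rule that[OF seq att])
    show "F (e 0) = X\<lparr>cells := A\<rparr>" by (simp only: F stage_X_def layer_0)
    show "F (e \<infinity>) = X" by (simp only: F top)
  qed
qed

end

section \<open>Filling operations on the stratified subdivision\<close>

definition monotone_to :: "(nat \<Rightarrow> nat) \<Rightarrow> nat \<Rightarrow> nat \<Rightarrow> bool" where
  "monotone_to g m n \<longleftrightarrow> (\<forall>i\<le>m. g i \<le> n) \<and> (\<forall>i j. i \<le> j \<and> j \<le> m \<longrightarrow> g i \<le> g j)"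

lemma monotone_toD:
  assumes "monotone_to g m n"
  shows "i \<le> m \<Longrightarrow> g i \<le> n" "i \<le> j \<Longrightarrow> j \<le> m \<Longrightarrow> g i \<le> g j"
  using assms by (auto simp: monotone_to_def)

lemma monotone_to_id: "monotone_to (\<lambda>i. i) n n"
  and monotone_to_skip: "monotone_to (skip k) n (Suc n)"
  and monotone_to_merge: "r \<le> n \<Longrightarrow> monotone_to (merge r) (Suc n) n"
  by (auto simp: monotone_to_def skip_def merge_def)

lemma monotone_to_comp: "monotone_to g m n \<Longrightarrow> monotone_to h l m \<Longrightarrow> monotone_to (\<lambda>i. g (h i)) l n"
  by (auto simp: monotone_to_def)

lemma monotone_to_simplex_maps: "\<theta> \<in> simplex_maps m n \<Longrightarrow> monotone_to ((!) \<theta>) m n"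
  using simplex_mapsD[of \<theta> m n] by (auto simp: monotone_to_def)

definition flag :: "nat \<Rightarrow> 'p::order list \<Rightarrow> bool" where
  "flag n J \<longleftrightarrow> length J = Suc n \<and> sorted_wrt (\<le>) J"

lemma flagD:
  assumes "flag n J"
  shows "length J = Suc n" "flag_dim J = n" "i \<le> j \<Longrightarrow> j \<le> n \<Longrightarrow> J ! i \<le> J ! j"
  using assms by (auto simp: flag_def flag_dim_def sorted_wrt_iff_nth_less dest: le_neq_implies_less)

text \<open>
  The flag \<open>J \<circ> g\<close>. Maps are treated as functions from here on, and \<open>flag n J\<close> records the dimension
  without reference to the poset.
\<close>

definition pullback :: "'p list \<Rightarrow> nat \<Rightarrow> (nat \<Rightarrow> nat) \<Rightarrow> 'p list" where
  "pullback J m g = map (\<lambda>i. J ! g i) [0..<Suc m]"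

lemma length_pullback [simp]: "length (pullback J m g) = Suc m"
  by (simp add: pullback_def)

lemma nth_pullback [simp]: "i \<le> m \<Longrightarrow> pullback J m g ! i = J ! g i"
  unfolding pullback_def by (subst nth_map) (auto simp del: upt_Suc)

lemma flag_dim_pullback [simp]: "flag_dim (pullback J m g) = m"
  by (simp add: flag_dim_def)

lemma flag_pullback:
  assumes "flag n J" "monotone_to g m n"
  shows "flag m (pullback J m g)"
  unfolding flag_def sorted_wrt_iff_nth_less
  using flagD(3)[OF assms(1)] monotone_toD[OF assms(2)] by (auto simp: less_Suc_eq_le)

lemma pullback_pullback:
  "monotone_to h l m \<Longrightarrow> pullback (pullback J m g) l h = pullback J l (\<lambda>i. g (h i))"
  unfolding pullback_def[of _ l] by (auto simp: monotone_to_def)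

lemma pullback_cong: "(\<And>i. i \<le> m \<Longrightarrow> g i = h i) \<Longrightarrow> pullback J m g = pullback J m h"
  by (auto simp: pullback_def)

lemma pullback_id: "length J = Suc n \<Longrightarrow> pullback J n (\<lambda>i. i) = J"
  using map_nth[of J] by (simp add: pullback_def)

lemma pullback_simplex_maps:
  assumes "\<theta> \<in> simplex_maps m n"
  shows "pullback J m ((!) \<theta>) = map ((!) J) \<theta>"
proof -
  have "map ((!) J) \<theta> = map ((!) J) (mk m ((!) \<theta>))" by (simp only: mk_nth[OF assms])
  thus ?thesis by (simp add: mk_def pullback_def)
qed

definition vertex :: "'p list \<Rightarrow> nat set \<Rightarrow> 'p \<Rightarrow> bool" where
  "vertex J \<sigma> q \<longleftrightarrow> \<sigma> \<subseteq> {..flag_dim J} \<and> q \<in> (!) J ` \<sigma>"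

text \<open>
  The value of \<open>lv\<close> at the vertex \<open>(\<sigma>, q)\<close>.
\<close>

definition last_in :: "'p list \<Rightarrow> nat set \<Rightarrow> 'p \<Rightarrow> nat" where
  "last_in J \<sigma> q = Max {i \<in> \<sigma>. J ! i = q}"

lemma last_in_eqI:
  assumes "l \<in> \<sigma>" "J ! l = q" "\<And>i. i \<in> \<sigma> \<Longrightarrow> J ! i = q \<Longrightarrow> i \<le> l"
  shows "last_in J \<sigma> q = l"
proof -
  have "{i \<in> \<sigma>. J ! i = q} \<subseteq> {..l}" using assms(3) by auto
  hence "finite {i \<in> \<sigma>. J ! i = q}" by (rule finite_subset) simp
  thus ?thesis unfolding last_in_def using assms by (intro Max_eqI) auto
qed

lemma last_in:
  assumes "vertex J \<sigma> q"
  shows "last_in J \<sigma> q \<in> \<sigma>" "J ! last_in J \<sigma> q = q" "i \<in> \<sigma> \<Longrightarrow> J ! i = q \<Longrightarrow> i \<le> last_in J \<sigma> q"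
    "last_in J \<sigma> q \<le> flag_dim J"
proof -
  have fin: "finite {i \<in> \<sigma>. J ! i = q}"
    using assms by (auto simp: vertex_def intro: finite_subset[of _ "{..flag_dim J}"])
  have "{i \<in> \<sigma>. J ! i = q} \<noteq> {}" using assms by (auto simp: vertex_def)
  from Max_in[OF fin this] show "last_in J \<sigma> q \<in> \<sigma>" "J ! last_in J \<sigma> q = q" by (auto simp: last_in_def)
  thus "last_in J \<sigma> q \<le> flag_dim J" using assms by (auto simp: vertex_def)
  show "i \<in> \<sigma> \<Longrightarrow> J ! i = q \<Longrightarrow> i \<le> last_in J \<sigma> q"
    unfolding last_in_def using fin by (intro Max_ge) auto
qed

lemma vertex_image:
  assumes "monotone_to g m n" "vertex (pullback J m g) \<sigma> q" "flag_dim J = n"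
  shows "vertex J (g ` \<sigma>) q" "last_in J (g ` \<sigma>) q = g (last_in (pullback J m g) \<sigma> q)"
proof -
  note g = monotone_toD[OF assms(1)] and l = last_in[OF assms(2)]
  have le: "i \<le> m" if "i \<in> \<sigma>" for i using assms(2) that by (auto simp: vertex_def)
  have "q = J ! g (last_in (pullback J m g) \<sigma> q)" using l by (simp add: le)
  thus "vertex J (g ` \<sigma>) q" using assms(3) g le l(1) by (auto simp: vertex_def)
  show "last_in J (g ` \<sigma>) q = g (last_in (pullback J m g) \<sigma> q)"
    by (rule last_in_eqI) (use l g le in auto)
qed

text \<open>
  The first vertices of the strata.
\<close>

definition minima :: "'p list \<Rightarrow> nat set" where
  "minima J = {i. i \<le> flag_dim J \<and> (i = 0 \<or> J ! (i - 1) \<noteq> J ! i)}"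

lemma ex_minima:
  assumes "i \<le> flag_dim J"
  obtains i' where "i' \<in> minima J" "i' \<le> i" "J ! i' = J ! i"
proof -
  let ?Q = "\<lambda>i'. J ! i' = J ! i"
  define i' where "i' = (LEAST i'. ?Q i')"
  have 1: "?Q i'" unfolding i'_def by (rule LeastI[of ?Q]) simp
  have 2: "i' \<le> i" unfolding i'_def by (rule Least_le) simp
  have "J ! (i' - 1) \<noteq> J ! i" if "i' \<noteq> 0"
    using not_less_Least[of "i' - 1" ?Q] that unfolding i'_def[symmetric] by auto
  hence "i' \<in> minima J" using 1 2 assms by (auto simp: minima_def)
  with 1 2 show ?thesis using that by blast
qed

text \<open>
  What a vertex \<open>(\<sigma>, q)\<close> with value \<open>l\<close> under \<open>lv\<close> becomes after 0, 1, 2 or 3 of the moves from the identity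
  to the idempotent of the section of \<open>lv\<close>. Passing from code 2 to code 3 shrinks the subset, the other transitions
  enlarge it. In every case \<open>q\<close> and the value of \<open>lv\<close> are kept, and no stratum is lost.
\<close>

definition fill :: "'p list \<Rightarrow> nat \<Rightarrow> nat set \<Rightarrow> nat \<Rightarrow> nat set" where
  "fill J c \<sigma> l = (if c = 0 then \<sigma> else if c = 1 then \<sigma> \<union> {..l}
     else if c = 2 then \<sigma> \<union> {..l} \<union> minima J else {..l} \<union> minima J)"

text \<open>
  The moves absorb each other: a later one can be applied before or after an earlier one without any difference.
\<close>

lemma fill_fill: "fill J c (fill J c' \<sigma> l) l = fill J (max c c') \<sigma> l"
  by (auto simp: fill_def max_def)

lemma fill_strata:
  assumes "\<sigma> \<subseteq> {..flag_dim J}" "l \<in> \<sigma>"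
  shows "fill J c \<sigma> l \<subseteq> {..flag_dim J}" "(!) J ` \<sigma> \<subseteq> (!) J ` fill J c \<sigma> l"
proof -
  show "fill J c \<sigma> l \<subseteq> {..flag_dim J}" using assms by (auto simp: fill_def minima_def)
  have "J ! i \<in> (!) J ` minima J" if "i \<in> \<sigma>" for i
  proof -
    have "i \<le> flag_dim J" using assms(1) that by auto
    from ex_minima[OF this] show ?thesis by (metis imageI)
  qed
  thus "(!) J ` \<sigma> \<subseteq> (!) J ` fill J c \<sigma> l" by (auto simp: fill_def)
qed

lemma vertex_fill:
  assumes J: "flag n J" and v: "vertex J \<sigma> q"
  shows "vertex J (fill J c \<sigma> (last_in J \<sigma> q)) q"
    "last_in J (fill J c \<sigma> (last_in J \<sigma> q)) q = last_in J \<sigma> q"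
proof -
  let ?l = "last_in J \<sigma> q"
  note l = last_in[OF v]
  have s: "\<sigma> \<subseteq> {..flag_dim J}" using v by (simp add: vertex_def)
  show "vertex J (fill J c \<sigma> ?l) q"
    using fill_strata[OF s l(1), of c] v by (auto simp: vertex_def)
  have min: "i \<le> ?l" if i: "i \<in> minima J" "J ! i = q" for i
  proof (rule ccontr)
    assume "\<not> i \<le> ?l"
    hence "J ! ?l \<le> J ! (i - 1)" "J ! (i - 1) \<le> J ! i" "i \<noteq> 0"
      using flagD[OF J] i(1) by (auto simp: minima_def)
    thus False using i l(2) by (auto simp: minima_def)
  qed
  show "last_in J (fill J c \<sigma> ?l) q = ?l"
    by (rule last_in_eqI) (use l min in \<open>auto simp: fill_def split: if_splits\<close>)
qed

text \<open>
  A code \<open>c\<close> prescribes how many moves to carry out at the vertices with \<open>lv\<close> equal to \<open>l\<close>. The resulting map is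
  monotone if codes increase with \<open>l\<close> while subsets grow, and if vertices with the shrunk subset (code 3)
  come before those that contain all first vertices (code 2).
\<close>

definition compatible :: "nat \<Rightarrow> (nat \<Rightarrow> nat) \<Rightarrow> bool" where
  "compatible m c \<longleftrightarrow> (\<forall>l l'. l \<le> l' \<and> l' \<le> m \<longrightarrow> c l \<le> c l' \<and> c l' \<le> 2 \<or> c l = 3 \<and> (c l' = 2 \<or> c l' = 3))"

lemma fill_mono:
  assumes "compatible m c" "\<sigma> \<subseteq> \<tau>" "l \<le> l'" "l' \<le> m" "t \<le> t'"
  shows "fill J (c l) \<sigma> t \<subseteq> fill J (c l') \<tau> t'"
proof -
  have "c l \<le> c l' \<and> c l' \<le> 2 \<or> c l = 3 \<and> (c l' = 2 \<or> c l' = 3)"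
    using assms by (auto simp: compatible_def)
  thus ?thesis using assms(2,5) by (auto simp: fill_def)
qed

text \<open>
  Push \<open>\<sigma>\<close> forward along \<open>g\<close>, then carry out the moves prescribed by the code. The code is evaluated in
  the source, which for non-injective \<open>g\<close> is finer than in the target; partners depend on this.
\<close>

definition twist :: "'p list \<Rightarrow> nat \<Rightarrow> (nat \<Rightarrow> nat) \<Rightarrow> (nat \<Rightarrow> nat) \<Rightarrow> nat set \<times> 'p \<Rightarrow> nat set \<times> 'p" where
  "twist J m c g = (\<lambda>(\<sigma>, q). let l = last_in (pullback J m g) \<sigma> q in (fill J (c l) (g ` \<sigma>) (g l), q))"

lemma map_twist_zero: "map (twist J m (\<lambda>_. 0) ((!) \<theta>)) s = sd_flag_map \<theta> s"
  unfolding sd_flag_map_def by (rule map_cong[OF refl]) (auto simp: twist_def fill_def)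

lemma sd_flag_cells:
  "s \<in> cells (sd_flag J) k \<longleftrightarrow> length s = Suc k \<and>
     (\<forall>i\<le>k. vertex J (fst (s ! i)) (snd (s ! i)) \<and> snd (s ! i) \<in> (!) J ` fst (s ! 0)) \<and>
     (\<forall>i j. i \<le> j \<and> j \<le> k \<longrightarrow> fst (s ! i) \<subseteq> fst (s ! j) \<and> snd (s ! i) \<le> snd (s ! j))"
  (is "?L \<longleftrightarrow> ?R")
proof
  assume L: ?L
  hence len: "length s = Suc k" by (simp add: sd_flag_def)
  have hd: "hd s = s ! 0" using len by (cases s) auto
  have m: "s ! i \<in> set s" if "i \<le> k" for i using len that by simp
  have a: "fst (s ! i) \<noteq> {}" "fst (s ! i) \<subseteq> {..flag_dim J}" "snd (s ! i) \<in> (!) J ` fst (s ! 0)" if "i \<le> k" for i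
    using L m[OF that] hd by (fastforce simp: sd_flag_def)+
  have b: "fst (s ! i) \<subseteq> fst (s ! j) \<and> snd (s ! i) \<le> snd (s ! j)" if "i \<le> j" "j \<le> k" for i j
  proof -
    have "sorted_wrt (\<lambda>x y. fst x \<subseteq> fst y \<and> snd x \<le> snd y) s"
      using L by (simp add: sd_flag_def case_prod_unfold)
    thus ?thesis using that len by (cases "i = j") (auto simp: sorted_wrt_iff_nth_less)
  qed
  have c: "vertex J (fst (s ! i)) (snd (s ! i))" if "i \<le> k" for i
    using a[OF that] b[of 0 i] that unfolding vertex_def by blast
  show ?R using len a b c by blast
next
  assume R: ?R
  hence hd: "hd s = s ! 0" by (cases s) auto
  have "\<sigma> \<noteq> {} \<and> \<sigma> \<subseteq> {..flag_dim J} \<and> q \<in> (!) J ` fst (s ! 0)" if "(\<sigma>, q) \<in> set s" for \<sigma> q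
  proof -
    have "\<exists>i\<le>k. s ! i = (\<sigma>, q)" using that R by (auto simp: in_set_conv_nth less_Suc_eq_le)
    then obtain i where i: "i \<le> k" "s ! i = (\<sigma>, q)" by blast
    have "vertex J (fst (s ! i)) (snd (s ! i)) \<and> snd (s ! i) \<in> (!) J ` fst (s ! 0)" using R i(1) by blast
    thus ?thesis unfolding i(2) vertex_def by auto
  qed
  moreover have "sorted_wrt (\<lambda>(\<sigma>, q) (\<tau>, r). \<sigma> \<subseteq> \<tau> \<and> q \<le> r) s"
    unfolding sorted_wrt_iff_nth_less case_prod_unfold using R by (simp add: less_Suc_eq_le)
  ultimately show ?L using R hd by (auto simp: sd_flag_def)
qed

lemma last_in_mono:
  assumes "flag n J" "vertex J \<sigma> q" "vertex J \<tau> r" "\<sigma> \<subseteq> \<tau>" "q \<le> r"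
  shows "last_in J \<sigma> q \<le> last_in J \<tau> r"
proof (cases "q = r")
  case True
  thus ?thesis using last_in(1,2)[OF assms(2)] last_in(3)[OF assms(3)] assms(4) by blast
next
  case False
  show ?thesis
  proof (rule ccontr)
    assume "\<not> ?thesis"
    hence "J ! last_in J \<tau> r \<le> J ! last_in J \<sigma> q"
      using flagD(3)[OF assms(1)] last_in(4)[OF assms(2)] flagD(2)[OF assms(1)] by simp
    thus False using last_in(2)[OF assms(2)] last_in(2)[OF assms(3)] assms(5) False by auto
  qed
qed

text \<open>
  The strata \<open>q\<close> of a simplex have to meet its smallest subset; this persists because no stratum gets lost.
\<close>

lemma twist_cells:
  assumes J: "flag n J" and g: "monotone_to g m n" and c: "compatible m c"
    and s: "s \<in> cells (sd_flag (pullback J m g)) k"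
  shows "map (twist J m c g) s \<in> cells (sd_flag J) k"
proof -
  let ?J = "pullback J m g"
  note S = s[unfolded sd_flag_cells]
  note dim = flagD(2)[OF J]
  define l where "l i = last_in ?J (fst (s ! i)) (snd (s ! i))" for i
  have v: "vertex ?J (fst (s ! i)) (snd (s ! i))" if "i \<le> k" for i using S that by blast
  have l: "l i \<le> m" if "i \<le> k" for i using last_in(4)[OF v[OF that]] by (simp add: l_def)
  have tw: "twist J m c g (s ! i) = (fill J (c (l i)) (g ` fst (s ! i)) (g (l i)), snd (s ! i))" for i
    by (simp add: twist_def l_def Let_def split: prod.split)
  have nth: "map (twist J m c g) s ! i = (fill J (c (l i)) (g ` fst (s ! i)) (g (l i)), snd (s ! i))"
    if "i \<le> k" for i using tw S that by simp
  have v': "vertex J (g ` fst (s ! i)) (snd (s ! i))" if "i \<le> k" for i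
    by (rule vertex_image(1)[OF g v[OF that] dim])
  have lin: "l i \<in> fst (s ! i)" if "i \<le> k" for i unfolding l_def by (rule last_in(1)[OF v[OF that]])
  have st: "fill J (c (l i)) (g ` fst (s ! i)) (g (l i)) \<subseteq> {..flag_dim J}"
    "(!) J ` (g ` fst (s ! i)) \<subseteq> (!) J ` fill J (c (l i)) (g ` fst (s ! i)) (g (l i))" if "i \<le> k" for i
    using fill_strata[of "g ` fst (s ! i)" J "g (l i)"] v'[OF that] lin[OF that] by (auto simp: vertex_def)
  have base: "(!) ?J ` fst (s ! 0) = (!) J ` (g ` fst (s ! 0))"
    using v[of 0] by (force simp: vertex_def image_image intro!: image_cong)
  show ?thesis
    unfolding sd_flag_cells
  proof (intro conjI allI impI)
    show "length (map (twist J m c g) s) = Suc k" using S by simp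
  next
    fix i assume i: "i \<le> k"
    show "vertex J (fst (map (twist J m c g) s ! i)) (snd (map (twist J m c g) s ! i))"
      using st[OF i] v'[OF i] by (auto simp: nth[OF i] vertex_def)
    have "snd (s ! i) \<in> (!) J ` (g ` fst (s ! 0))" using S i base by simp
    thus "snd (map (twist J m c g) s ! i) \<in> (!) J ` fst (map (twist J m c g) s ! 0)"
      using st(2)[of 0] by (auto simp: nth[OF i] nth[of 0])
  next
    fix i j assume ij: "i \<le> j \<and> j \<le> k"
    hence sub: "fst (s ! i) \<subseteq> fst (s ! j)" "snd (s ! i) \<le> snd (s ! j)" using S by blast+
    have "l i \<le> l j" unfolding l_def
      by (rule last_in_mono[OF flag_pullback[OF J g] v v sub]) (use ij in auto)
    thus "fst (map (twist J m c g) s ! i) \<subseteq> fst (map (twist J m c g) s ! j)"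
      "snd (map (twist J m c g) s ! i) \<le> snd (map (twist J m c g) s ! j)"
      using fill_mono[OF c, of "g ` fst (s ! i)" "g ` fst (s ! j)" "l i" "l j"] sub ij l[of j]
        monotone_toD(2)[OF g, of "l i" "l j"] by (auto simp: nth image_mono)
  qed
qed

lemma sd_flag_act:
  assumes "s \<in> cells (sd_flag J) k" "\<theta> \<in> simplex_maps k' k"
  shows "map ((!) s) \<theta> \<in> cells (sd_flag J) k'"
proof -
  note S = assms(1)[unfolded sd_flag_cells] and T = simplex_mapsD[OF assms(2)]
  have nth: "map ((!) s) \<theta> ! i = s ! (\<theta> ! i)" if "i \<le> k'" for i using T(1) that by simp
  show ?thesis
    unfolding sd_flag_cells
  proof (intro conjI allI impI)
    fix i assume i: "i \<le> k'"
    show "vertex J (fst (map ((!) s) \<theta> ! i)) (snd (map ((!) s) \<theta> ! i))" using S T(2)[OF i] nth[OF i] by simp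
    have "snd (s ! (\<theta> ! i)) \<in> (!) J ` fst (s ! 0)" "fst (s ! 0) \<subseteq> fst (s ! (\<theta> ! 0))"
      using S T(2)[OF i] T(2)[of 0] by auto
    thus "snd (map ((!) s) \<theta> ! i) \<in> (!) J ` fst (map ((!) s) \<theta> ! 0)" using nth[OF i] nth[of 0] by auto
  next
    fix i j assume ij: "i \<le> j \<and> j \<le> k'"
    hence "\<theta> ! i \<le> \<theta> ! j" "\<theta> ! j \<le> k" using T(2,3) by auto
    thus "fst (map ((!) s) \<theta> ! i) \<subseteq> fst (map ((!) s) \<theta> ! j)"
      "snd (map ((!) s) \<theta> ! i) \<le> snd (map ((!) s) \<theta> ! j)" using S ij nth by auto
  qed (use T(1) in simp)
qed

section \<open>Pulling back simplices of \<open>Ex\<^sub>P\<close> along filling maps\<close>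

text \<open>
  Precomposition of a simplex of \<open>Ex\<^sub>P\<close> with a twisted map. For the code 0 this is the simplicial action
  (\<open>act_Ex\<close> below).
\<close>

definition pull :: "nat \<Rightarrow> (nat \<Rightarrow> nat) \<Rightarrow> (nat \<Rightarrow> nat) \<Rightarrow> ('a, 'p::order) Ex_simplex \<Rightarrow> ('a, 'p) Ex_simplex" where
  "pull m c g F = (pullback (fst F) m g,
     \<lambda>k s. if s \<in> cells (sd_flag (pullback (fst F) m g)) k then snd F k (map (twist (fst F) m c g) s) else undefined)"

lemma fst_pull [simp]: "fst (pull m c g F) = pullback (fst F) m g"
  by (simp add: pull_def)

lemma twist_cong:
  assumes "\<And>i. i \<le> m \<Longrightarrow> c i = c' i" "\<And>i. i \<le> m \<Longrightarrow> g i = g' i" "vertex (pullback J m g) \<sigma> q"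
  shows "twist J m c g (\<sigma>, q) = twist J m c' g' (\<sigma>, q)"
proof -
  have "last_in (pullback J m g) \<sigma> q \<le> m" using last_in(4)[OF assms(3)] by simp
  moreover have "g ` \<sigma> = g' ` \<sigma>" using assms(2,3) by (auto simp: vertex_def intro!: image_cong)
  moreover have "pullback J m g = pullback J m g'" by (rule pullback_cong) (simp add: assms(2))
  ultimately show ?thesis using assms(1,2) by (simp add: twist_def)
qed

lemma vertex_of_cell: "s \<in> cells (sd_flag J) k \<Longrightarrow> (\<sigma>, q) \<in> set s \<Longrightarrow> vertex J \<sigma> q"
  unfolding sd_flag_cells in_set_conv_nth by (metis fst_conv less_Suc_eq_le snd_conv)

lemma pull_cong:
  assumes "\<And>i. i \<le> m \<Longrightarrow> c i = c' i" "\<And>i. i \<le> m \<Longrightarrow> g i = g' i"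
  shows "pull m c g F = pull m c' g' F"
proof -
  have p: "pullback (fst F) m g' = pullback (fst F) m g" by (rule pullback_cong) (simp add: assms(2))
  have "map (twist (fst F) m c g) s = map (twist (fst F) m c' g') s"
    if "s \<in> cells (sd_flag (pullback (fst F) m g)) k" for s k
  proof (rule map_cong[OF refl])
    fix x assume "x \<in> set s"
    hence v: "vertex (pullback (fst F) m g) (fst x) (snd x)" using vertex_of_cell[OF that] by simp
    have "twist (fst F) m c g (fst x, snd x) = twist (fst F) m c' g' (fst x, snd x)"
      by (rule twist_cong[OF _ _ v]) (simp_all add: assms)
    thus "twist (fst F) m c g x = twist (fst F) m c' g' x" by simp
  qed
  hence "snd F k (map (twist (fst F) m c g) s) = snd F k (map (twist (fst F) m c' g') s)"
    if "s \<in> cells (sd_flag (pullback (fst F) m g)) k" for s k using that by metis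
  thus ?thesis by (auto simp: pull_def p fun_eq_iff)
qed

text \<open>
  Two pullbacks compose to a single one as soon as the underlying operations on subsets do, at every value \<open>i\<close> of
  \<open>lv\<close>. All identities between faces, degeneracies and partners are instances.
\<close>

lemma pull_pull:
  assumes J: "flag n (fst F)" and g: "monotone_to g m n" and h: "monotone_to h l m" and c': "compatible l c'"
    and eq: "\<And>i \<tau>. i \<le> l \<Longrightarrow> i \<in> \<tau> \<Longrightarrow> \<tau> \<subseteq> {..l} \<Longrightarrow>
      fill (fst F) (c (h i)) (g ` fill (pullback (fst F) m g) (c' i) (h ` \<tau>) (h i)) (g (h i))
      = fill (fst F) (c'' i) (g ` h ` \<tau>) (g (h i))"
  shows "pull l c' h (pull m c g F) = pull l c'' (\<lambda>i. g (h i)) F"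
proof -
  let ?J = "fst F" let ?J' = "pullback (fst F) m g" let ?J'' = "pullback (fst F) l (\<lambda>i. g (h i))"
  have J': "flag m ?J'" by (rule flag_pullback[OF J g])
  have pp: "pullback ?J' l h = ?J''" by (rule pullback_pullback[OF h])
  have tw: "twist ?J m c g (twist ?J' l c' h (\<sigma>, q)) = twist ?J l c'' (\<lambda>i. g (h i)) (\<sigma>, q)"
    if v: "vertex ?J'' \<sigma> q" for \<sigma> q
  proof -
    let ?l = "last_in ?J'' \<sigma> q"
    have v'': "vertex (pullback ?J' l h) \<sigma> q" using v pp by simp
    have l: "?l \<le> l" "?l \<in> \<sigma>" "\<sigma> \<subseteq> {..l}" using last_in[OF v] v by (auto simp: vertex_def)
    note vi = vertex_image[OF h v'' flagD(2)[OF J']]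
    have "last_in ?J' (fill ?J' (c' ?l) (h ` \<sigma>) (h ?l)) q = h ?l"
      using vertex_fill(2)[OF J' vi(1)] vi(2) pp by simp
    thus ?thesis using eq[OF l] by (simp add: twist_def pp Let_def image_image)
  qed
  have "snd (pull m c g F) k (map (twist ?J' l c' h) s) = snd F k (map (twist ?J l c'' (\<lambda>i. g (h i))) s)"
    if s: "s \<in> cells (sd_flag ?J'') k" for s k
  proof -
    have "map (twist ?J m c g) (map (twist ?J' l c' h) s) = map (twist ?J l c'' (\<lambda>i. g (h i))) s"
      using tw vertex_of_cell[OF s] by auto
    moreover have "map (twist ?J' l c' h) s \<in> cells (sd_flag ?J') k"
      by (rule twist_cells[OF J' h c']) (simp add: pp s)
    ultimately show ?thesis by (simp add: pull_def del: map_map)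
  qed
  thus ?thesis by (auto simp: pull_def[of l] pp fun_eq_iff)
qed

lemma image_atMost_surj:
  assumes "monotone_to g m n" "g ` {..m} = {..n}" "l \<le> m"
  shows "g ` {..l} = {..g l}"
proof (intro equalityI subsetI)
  fix x assume "x \<in> {..g l}"
  hence "x \<in> g ` {..m}" using assms monotone_toD(1)[OF assms(1,3)] by auto
  then obtain i where i: "i \<le> m" "x = g i" by auto
  show "x \<in> g ` {..l}"
  proof (cases "i \<le> l")
    case False
    hence "g l \<le> x" using monotone_toD(2)[OF assms(1), of l i] i by simp
    thus ?thesis using \<open>x \<in> {..g l}\<close> by auto
  qed (use i in auto)
qed (use assms monotone_toD(2)[OF assms(1)] in auto)

lemma image_minima_surj:
  assumes J: "flag n J" and g: "monotone_to g m n" "g ` {..m} = {..n}"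
  shows "g ` minima (pullback J m g) = minima J"
proof (intro equalityI subsetI)
  fix x assume "x \<in> g ` minima (pullback J m g)"
  then obtain i where i: "x = g i" "i \<le> m" "i = 0 \<or> J ! g (i - 1) \<noteq> J ! g i"
    by (auto simp: minima_def)
  show "x \<in> minima J"
  proof (cases "x = 0")
    case False
    have "0 \<in> g ` {..0}" using image_atMost_surj[OF g, of 0] by auto
    hence "i \<noteq> 0" using i(1) False by (cases i) auto
    hence ne: "J ! g (i - 1) \<noteq> J ! g i" using i(3) by simp
    have "x - 1 \<in> g ` {..i}" using image_atMost_surj[OF g i(2)] i(1) by auto
    then obtain i' where i': "i' \<le> i" "g i' = x - 1" by auto
    hence "i' \<noteq> i" using False i(1) by auto
    hence "g i' \<le> g (i - 1)" "g (i - 1) \<le> g i"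
      using i' i(2) monotone_toD(2)[OF g(1), of i' "i - 1"] monotone_toD(2)[OF g(1), of "i - 1" i] by auto
    moreover have "g (i - 1) \<noteq> g i" using ne by auto
    ultimately have "g (i - 1) = x - 1" using i' i(1) by linarith
    thus ?thesis using ne i(1) monotone_toD(1)[OF g(1) i(2)] flagD(2)[OF J] by (auto simp: minima_def)
  qed (simp add: minima_def)
next
  fix x assume x: "x \<in> minima J"
  hence xn: "x \<le> n" using flagD(2)[OF J] by (simp add: minima_def)
  define i where "i = (LEAST i. i \<le> m \<and> g i = x)"
  have "\<exists>i. i \<le> m \<and> g i = x" using xn g(2) by (metis atMost_iff imageE)
  hence i: "i \<le> m" "g i = x" unfolding i_def by (metis (mono_tags, lifting) LeastI)+
  have "J ! g (i - 1) \<noteq> J ! g i" if "i \<noteq> 0"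
  proof -
    have "g (i - 1) \<noteq> x"
      using not_less_Least[of "i - 1" "\<lambda>i. i \<le> m \<and> g i = x"] that i(1) unfolding i_def[symmetric] by auto
    moreover have "g (i - 1) \<le> x" using monotone_toD(2)[OF g(1), of "i - 1" i] i by simp
    ultimately have lt: "g (i - 1) \<le> x - 1" "x \<noteq> 0" by auto
    hence "J ! (x - 1) \<noteq> J ! x" using x by (simp add: minima_def)
    moreover have "J ! g (i - 1) \<le> J ! (x - 1)" "J ! (x - 1) \<le> J ! x"
      using flagD(3)[OF J] lt xn by auto
    ultimately show ?thesis using i by auto
  qed
  hence "i \<in> minima (pullback J m g)" using i by (auto simp: minima_def)
  thus "x \<in> g ` minima (pullback J m g)" using i by blast
qed

text \<open>
  Surjections preserve initial segments and first vertices, so they commute with all moves.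
\<close>

lemma fill_image_surj:
  assumes "flag n J" "monotone_to g m n" "g ` {..m} = {..n}" "l \<le> m"
  shows "g ` fill (pullback J m g) c \<sigma> l = fill J c (g ` \<sigma>) (g l)"
  using image_atMost_surj[OF assms(2-4)] image_minima_surj[OF assms(1-3)]
  by (simp add: fill_def image_Un)

lemma pull_pull_surj:
  assumes "flag n (fst F)" "monotone_to g m n" "g ` {..m} = {..n}" "monotone_to h l m" "compatible l c'"
  shows "pull l c' h (pull m c g F) = pull l (\<lambda>i. max (c (h i)) (c' i)) (\<lambda>i. g (h i)) F"
proof (rule pull_pull[OF assms(1,2,4,5)])
  fix i \<tau> assume "i \<le> l"
  hence "h i \<le> m" using monotone_toD(1)[OF assms(4)] by simp
  thus "fill (fst F) (c (h i)) (g ` fill (pullback (fst F) m g) (c' i) (h ` \<tau>) (h i)) (g (h i))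
      = fill (fst F) (max (c (h i)) (c' i)) (g ` h ` \<tau>) (g (h i))"
    using fill_image_surj[OF assms(1-3)] by (simp add: fill_fill)
qed

lemma compatible_0 [simp]: "compatible m (\<lambda>_. 0)"
  by (simp add: compatible_def)

lemma pull_act:
  assumes "flag n (fst F)" "monotone_to g m n" "monotone_to h l m"
  shows "pull l (\<lambda>_. 0) h (pull m c g F) = pull l (\<lambda>i. c (h i)) (\<lambda>i. g (h i)) F"
  by (rule pull_pull[OF assms]) (simp_all add: fill_def)

text \<open>
  Invariance under the moves prescribed by \<open>c\<close>.
\<close>

definition good :: "nat \<Rightarrow> (nat \<Rightarrow> nat) \<Rightarrow> ('a, 'p::order) Ex_simplex \<Rightarrow> bool" where
  "good n c F \<longleftrightarrow> pull n c (\<lambda>i. i) F = F"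

text \<open>
  Invariance under \<open>c\<close> allows the moves of \<open>c\<close> to be carried out additionally in every pullback.
\<close>

lemma pull_good:
  assumes "flag n (fst F)" "good n c F" "monotone_to h l n" "compatible l c'"
  shows "pull l c' h F = pull l (\<lambda>i. max (c (h i)) (c' i)) h F"
  using pull_pull_surj[OF assms(1) monotone_to_id _ assms(3,4), of c] assms(2) by (simp add: good_def)

lemma good_mono:
  assumes "flag n (fst F)" "good n c F" "compatible n c'" "\<And>i. i \<le> n \<Longrightarrow> c' i \<le> c i"
  shows "good n c' F"
proof -
  have "pull n c' (\<lambda>i. i) F = pull n c (\<lambda>i. i) F"
    unfolding pull_good[OF assms(1,2) monotone_to_id assms(3)] by (rule pull_cong) (simp_all add: assms(4) max_absorb1)
  thus ?thesis using assms(2) by (simp add: good_def)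
qed

section \<open>\<open>Ex\<^sub>P\<close> as a stratified simplicial set\<close>

lemma Ex_cells:
  "F \<in> cells (Ex_P P K) n \<longleftrightarrow> fst F \<in> cells (nerve P) n \<and> snd F \<in> strat_hom (sd_flag (fst F)) K"
  by (cases F) (simp add: Ex_P_def)

lemma Ex_flag: "F \<in> cells (Ex_P P K) n \<Longrightarrow> flag n (fst F)"
  by (simp add: Ex_cells nerve_def flag_def)

lemma strat_homD:
  assumes "f \<in> strat_hom X Y"
  shows "simplicial_map X Y f" "x \<in> cells X n \<Longrightarrow> strat Y n (f n x) = strat X n x"
    "x \<notin> cells X n \<Longrightarrow> f n x = undefined"
  using assms by (auto simp: strat_hom_def strat_map_def)

lemma snd_twist [simp]: "snd (twist J m c g x) = snd x"
  by (simp add: twist_def Let_def split: prod.split)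

lemma map_nth_map:
  "(\<And>i. i \<in> set \<theta> \<Longrightarrow> i < length s) \<Longrightarrow> map h (map ((!) s) \<theta>) = map ((!) (map h s)) \<theta>"
  by auto

lemma pull_in_Ex:
  assumes F: "F \<in> cells (Ex_P P K) n" and g: "monotone_to g m n" and c: "compatible m c"
  shows "pull m c g F \<in> cells (Ex_P P K) m"
proof -
  let ?J = "fst F" let ?J' = "pullback (fst F) m g" let ?f = "snd (pull m c g F)"
  have J: "flag n ?J" by (rule Ex_flag[OF F])
  have hom: "snd F \<in> strat_hom (sd_flag ?J) K" and JP: "set ?J \<subseteq> P"
    using F by (auto simp: Ex_cells nerve_def)
  note h = strat_homD[OF hom]
  have f: "?f k s = snd F k (map (twist ?J m c g) s)" if "s \<in> cells (sd_flag ?J') k" for k s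
    using that by (simp add: pull_def)
  have tw: "map (twist ?J m c g) s \<in> cells (sd_flag ?J) k" if "s \<in> cells (sd_flag ?J') k" for k s
    by (rule twist_cells[OF J g c that])
  have "simplicial_map (sd_flag ?J') K ?f"
    unfolding simplicial_map_def
  proof (intro allI ballI conjI)
    fix k s assume s: "s \<in> cells (sd_flag ?J') k"
    show "?f k s \<in> cells K k" unfolding f[OF s] by (rule simplicial_mapD(1)[OF h(1) tw[OF s]])
    fix k' \<theta> assume t: "\<theta> \<in> simplex_maps k' k"
    have len: "i < length s" if "i \<in> set \<theta>" for i
      using that s t by (auto simp: sd_flag_cells simplex_maps_def)
    have "?f k' (map ((!) s) \<theta>) = snd F k' (map ((!) (map (twist ?J m c g) s)) \<theta>)"
      unfolding f[OF sd_flag_act[OF s t]] by (subst map_nth_map[of \<theta> s, OF len]) simp_all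
    also have "\<dots> = act K k (?f k s) \<theta>"
      using simplicial_mapD(2)[OF h(1) tw[OF s] t] f[OF s] by (simp add: sd_flag_def)
    finally show "?f k' (act (sd_flag ?J') k s \<theta>) = act K k (?f k s) \<theta>" by (simp add: sd_flag_def)
  qed
  moreover have "strat K k (?f k s) = strat (sd_flag ?J') k s" if s: "s \<in> cells (sd_flag ?J') k" for k s
    using h(2)[OF tw[OF s]] f[OF s] by (simp add: sd_flag_def comp_def)
  moreover have "?f k s = undefined" if "s \<notin> cells (sd_flag ?J') k" for k s
    using that by (simp add: pull_def)
  ultimately have "?f \<in> strat_hom (sd_flag ?J') K" by (simp add: strat_hom_def strat_map_def)
  moreover have "?J' \<in> cells (nerve P) m"
  proof -
    have "?J ! g i \<in> P" if "i \<le> m" for i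
      using JP flagD(1)[OF J] monotone_toD(1)[OF g that] nth_mem[of "g i" ?J] by auto
    hence "set ?J' \<subseteq> P" by (auto simp: pullback_def simp del: upt_Suc)
    thus ?thesis using flag_pullback[OF J g] by (simp add: nerve_def flag_def)
  qed
  ultimately show ?thesis by (simp add: Ex_cells)
qed

lemma act_Ex:
  assumes "\<theta> \<in> simplex_maps m n"
  shows "act (Ex_P P K) n F \<theta> = pull m (\<lambda>_. 0) ((!) \<theta>) F"
proof -
  have p: "pullback (fst F) m ((!) \<theta>) = map ((!) (fst F)) \<theta>"
    by (rule pullback_simplex_maps[OF assms])
  show ?thesis unfolding pull_def p by (simp add: Ex_P_def case_prod_unfold map_twist_zero cong: if_cong)
qed

lemma act_Ex_mk:
  assumes "monotone_to g m n"
  shows "act (Ex_P P K) n F (mk m g) = pull m (\<lambda>_. 0) g F"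
proof -
  have "mk m g \<in> simplex_maps m n"
    using monotone_toD[OF assms] by (intro mk_simplex_maps) auto
  thus ?thesis by (simp add: act_Ex pull_cong[of m _ _ "(!) (mk m g)" g])
qed

lemma good_zero:
  assumes F: "F \<in> cells (Ex_P P K) n" and c: "\<And>i. i \<le> n \<Longrightarrow> c i = 0"
  shows "good n c F"
proof -
  note J = Ex_flag[OF F]
  have p: "pullback (fst F) n (\<lambda>i. i) = fst F" by (rule pullback_id[OF flagD(1)[OF J]])
  have tw: "map (twist (fst F) n (\<lambda>_. 0) (\<lambda>i. i)) s = s" for s
    by (rule map_idI) (auto simp: twist_def fill_def)
  have "snd F k s = undefined" if "s \<notin> cells (sd_flag (fst F)) k" for k s
    using F that unfolding Ex_cells by (blast intro: strat_homD(3))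
  hence "pull n (\<lambda>_. 0) (\<lambda>i. i) F = F"
    by (auto simp: pull_def p tw prod_eq_iff fun_eq_iff)
  moreover have "pull n c (\<lambda>i. i) F = pull n (\<lambda>_. 0) (\<lambda>i. i) F" by (rule pull_cong) (simp_all add: c)
  ultimately show ?thesis by (simp add: good_def)
qed

lemma stratified_Ex: "stratified P (Ex_P P K)"
proof -
  have "simplicial_set (Ex_P P K)"
    unfolding simplicial_set_def
  proof (intro conjI allI ballI)
    fix n F assume F: "F \<in> cells (Ex_P P K) n"
    show "act (Ex_P P K) n F [0..<Suc n] = F"
      using good_zero[OF F, of "\<lambda>_. 0"] act_Ex_mk[OF monotone_to_id, of P K n F]
      by (simp add: good_def mk_id del: upt_Suc)
    fix m \<theta> assume t: "\<theta> \<in> simplex_maps m n"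
    note mt = monotone_to_simplex_maps[OF t]
    show "act (Ex_P P K) n F \<theta> \<in> cells (Ex_P P K) m"
      unfolding act_Ex[OF t] by (rule pull_in_Ex[OF F mt]) simp
    fix l \<phi> assume p: "\<phi> \<in> simplex_maps l m"
    have "act (Ex_P P K) m (act (Ex_P P K) n F \<theta>) \<phi> = pull l (\<lambda>_. 0) (\<lambda>i. \<theta> ! (\<phi> ! i)) F"
      unfolding act_Ex[OF t] act_Ex[OF p]
      by (rule pull_act[OF Ex_flag[OF F] mt monotone_to_simplex_maps[OF p]])
    also have "\<dots> = act (Ex_P P K) n F (map ((!) \<theta>) \<phi>)"
      unfolding act_Ex[OF comp_simplex_maps[OF t p]]
      by (rule pull_cong) (simp_all add: simplex_mapsD(1)[OF p])
    finally show "act (Ex_P P K) m (act (Ex_P P K) n F \<theta>) \<phi> = act (Ex_P P K) n F (map ((!) \<theta>) \<phi>)" .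
  qed
  thus ?thesis
    by (auto simp: stratified_def simplicial_map_def Ex_P_def nerve_def)
qed

section \<open>The pairing on \<open>Ex\<^sub>P\<close>\<close>

text \<open>
  The codes along the way from the identity to the idempotent. In phases 0 and 1 the move number \<open>p\<close> (counted
  from 0) has been carried out for \<open>l \<ge> R\<close>, so \<open>R\<close> decreases; in phase 2 it has been carried out for \<open>l < R\<close>, so
  \<open>R\<close> increases.
\<close>

definition phase :: "nat \<Rightarrow> nat \<Rightarrow> nat \<Rightarrow> nat" where
  "phase p R l = (if p = 0 then (if l < R then 0 else 1) else if p = 1 then (if l < R then 1 else 2)
     else (if l < R then 3 else 2))"

lemma compatible_phase [simp]: "compatible m (phase p R)"
  by (auto simp: compatible_def phase_def)

lemma compatible_3 [simp]: "compatible m (\<lambda>_. 3)"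
  by (simp add: compatible_def)

lemma phase_le_3: "phase p R l \<le> 3"
  by (simp add: phase_def)

text \<open>
  The step \<open>(p, r)\<close> leads from the code \<open>phase p (horn_index p r)\<close> to the code \<open>phase p (opposite_index p r)\<close>; the
  two differ at \<open>l = r\<close> only. As vertices of the partner, the two indices are the copies of \<open>r\<close>: the one whose
  omission gives back the simplex, and the other one.
\<close>

definition horn_index :: "nat \<Rightarrow> nat \<Rightarrow> nat" where
  "horn_index p r = (if p = 2 then r else Suc r)"

definition opposite_index :: "nat \<Rightarrow> nat \<Rightarrow> nat" where
  "opposite_index p r = (if p = 2 then Suc r else r)"

text \<open>
  \<open>(p, r)\<close> is the first step that changes \<open>F\<close>.
\<close>

definition state :: "nat \<Rightarrow> nat \<Rightarrow> nat \<Rightarrow> ('a, 'p::order) Ex_simplex \<Rightarrow> bool" where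
  "state n p r F \<longleftrightarrow> p \<le> 2 \<and> r \<le> n \<and> good n (phase p (horn_index p r)) F \<and>
     \<not> good n (phase p (opposite_index p r)) F"

text \<open>
  The partner. Counted in the flag with \<open>r\<close> repeated, the code is that of a single stage of the phase: it lies past
  the step \<open>(p, r)\<close> at one copy of \<open>r\<close> and before it at the other.
\<close>

definition extend :: "nat \<Rightarrow> nat \<Rightarrow> nat \<Rightarrow> ('a, 'p::order) Ex_simplex \<Rightarrow> ('a, 'p) Ex_simplex" where
  "extend p r n F = pull (Suc n) (phase p (Suc r)) (merge r) F"

text \<open>
  The number of steps that follow \<open>(p, r)\<close>.
\<close>

definition level :: "nat \<Rightarrow> nat \<Rightarrow> nat \<Rightarrow> nat" where
  "level n p r = (if p = 0 then 2 * Suc n + r else if p = 1 then Suc n + r else n - r)"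

lemma level_less: "r \<le> n \<Longrightarrow> level n p r < 3 * Suc n"
  by (auto simp: level_def)

text \<open>
  Along the list of steps the codes increase at every \<open>l\<close>, so each step is implied by the later ones.
\<close>

lemma phase_level_mono:
  assumes "p \<le> 2" "p' \<le> 2" "r \<le> n" "r' \<le> n" "level n p r < level n p' r'" "l \<le> n"
  shows "phase p' (opposite_index p' r') l \<le> phase p (horn_index p r) l"
proof -
  have "p = 0 \<or> p = 1 \<or> p = 2" "p' = 0 \<or> p' = 1 \<or> p' = 2" using assms(1,2) by auto
  thus ?thesis using assms(3-)
    by (elim disjE) (auto simp: phase_def level_def opposite_index_def horn_index_def)
qed

lemma level_inj:
  assumes "p \<le> 2" "p' \<le> 2" "r \<le> n" "r' \<le> n" "level n p r = level n p' r'"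
  shows "p = p' \<and> r = r'"
  using assms by (auto simp: level_def split: if_splits)

lemma state_unique:
  assumes J: "flag n (fst F)" and s: "state n p r F" "state n p' r' F"
  shows "p = p'" "r = r'"
proof -
  have no: False if "state n p r F" "state n p' r' F" "level n p r < level n p' r'" for p r p' r'
  proof -
    have "good n (phase p' (opposite_index p' r')) F"
      by (rule good_mono[OF J, of "phase p (horn_index p r)"])
        (use that phase_level_mono[of p p' r n r'] in \<open>auto simp: state_def\<close>)
    thus False using that(2) by (simp add: state_def)
  qed
  have "level n p r = level n p' r'" using no[OF s] no[OF s(2,1)]
    by (cases rule: linorder_cases[of "level n p r" "level n p' r'"]) auto
  thus "p = p'" "r = r'" using level_inj[of p p' r n r'] s by (auto simp: state_def)
qed

lemma switch:
  assumes "\<not> Q 0" "Q (Suc n)"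
  shows "\<exists>r\<le>n. \<not> Q r \<and> Q (Suc r)"
  using assms(2)
proof (induction n)
  case (Suc n)
  show ?case
  proof (cases "Q (Suc n)")
    case True
    with Suc show ?thesis using le_SucI by blast
  qed (use Suc.prems in blast)
qed (use assms(1) in blast)

lemma good_cong: "(\<And>i. i \<le> n \<Longrightarrow> c i = c' i) \<Longrightarrow> good n c F \<longleftrightarrow> good n c' F"
  using pull_cong[of n c c' "\<lambda>i. i" "\<lambda>i. i" F] by (simp add: good_def)

text \<open>
  The identity leaves \<open>F\<close> unchanged and the last code does not, so invariance is lost at some step. The last code of
  a phase agrees with the first code of the next one.
\<close>

lemma state_exists:
  assumes F: "F \<in> cells (Ex_P P K) n" and nA: "\<not> good n (\<lambda>_. 3) F"
  obtains p r where "state n p r F"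
proof -
  have start: "good n (phase 0 (Suc n)) F" by (rule good_zero[OF F]) (simp add: phase_def)
  have link1: "good n (phase 1 (Suc n)) F \<longleftrightarrow> good n (phase 0 0) F"
    by (rule good_cong) (simp add: phase_def)
  have link2: "good n (phase 2 0) F \<longleftrightarrow> good n (phase 1 0) F"
    by (rule good_cong) (simp add: phase_def)
  have stop: "\<not> good n (phase 2 (Suc n)) F"
    using nA good_cong[of n "phase 2 (Suc n)" "\<lambda>_. 3" F] by (simp add: phase_def)
  consider "\<not> good n (phase 0 0) F" | "good n (phase 0 0) F" "\<not> good n (phase 1 0) F" | "good n (phase 1 0) F"
    by blast
  thus ?thesis
  proof cases
    case 1
    with start switch[of "\<lambda>R. good n (phase 0 R) F" n] that[of 0] show ?thesis
      by (auto simp: state_def opposite_index_def horn_index_def)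
  next
    case 2
    with link1 switch[of "\<lambda>R. good n (phase 1 R) F" n] that[of 1] show ?thesis
      by (auto simp: state_def opposite_index_def horn_index_def)
  next
    case 3
    with link2 stop switch[of "\<lambda>R. \<not> good n (phase 2 R) F" n] that[of 2] show ?thesis
      by (auto simp: state_def opposite_index_def horn_index_def)
  qed
qed

lemma merge_surj: "r \<le> n \<Longrightarrow> merge r ` {..Suc n} = {..n}"
proof (intro equalityI subsetI)
  fix x assume "r \<le> n" "x \<in> {..n}"
  thus "x \<in> merge r ` {..Suc n}"
    by (intro image_eqI[of _ _ "if x \<le> r then x else Suc x"]) (auto simp: merge_def)
qed (auto simp: merge_def)

lemma extend_in_Ex: "F \<in> cells (Ex_P P K) n \<Longrightarrow> r \<le> n \<Longrightarrow> extend p r n F \<in> cells (Ex_P P K) (Suc n)"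
  unfolding extend_def by (rule pull_in_Ex[OF _ monotone_to_merge]) simp_all

lemma face_extend:
  assumes F: "F \<in> cells (Ex_P P K) n" and r: "r \<le> n"
  shows "act (Ex_P P K) (Suc n) (extend p r n F) (mk n (skip j))
    = pull n (\<lambda>i. phase p (Suc r) (skip j i)) (\<lambda>i. merge r (skip j i)) F"
  unfolding act_Ex_mk[OF monotone_to_skip] extend_def
  by (rule pull_act[OF Ex_flag[OF F] monotone_to_merge[OF r] monotone_to_skip])

text \<open>
  Omitting one copy of \<open>r\<close> leaves the other one, at which the step \<open>(p, r)\<close> has either not been carried out or been
  carried out.
\<close>

lemma face_extend_special:
  assumes F: "F \<in> cells (Ex_P P K) n" and r: "r \<le> n" and p: "p \<le> 2"
  shows "act (Ex_P P K) (Suc n) (extend p r n F) (mk n (skip (horn_index p r)))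
      = pull n (phase p (horn_index p r)) (\<lambda>i. i) F"
    and "act (Ex_P P K) (Suc n) (extend p r n F) (mk n (skip (opposite_index p r)))
      = pull n (phase p (opposite_index p r)) (\<lambda>i. i) F"
  unfolding face_extend[OF F r]
  by (rule pull_cong; use p in \<open>auto simp: phase_def skip_def merge_def horn_index_def opposite_index_def\<close>)+

text \<open>
  The partner is invariant under its own code. If it were also invariant under the following step, then so would be
  its face \<open>F\<close>.
\<close>

lemma state_extend:
  assumes F: "F \<in> cells (Ex_P P K) n" and s: "state n p r F"
  shows "state (Suc n) p (opposite_index p r) (extend p r n F)"
proof -
  have r: "r \<le> n" and p: "p \<le> 2" and g: "good n (phase p (horn_index p r)) F"
    and ng: "\<not> good n (phase p (opposite_index p r)) F" using s by (auto simp: state_def)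
  note J = Ex_flag[OF F] and mm = monotone_to_merge[OF r]
  let ?E = "extend p r n F" let ?r = "opposite_index p r"
  have R: "horn_index p ?r = Suc r" by (simp add: horn_index_def opposite_index_def)
  have pE: "pull (Suc n) (phase p R) (\<lambda>i. i) ?E
      = pull (Suc n) (\<lambda>i. max (phase p (Suc r) i) (phase p R i)) (merge r) F" for R
    unfolding extend_def by (rule pull_pull_surj[OF J mm merge_surj[OF r] monotone_to_id]) simp
  have "good (Suc n) (phase p (Suc r)) ?E" unfolding good_def pE by (simp add: extend_def)
  moreover have "\<not> good (Suc n) (phase p (opposite_index p ?r)) ?E"
  proof
    let ?R = "opposite_index p ?r" let ?k = "horn_index p r"
    assume "good (Suc n) (phase p ?R) ?E"
    hence eq: "?E = pull (Suc n) (\<lambda>i. max (phase p (Suc r) i) (phase p ?R i)) (merge r) F"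
      unfolding good_def pE by simp
    have "F = act (Ex_P P K) (Suc n) ?E (mk n (skip ?k))"
      using g by (simp add: face_extend_special[OF F r p] good_def)
    also have "\<dots> = pull n (\<lambda>_. 0) (skip ?k) ?E" by (rule act_Ex_mk[OF monotone_to_skip])
    also have "\<dots> = pull n (\<lambda>i. max (phase p (Suc r) (skip ?k i)) (phase p ?R (skip ?k i)))
        (\<lambda>i. merge r (skip ?k i)) F"
      by (subst eq) (rule pull_act[OF J mm monotone_to_skip])
    also have "\<dots> = pull n (phase p ?r) (\<lambda>i. i) F"
      by (rule pull_cong)
        (use p in \<open>auto simp: phase_def skip_def merge_def horn_index_def opposite_index_def split: if_splits\<close>)
    finally show False using ng by (simp add: good_def)
  qed
  ultimately show ?thesis using r p R by (simp add: state_def opposite_index_def)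
qed

text \<open>
  Repeating a vertex commutes with repeating \<open>r\<close>, and degeneracies commute with all moves; only the positions shift.
\<close>

lemma extend_degenerate:
  assumes G: "G \<in> cells (Ex_P P K) m" and i: "i \<le> m" and r: "r \<le> Suc m"
    and F: "F = act (Ex_P P K) m G (mk (Suc m) (merge i))"
  shows "degenerate (Ex_P P K) (Suc (Suc m)) (extend p r (Suc m) F)"
proof -
  note J = Ex_flag[OF G] and mi = monotone_to_merge[OF i]
  define r' i' where "r' = (if r \<le> i then r else r - 1)" and "i' = (if r \<le> i then Suc i else i)"
  have r': "r' \<le> m" and i': "i' \<le> Suc m" using r i by (auto simp: r'_def i'_def)
  have "extend p r (Suc m) F = pull (Suc (Suc m)) (phase p (Suc r)) (merge r) (pull (Suc m) (\<lambda>_. 0) (merge i) G)"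
    unfolding extend_def F act_Ex_mk[OF mi] ..
  also have "\<dots> = pull (Suc (Suc m)) (\<lambda>l. max 0 (phase p (Suc r) l)) (\<lambda>l. merge i (merge r l)) G"
    by (rule pull_pull_surj[OF J mi merge_surj[OF i] monotone_to_merge[OF r]]) simp
  also have "\<dots> = pull (Suc (Suc m)) (\<lambda>l. phase p (Suc r') (merge i' l)) (\<lambda>l. merge r' (merge i' l)) G"
    by (rule pull_cong) (auto simp: phase_def merge_def r'_def i'_def)
  also have "\<dots> = pull (Suc (Suc m)) (\<lambda>_. 0) (merge i') (extend p r' m G)"
    unfolding extend_def by (rule pull_act[OF J monotone_to_merge[OF r'] monotone_to_merge[OF i'], symmetric])
  also have "\<dots> = act (Ex_P P K) (Suc m) (extend p r' m G) (mk (Suc (Suc m)) (merge i'))"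
    by (rule act_Ex_mk[OF monotone_to_merge[OF i'], symmetric])
  finally show ?thesis using degenerate_merge[OF extend_in_Ex[OF G r'] i'] by simp
qed

text \<open>
  After two extensions there are three copies of \<open>r\<close>. The step has been carried out at two of them, and these are
  adjacent and cannot be distinguished.
\<close>

lemma extend_extend_degenerate:
  assumes F: "F \<in> cells (Ex_P P K) n" and r: "r \<le> n" and p: "p \<le> 2"
  shows "degenerate (Ex_P P K) (Suc (Suc n)) (extend p (opposite_index p r) (Suc n) (extend p r n F))"
proof -
  note J = Ex_flag[OF F] and mr = monotone_to_merge[OF r]
  let ?r = "opposite_index p r" let ?i = "horn_index p r"
  have r': "?r \<le> Suc n" and i: "?i \<le> Suc n" using r by (auto simp: opposite_index_def horn_index_def)
  have "extend p ?r (Suc n) (extend p r n F)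
      = pull (Suc (Suc n)) (\<lambda>l. max (phase p (Suc r) (merge ?r l)) (phase p (Suc ?r) l)) (\<lambda>l. merge r (merge ?r l)) F"
    unfolding extend_def
    by (rule pull_pull_surj[OF J mr merge_surj[OF r] monotone_to_merge[OF r']]) simp
  also have "\<dots> = pull (Suc (Suc n)) (\<lambda>l. phase p (Suc r) (merge ?i l)) (\<lambda>l. merge r (merge ?i l)) F"
    by (rule pull_cong) (use p in \<open>auto simp: phase_def merge_def horn_index_def opposite_index_def\<close>)
  also have "\<dots> = pull (Suc (Suc n)) (\<lambda>_. 0) (merge ?i) (extend p r n F)"
    unfolding extend_def by (rule pull_act[OF J mr monotone_to_merge[OF i], symmetric])
  also have "\<dots> = act (Ex_P P K) (Suc n) (extend p r n F) (mk (Suc (Suc n)) (merge ?i))"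
    by (rule act_Ex_mk[OF monotone_to_merge[OF i], symmetric])
  finally show ?thesis using degenerate_merge[OF extend_in_Ex[OF F r] i] by simp
qed

text \<open>
  If the step did not change \<open>G\<close>, then both copies of \<open>r\<close> in the extension would be indistinguishable.
\<close>

lemma state_of_extend_nondegenerate:
  assumes G: "G \<in> cells (Ex_P P K) n" and p: "p \<le> 2" and r: "r \<le> n"
    and g: "good n (phase p (horn_index p r)) G" and nd: "\<not> degenerate (Ex_P P K) (Suc n) (extend p r n G)"
  shows "state n p r G"
proof (rule ccontr)
  assume "\<not> state n p r G"
  hence g': "good n (phase p (opposite_index p r)) G" using p r g by (simp add: state_def)
  note J = Ex_flag[OF G] and mr = monotone_to_merge[OF r]
  have "extend p r n G = pull (Suc n) (\<lambda>i. max (phase p (opposite_index p r) (merge r i)) (phase p (Suc r) i)) (merge r) G"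
    unfolding extend_def by (rule pull_good[OF J g' mr]) simp
  also have "\<dots> = pull (Suc n) (\<lambda>i. max (phase p (opposite_index p r) (merge r i)) 0) (merge r) G"
    by (rule pull_cong) (use p in \<open>auto simp: phase_def merge_def opposite_index_def\<close>)
  also have "\<dots> = pull (Suc n) (\<lambda>_. 0) (merge r) G"
    by (rule pull_good[OF J g' mr, symmetric]) simp
  also have "\<dots> = act (Ex_P P K) n G (mk (Suc n) (merge r))" by (rule act_Ex_mk[OF mr, symmetric])
  finally show False using nd degenerate_merge[OF G r] by simp
qed

section \<open>The other faces of an extension\<close>

text \<open>
  Omitting \<open>j\<close> affects the first vertices only if \<open>j\<close> is one of them, and only from \<open>j\<close> on. The part up to \<open>x\<close> is
  disregarded because the moves that involve first vertices add it anyway.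
\<close>

lemma minima_skip:
  assumes J: "flag (Suc m) J" and j: "j < r \<or> j \<notin> minima J" and jm: "j \<le> Suc m" and x: "r \<le> x"
  shows "skip j ` minima (pullback J m (skip j)) \<union> {..x} = minima J \<union> {..x}"
proof -
  note dim = flagD(2)[OF J]
  have 1: "skip j i \<in> minima J" if i: "i \<in> minima (pullback J m (skip j))" "x < skip j i" for i
  proof -
    have im: "i \<le> m" using i(1) by (simp add: minima_def)
    have "i \<noteq> 0"
    proof
      assume "i = 0"
      hence "j = 0" "r = 0" using i(2) x by (auto simp: skip_def split: if_splits)
      thus False using j by (auto simp: minima_def)
    qed
    hence ne: "J ! skip j (i - 1) \<noteq> J ! skip j i" using i(1) im by (auto simp: minima_def)
    show ?thesis
    proof (cases "i = j")
      case True
      hence "j \<notin> minima J" using i(2) x(1) j by (auto simp: skip_def)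
      hence "J ! (j - 1) = J ! j" using True \<open>i \<noteq> 0\<close> im dim by (auto simp: minima_def)
      thus ?thesis using ne True \<open>i \<noteq> 0\<close> im dim by (auto simp: skip_def minima_def)
    next
      case False
      hence "skip j (i - 1) = skip j i - 1" using \<open>i \<noteq> 0\<close> by (auto simp: skip_def)
      thus ?thesis using ne im dim by (auto simp: skip_def minima_def)
    qed
  qed
  have 2: "i \<in> skip j ` minima (pullback J m (skip j))" if i: "i \<in> minima J" "x < i" for i
  proof -
    have ij: "i \<noteq> j" using i x(1) j by auto
    have im: "i \<le> Suc m" using i(1) dim by (simp add: minima_def)
    define i' where "i' = (if i < j then i else i - 1)"
    have s: "skip j i' = i" "i' \<le> m" using ij im jm by (auto simp: skip_def i'_def)
    have ne: "J ! (i - 1) \<noteq> J ! i" using i by (auto simp: minima_def)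
    have "J ! skip j (i' - 1) \<noteq> J ! skip j i'" if "i' \<noteq> 0"
    proof (cases "i = Suc j")
      case True
      hence "j \<notin> minima J" using i(2) x(1) j by auto
      hence "J ! (j - 1) = J ! j" using True im dim by (auto simp: minima_def)
      thus ?thesis using ne True s that by (auto simp: skip_def i'_def)
    next
      case False
      hence "skip j (i' - 1) = i - 1" using that ij by (auto simp: skip_def i'_def)
      thus ?thesis using ne s by simp
    qed
    hence "i' \<in> minima (pullback J m (skip j))" using s by (auto simp: minima_def)
    thus ?thesis using s(1) by blast
  qed
  show ?thesis using 1 2 by (auto simp: not_le[symmetric])
qed

text \<open>
  Once \<open>C\<close> moves are carried out afterwards, it makes no difference whether \<open>e\<close> moves come before or after the
  coface that omits \<open>j\<close>. For \<open>e = 1\<close> and \<open>C = 0\<close> this is only true because the initial segment that is added does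
  not contain \<open>j\<close>; if first vertices are involved, it rests on the preceding lemma.
\<close>

lemma fill_skip:
  assumes J: "flag (Suc m) J" and j: "j \<le> Suc m" and t: "t \<le> m"
    and 1: "e = 1 \<Longrightarrow> 1 \<le> C \<or> t < j"
    and 2: "e = 2 \<Longrightarrow> 1 \<le> C" and 3: "e = 3 \<Longrightarrow> 2 \<le> C" and le: "C \<le> 3" "e \<le> 3"
    and x: "2 \<le> e \<Longrightarrow> C \<noteq> 3 \<Longrightarrow> r \<le> skip j t \<and> (j < r \<or> j \<notin> minima J)"
  shows "fill J C (skip j ` fill (pullback J m (skip j)) e U t) (skip j t)
       = fill J (max C e) (skip j ` U) (skip j t)"
proof -
  define a b M X where "a = skip j ` U" and "b = skip j ` {..t}"
    and "M = skip j ` minima (pullback J m (skip j))" and "X = {..skip j t}"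
  note defs = this
  have b: "b \<subseteq> X" by (auto simp: defs skip_def)
  have b_eq: "b = X" if "t < j" using that by (auto simp: defs skip_def image_iff)
  have "M \<union> X = minima J \<union> X" if "2 \<le> e" "C \<noteq> 3"
    unfolding defs using minima_skip[OF J _ j, of r "skip j t"] x[OF that] by blast
  hence M: "M \<subseteq> minima J \<union> X" "minima J \<subseteq> M \<union> X" if "2 \<le> e" "C \<noteq> 3" using that by blast+
  have img: "skip j ` fill (pullback J m (skip j)) e U t =
      (if e = 0 then a else if e = 1 then a \<union> b else if e = 2 then a \<union> b \<union> M else b \<union> M)"
    by (simp add: fill_def defs image_Un)
  have f: "fill J c V (skip j t) = (if c = 0 then V else if c = 1 then V \<union> X
      else if c = 2 then V \<union> X \<union> minima J else X \<union> minima J)" for c V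
    by (simp add: fill_def defs)
  have "(e \<noteq> 1 \<or> 1 \<le> C \<or> t < j) \<and> (e \<noteq> 2 \<or> 1 \<le> C) \<and> (e \<noteq> 3 \<or> 2 \<le> C)" using 1 2 3 by blast
  hence "e = 0 \<or> e = 1 \<and> 1 \<le> C \<or> e = 1 \<and> C = 0 \<and> t < j \<or> e = 2 \<and> C = 1 \<or> e = 2 \<and> C = 2
    \<or> e = 3 \<and> C = 2 \<or> C = 3" using le by arith
  then consider "e = 0" | "e = 1" "1 \<le> C" | "e = 1" "C = 0" "t < j" | "e = 2" "C = 1" | "e = 2" "C = 2"
    | "e = 3" "C = 2" | "C = 3"
    by blast
  thus ?thesis
  proof cases
    case 1
    thus ?thesis unfolding img f defs(1)[symmetric] by simp
  next
    case 3
    thus ?thesis unfolding img f defs(1)[symmetric] using b_eq by simp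
  next
    case 2
    thus ?thesis unfolding img f defs(1)[symmetric] using b by auto
  next
    case 4
    with M have "M \<subseteq> minima J \<union> X" "minima J \<subseteq> M \<union> X" by auto
    thus ?thesis unfolding img f defs(1)[symmetric] using b 4 by simp blast
  next
    case 5
    with M have "M \<subseteq> minima J \<union> X" by auto
    thus ?thesis unfolding img f defs(1)[symmetric] using b 5 by simp blast
  next
    case 6
    with M have "M \<subseteq> minima J \<union> X" by auto
    thus ?thesis unfolding img f defs(1)[symmetric] using b 6 by simp blast
  next
    case 7
    thus ?thesis unfolding f using le by (simp add: max_def)
  qed
qed

text \<open>
  Cofaces do not commute with the moves. For a good simplex it suffices that they do so after the moves under
  which the simplex is invariant.
\<close>

lemma pull_pull_good:
  assumes J: "flag n (fst F)" and gd: "good n c F" and g: "monotone_to g m n" and h: "monotone_to h l m"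
    and c': "compatible l c'" and c'': "compatible l c''"
    and eq: "\<And>i U. i \<le> l \<Longrightarrow> fill (fst F) (c (g (h i))) (g ` fill (pullback (fst F) m g) (c' i) U (h i)) (g (h i))
      = fill (fst F) (max (c (g (h i))) (c'' i)) (g ` U) (g (h i))"
  shows "pull l c' h (pull m (\<lambda>_. 0) g F) = pull l c'' (\<lambda>i. g (h i)) F"
proof -
  have "pull l c' h (pull m (\<lambda>_. 0) g F) = pull l c' h (pull m (\<lambda>i. max (c (g i)) 0) g F)"
    by (subst pull_good[OF J gd g]) simp_all
  also have "\<dots> = pull l (\<lambda>i. max (c (g (h i))) (c'' i)) (\<lambda>i. g (h i)) F"
    by (rule pull_pull[OF J g h c']) (simp add: eq)
  also have "\<dots> = pull l c'' (\<lambda>i. g (h i)) F"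
    by (rule pull_good[OF J gd monotone_to_comp[OF g h] c'', symmetric])
  finally show ?thesis .
qed

text \<open>
  The main case of the analysis of faces: omitting a vertex other than the copies of \<open>r\<close> commutes with extension,
  except that in the first move the omitted vertex must not be below \<open>r\<close>, since it would be among the vertices added,
  and that in the other moves it must not be the first vertex of a stratum, unless it is below \<open>r\<close>.
\<close>

lemma face_natural:
  assumes F: "F \<in> cells (Ex_P P K) (Suc m)" and p: "p \<le> 2" and r: "r \<le> Suc m" and j: "j \<le> Suc m" "j \<noteq> r"
    and gd: "good (Suc m) (phase p (horn_index p r)) F"
    and nat: "if j < r then p \<noteq> 0 else p = 0 \<or> j \<notin> minima (fst F)"
  defines "r' \<equiv> (if j < r then r - 1 else r)" and "G \<equiv> act (Ex_P P K) (Suc m) F (mk m (skip j))"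
  shows "act (Ex_P P K) (Suc (Suc m)) (extend p r (Suc m) F) (mk (Suc m) (skip (if j < r then j else Suc j)))
      = extend p r' m G"
    and "good m (phase p (horn_index p r')) G" and "r' \<le> m" and "G \<in> cells (Ex_P P K) m"
proof -
  note J = Ex_flag[OF F]
  let ?jj = "if j < r then j else Suc j" let ?c = "phase p (horn_index p r)"
  have p': "p = 0 \<or> p = 1 \<or> p = 2" using p by auto
  show r': "r' \<le> m" using r j by (auto simp: r'_def)
  have G: "G = pull m (\<lambda>_. 0) (skip j) F" unfolding G_def by (rule act_Ex_mk[OF monotone_to_skip])
  show "G \<in> cells (Ex_P P K) m" unfolding G by (rule pull_in_Ex[OF F monotone_to_skip]) simp
  have nat': "j < r \<or> j \<notin> minima (fst F)" if "p \<noteq> 0" using nat that by (auto split: if_splits)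
  have "extend p r' m G = pull (Suc m) (phase p (Suc r')) (\<lambda>i. skip j (merge r' i)) F"
    unfolding extend_def G
  proof (rule pull_pull_good[OF J gd monotone_to_skip monotone_to_merge[OF r']])
    fix i U assume i: "i \<le> Suc m"
    show "fill (fst F) (?c (skip j (merge r' i))) (skip j ` fill (pullback (fst F) m (skip j)) (phase p (Suc r') i) U (merge r' i))
        (skip j (merge r' i)) = fill (fst F) (max (?c (skip j (merge r' i))) (phase p (Suc r') i)) (skip j ` U) (skip j (merge r' i))"
    proof (rule fill_skip[OF J j(1), of _ _ _ r])
      show "merge r' i \<le> m" using i r' by (auto simp: merge_def)
    qed (use p' j nat nat' in \<open>auto simp: phase_def horn_index_def skip_def merge_def r'_def split: if_splits\<close>)
  qed simp_all
  also have "\<dots> = pull (Suc m) (\<lambda>i. phase p (Suc r) (skip ?jj i)) (\<lambda>i. merge r (skip ?jj i)) F"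
    by (rule pull_cong) (use j in \<open>auto simp: phase_def skip_def merge_def r'_def\<close>)
  also have "\<dots> = act (Ex_P P K) (Suc (Suc m)) (extend p r (Suc m) F) (mk (Suc m) (skip ?jj))"
    by (rule face_extend[OF F r, symmetric])
  finally show "act (Ex_P P K) (Suc (Suc m)) (extend p r (Suc m) F) (mk (Suc m) (skip ?jj)) = extend p r' m G" by simp
  have "pull m (phase p (horn_index p r')) (\<lambda>i. i) G = pull m (\<lambda>_. 0) (\<lambda>i. skip j i) F"
    unfolding G
  proof (rule pull_pull_good[OF J gd monotone_to_skip monotone_to_id])
    fix i U assume i: "i \<le> m"
    show "fill (fst F) (?c (skip j i)) (skip j ` fill (pullback (fst F) m (skip j)) (phase p (horn_index p r') i) U i)
        (skip j i) = fill (fst F) (max (?c (skip j i)) 0) (skip j ` U) (skip j i)"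
    proof -
      have C: "?c (skip j i) = phase p (horn_index p r') i"
        using j p' by (auto simp: phase_def horn_index_def skip_def r'_def)
      have "fill (fst F) (?c (skip j i)) (skip j ` fill (pullback (fst F) m (skip j)) (phase p (horn_index p r') i) U i) (skip j i)
        = fill (fst F) (max (?c (skip j i)) (phase p (horn_index p r') i)) (skip j ` U) (skip j i)"
        by (rule fill_skip[OF J j(1) i, of _ _ r])
          (use p' j nat nat' in \<open>auto simp: phase_def horn_index_def skip_def r'_def split: if_splits\<close>)
      thus ?thesis by (simp add: C)
    qed
  qed simp_all
  thus "good m (phase p (horn_index p r')) G" by (simp add: good_def G)
qed

text \<open>
  Adding \<open>{..l}\<close> is compatible with every monotone map, in contrast to adding first vertices.
\<close>

lemma good_after_pull:
  assumes J: "flag n (fst F)" and g: "monotone_to g m n" and d: "compatible m d"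
    and le: "\<And>i. i \<le> m \<Longrightarrow> d i \<le> 1 \<and> d i \<le> c i"
  shows "good m d (pull m c g F)"
  unfolding good_def
proof (rule pull_pull[OF J g monotone_to_id d])
  fix i \<tau> assume i: "i \<le> m"
  have "g ` {..i} \<subseteq> {..g i}" using monotone_toD(2)[OF g _ i] by auto
  moreover have "d i = 0 \<or> d i = 1 \<and> c i \<noteq> 0" using le[OF i] by auto
  ultimately show "fill (fst F) (c i) (g ` fill (pullback (fst F) m g) (d i) ((\<lambda>i. i) ` \<tau>) i) (g i)
      = fill (fst F) (c i) (g ` (\<lambda>i. i) ` \<tau>) (g i)"
    by (auto simp: fill_def)
qed

text \<open>
  Vertices count more in higher strata. The strata present in \<open>J\<close> are used as a yardstick because the poset may
  contain infinite chains.
\<close>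

definition weight :: "'p::order list \<Rightarrow> nat" where
  "weight J = (\<Sum>i<length J. card {s \<in> set J. s < J ! i})"

lemma weight_le: "weight J \<le> length J * length J"
proof -
  have "card {s \<in> set J. s < J ! i} \<le> length J" for i
    using card_mono[of "set J" "{s \<in> set J. s < J ! i}"] card_length[of J] by force
  thus ?thesis unfolding weight_def using sum_bounded_above[of "{..<length J}" "\<lambda>i. card {s \<in> set J. s < J ! i}" "length J"]
    by simp
qed

text \<open>
  The flag arises from \<open>J\<close> by repeating \<open>r\<close> and omitting \<open>j\<close>. At no position does it have a larger value than \<open>J\<close>,
  and at the position \<open>j\<close> it has the value \<open>J ! (j - 1)\<close> of a lower stratum.
\<close>

lemma weight_decreases:
  assumes J: "flag n J" and j: "j \<in> minima J" "r < j"
  shows "weight (pullback J n (\<lambda>i. merge r (skip (Suc j) i))) < weight J"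
proof -
  let ?g = "\<lambda>i. merge r (skip (Suc j) i)" let ?J = "pullback J n ?g"
  have len: "length J = Suc n" and jn: "j \<le> n" using flagD[OF J] j(1) by (auto simp: minima_def)
  have g: "?g i \<le> i" if "i \<le> n" for i using j(2) by (auto simp: merge_def skip_def)
  define w where "w x = card {s \<in> set J. s < x}" for x
  have w_mono: "w x \<le> w y" if "x \<le> y" for x y
  proof -
    have "{s \<in> set J. s < x} \<subseteq> {s \<in> set J. s < y}" using that by (blast intro: less_le_trans)
    thus ?thesis unfolding w_def by (intro card_mono) auto
  qed
  have "J ! ?g i \<in> set J" if "i \<le> n" for i using g[OF that] that len by (intro nth_mem) simp
  hence set: "set ?J \<subseteq> set J" by (auto simp: pullback_def simp del: upt_Suc)
  have "weight ?J \<le> (\<Sum>i<Suc n. w (J ! ?g i))"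
    unfolding weight_def length_pullback
  proof (rule sum_mono)
    fix i assume i: "i \<in> {..<Suc n}"
    show "card {s \<in> set ?J. s < ?J ! i} \<le> w (J ! ?g i)"
      unfolding w_def by (rule card_mono) (use i set in auto)
  qed
  also have "\<dots> < (\<Sum>i<Suc n. w (J ! i))"
  proof (rule sum_strict_mono_ex1)
    show "\<forall>i\<in>{..<Suc n}. w (J ! ?g i) \<le> w (J ! i)"
    proof
      fix i assume "i \<in> {..<Suc n}"
      hence "J ! ?g i \<le> J ! i" using g[of i] by (intro flagD(3)[OF J]) auto
      thus "w (J ! ?g i) \<le> w (J ! i)" by (rule w_mono)
    qed
    have gj: "?g j = j - 1" using j(2) by (auto simp: merge_def skip_def)
    have "J ! (j - 1) \<le> J ! j" "J ! (j - 1) \<noteq> J ! j"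
      using flagD(3)[OF J, of "j - 1" j] jn j by (auto simp: minima_def)
    hence lt: "J ! (j - 1) < J ! j" by simp
    have "w (J ! (j - 1)) < w (J ! j)"
    proof -
      have "{s \<in> set J. s < J ! (j - 1)} \<subseteq> {s \<in> set J. s < J ! j}" using lt by (blast intro: less_trans)
      moreover have "J ! (j - 1) \<in> set J" using jn len by (intro nth_mem) simp
      ultimately have "{s \<in> set J. s < J ! (j - 1)} \<subset> {s \<in> set J. s < J ! j}" using lt by blast
      thus ?thesis unfolding w_def by (intro psubset_card_mono) auto
    qed
    thus "\<exists>i\<in>{..<Suc n}. w (J ! ?g i) < w (J ! i)" using gj jn by (intro bexI[of _ j]) auto
  qed simp
  finally show ?thesis unfolding weight_def w_def len .
qed

text \<open>
  Larger than all ranks that occur in the phases 1 and 2 for simplices of dimension \<open>n\<close>.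
\<close>

definition rank_bound :: "nat \<Rightarrow> nat" where
  "rank_bound n = (Suc n * Suc n + 1) * (3 * Suc n)"

definition the_state :: "nat \<Rightarrow> ('a, 'p::order) Ex_simplex \<Rightarrow> nat \<times> nat" where
  "the_state n F = (SOME (p, r). state n p r F)"

definition partner :: "nat \<Rightarrow> ('a, 'p::order) Ex_simplex \<Rightarrow> ('a, 'p) Ex_simplex" where
  "partner n F = (case the_state n F of (p, r) \<Rightarrow> extend p r n F)"

definition missing_face :: "nat \<Rightarrow> ('a, 'p::order) Ex_simplex \<Rightarrow> nat" where
  "missing_face n F = (case the_state n F of (p, r) \<Rightarrow> horn_index p r)"

text \<open>
  In phases 1 and 2 the weight takes precedence over the level. In phase 0 the weight may increase, as vertices of
  lower strata get traded for copies of \<open>r\<close>, but there the level alone decreases.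
\<close>

definition rank :: "nat \<Rightarrow> ('a, 'p::order) Ex_simplex \<Rightarrow> nat" where
  "rank n F = (case the_state n F of (p, r) \<Rightarrow>
     if p = 0 then rank_bound n + level n p r else weight (fst F) * (3 * Suc n) + level n p r)"

lemma the_state_eq:
  assumes F: "F \<in> cells (Ex_P P K) n" and s: "state n p r F"
  shows "the_state n F = (p, r)"
proof -
  have "case the_state n F of (p, r) \<Rightarrow> state n p r F"
    unfolding the_state_def by (rule someI[of "\<lambda>(p, r). state n p r F" "(p, r)"]) (simp add: s)
  thus ?thesis using state_unique[OF Ex_flag[OF F] s] by (cases "the_state n F") auto
qed

text \<open>
  The simplices fixed by the idempotent that belongs to the section of \<open>lv\<close>, in other words those that factor
  through \<open>lv\<close>.
\<close>

definition iota_image :: "'p::order set \<Rightarrow> ('a, 'p) strat_sset \<Rightarrow> nat \<Rightarrow> ('a, 'p) Ex_simplex set" where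
  "iota_image P K n = {F \<in> cells (Ex_P P K) n. good n (\<lambda>_. 3) F}"

lemma state_not_image: "flag n (fst F) \<Longrightarrow> state n p r F \<Longrightarrow> \<not> good n (\<lambda>_. 3) F"
  using good_mono[of n F "\<lambda>_. 3" "phase p (opposite_index p r)"] phase_le_3 by (auto simp: state_def)

lemma obtain_state:
  assumes "F \<in> cells (Ex_P P K) n - iota_image P K n"
  obtains p r where "F \<in> cells (Ex_P P K) n" "p \<le> 2" "r \<le> n" "state n p r F" "partner n F = extend p r n F"
    "missing_face n F = horn_index p r"
    "rank n F = (if p = 0 then rank_bound n + level n p r else weight (fst F) * (3 * Suc n) + level n p r)"
proof -
  have F: "F \<in> cells (Ex_P P K) n" "\<not> good n (\<lambda>_. 3) F" using assms by (auto simp: iota_image_def)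
  then obtain p r where s: "state n p r F" by (rule state_exists)
  show ?thesis
    by (rule that[OF F(1) _ _ s]) (use s in \<open>auto simp: state_def partner_def missing_face_def rank_def the_state_eq[OF F(1) s]\<close>)
qed

lemma partner_cell:
  assumes F: "F \<in> cells (Ex_P P K) n" and s: "state n p r F"
  shows "F \<in> cells (Ex_P P K) n - iota_image P K n" "partner n F = extend p r n F"
  using F state_not_image[OF Ex_flag[OF F] s] the_state_eq[OF F s] by (auto simp: iota_image_def partner_def)

lemma level_drop:
  assumes J: "flag n (fst G)" and G: "state n p' r' G" and g: "good n (phase p (opposite_index p r)) G"
    and pr: "p \<le> 2" "r \<le> n"
  shows "level n p' r' < level n p r"
proof (rule ccontr)
  assume "\<not> ?thesis"
  hence "level n p r = level n p' r' \<or> level n p r < level n p' r'" by auto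
  moreover have "good n (phase p (horn_index p r)) G"
    by (rule good_mono[OF J g]) (use pr(1) in \<open>auto simp: phase_def opposite_index_def horn_index_def\<close>)
  ultimately have "good n (phase p' (opposite_index p' r')) G"
    using level_inj[of p p' r n r'] phase_level_mono[of p p' r n r'] pr G g
      good_mono[OF J, of "phase p (horn_index p r)" "phase p' (opposite_index p' r')"]
    by (auto simp: state_def)
  thus False using G by (simp add: state_def)
qed

lemma rank_bounds:
  assumes "flag n (fst F)" "r \<le> n"
  shows "weight (fst F) * (3 * Suc n) + level n p r < rank_bound n" "level n p r < rank_bound n"
proof -
  have "weight (fst F) \<le> Suc n * Suc n" using weight_le[of "fst F"] flagD(1)[OF assms(1)] by simp
  hence "weight (fst F) * (3 * Suc n) \<le> Suc n * Suc n * (3 * Suc n)" by (rule mult_le_mono1)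
  moreover have "level n p r < 3 * Suc n" by (rule level_less[OF assms(2)])
  moreover have "rank_bound n = Suc n * Suc n * (3 * Suc n) + 3 * Suc n"
    unfolding rank_bound_def by (simp only: add_mult_distrib mult_1)
  ultimately show "weight (fst F) * (3 * Suc n) + level n p r < rank_bound n" "level n p r < rank_bound n"
    by linarith+
qed

lemma iota_image_act:
  assumes F: "F \<in> iota_image P K n" and t: "\<theta> \<in> simplex_maps m n"
  shows "act (Ex_P P K) n F \<theta> \<in> iota_image P K m"
proof -
  have F': "F \<in> cells (Ex_P P K) n" and g: "good n (\<lambda>_. 3) F" using F by (auto simp: iota_image_def)
  note J = Ex_flag[OF F'] and mt = monotone_to_simplex_maps[OF t]
  have "act (Ex_P P K) n F \<theta> = pull m (\<lambda>_. 0) ((!) \<theta>) F" by (rule act_Ex[OF t])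
  also have "\<dots> = pull m (\<lambda>_. 3) ((!) \<theta>) F" by (subst pull_good[OF J g mt]) simp_all
  finally have e: "act (Ex_P P K) n F \<theta> = pull m (\<lambda>_. 3) ((!) \<theta>) F" .
  have "good m (\<lambda>_. 3) (pull m (\<lambda>_. 3) ((!) \<theta>) F)"
    unfolding good_def by (rule pull_pull[OF J mt monotone_to_id]) (simp_all add: fill_def)
  thus ?thesis using simplicial_setD(2)[OF stratifiedD(1)[OF stratified_Ex] F' t] unfolding e
    by (simp add: iota_image_def)
qed

lemma extend_not_image:
  assumes F: "F \<in> cells (Ex_P P K) n" and s: "state n p r F"
  shows "extend p r n F \<in> cells (Ex_P P K) (Suc n) - iota_image P K (Suc n)"
  using partner_cell(1)[OF extend_in_Ex[OF F] state_extend[OF F s]] s by (simp add: state_def)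

lemma Ex_degenerate:
  assumes F: "F \<in> cells (Ex_P P K) n" and d: "degenerate (Ex_P P K) n F"
  obtains m i G where "n = Suc m" "i \<le> m" "G \<in> cells (Ex_P P K) m"
    "F = act (Ex_P P K) m G (mk (Suc m) (merge i))"
    "G = act (Ex_P P K) n F (mk m (skip i))" "G = act (Ex_P P K) n F (mk m (skip (Suc i)))"
proof -
  note S = stratifiedD(1)[OF stratified_Ex]
  obtain m where m: "n = Suc m" using d by (cases n) (auto simp: degenerate_def)
  obtain i where i: "i \<le> m" "act (Ex_P P K) (Suc m) F (mk m (skip i)) = act (Ex_P P K) (Suc m) F (mk m (skip (Suc i)))"
    "F = act (Ex_P P K) m (act (Ex_P P K) (Suc m) F (mk m (skip i))) (mk (Suc m) (merge i))"
    using degenerate_faces[OF S F[unfolded m] d[unfolded m]] .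
  show ?thesis
    by (rule that[OF m i(1) _ i(3)])
      (use simplicial_setD(2)[OF S F[unfolded m] skip_simplex_maps] i(2) m in auto)
qed

lemma partner_of_natural_face:
  assumes G: "G \<in> cells (Ex_P P K) m" and "p \<le> 2" "r \<le> m" "good m (phase p (horn_index p r)) G"
    and nd: "\<not> degenerate (Ex_P P K) (Suc m) (extend p r m G)"
  shows "extend p r m G \<in> partner m ` (cells (Ex_P P K) m - iota_image P K m)"
  using partner_cell[OF G state_of_extend_nondegenerate[OF assms]] by (metis image_eqI)

text \<open>
  The composite of the coface with the codegeneracy misses the vertex to which the omitted vertex was mapped.
\<close>

lemma degenerate_other_face:
  assumes X: "simplicial_set X" and z: "z \<in> cells X n" and i: "i \<le> n" and k: "k \<le> Suc n" "k \<noteq> i" "k \<noteq> Suc i"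
  shows "degenerate X n (act X (Suc n) (act X n z (mk (Suc n) (merge i))) (mk n (skip k)))"
proof -
  let ?h = "\<lambda>l. merge i (skip k l)"
  have "?h l \<le> n" if "l \<le> n" for l using that i by (auto simp: merge_def skip_def)
  moreover have "mk n ?h \<in> simplex_maps n n" by (rule mk_simplex_maps) (use i in \<open>auto simp: merge_def skip_def\<close>)
  moreover have "merge i k \<notin> set (mk n ?h)" using k by (auto simp: set_mk merge_def skip_def split: if_splits)
  moreover have "merge i k \<le> n" using i k by (auto simp: merge_def)
  ultimately have h: "mk n ?h \<in> simplex_maps n n" "set (mk n ?h) \<noteq> {..n}" by auto
  have "map ((!) (mk (Suc n) (merge i))) (mk n (skip k)) = mk n ?h"
    unfolding map_mk by (rule mk_cong) (simp add: skip_def)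
  hence "act X (Suc n) (act X n z (mk (Suc n) (merge i))) (mk n (skip k)) = act X n z (mk n ?h)"
    using simplicial_setD(3)[OF X z merge_simplex_maps[OF i] skip_simplex_maps] by simp
  thus ?thesis using act_missing_degenerate[OF X z h] unfolding degenerate_def by (metis lessI)
qed

text \<open>
  If the partner is degenerate, it is a degeneration of \<open>F\<close> itself, since \<open>F\<close> is one of its faces and nondegenerate.
  The two vertices that this degeneration identifies are not the two copies of \<open>r\<close>, because omitting one or the
  other gives different faces. So the copy whose omission gives \<open>F\<close> is identified with its neighbour on the other
  side. Omitting this neighbour gives \<open>F\<close> as well, and by \<open>face_natural\<close> the result is a partner.
\<close>

lemma extend_nondegenerate:
  assumes F: "F \<in> cells (Ex_P P K) n" and s: "state n p r F" and nd: "\<not> degenerate (Ex_P P K) n F"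
    and d: "degenerate (Ex_P P K) (Suc n) (extend p r n F)"
  shows "\<exists>m. n = Suc m \<and> F \<in> partner m ` (cells (Ex_P P K) m - iota_image P K m)"
proof -
  note S = stratifiedD(1)[OF stratified_Ex]
  have r: "r \<le> n" and p: "p \<le> 2" and g: "good n (phase p (horn_index p r)) F"
    and ng: "\<not> good n (phase p (opposite_index p r)) F" using s by (auto simp: state_def)
  let ?E = "extend p r n F" let ?X = "Ex_P P K"
  obtain i z where i: "i \<le> n" "z \<in> cells ?X n" "?E = act ?X n z (mk (Suc n) (merge i))"
    "z = act ?X (Suc n) ?E (mk n (skip i))" "z = act ?X (Suc n) ?E (mk n (skip (Suc i)))"
    using Ex_degenerate[OF extend_in_Ex[OF F r] d] by (metis nat.inject)
  have k: "act ?X (Suc n) ?E (mk n (skip (horn_index p r))) = F"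
    using face_extend_special(1)[OF F r p] g by (simp add: good_def)
  \<comment> \<open>Otherwise \<open>F\<close> would be one of the degenerate faces of a degenerate simplex.\<close>
  have "horn_index p r = i \<or> horn_index p r = Suc i"
    using degenerate_other_face[OF S i(2,1), of "horn_index p r"] k nd r i(3)[symmetric]
    by (auto simp: horn_index_def split: if_splits)
  hence zF: "z = F" using k i(4,5) by auto
  have "opposite_index p r \<noteq> i \<and> opposite_index p r \<noteq> Suc i"
    using face_extend_special(2)[OF F r p] ng i(4,5) zF by (metis good_def)
  hence c: "p = 2 \<and> r = Suc i \<or> p \<noteq> 2 \<and> i = Suc r"
    using \<open>horn_index p r = i \<or> horn_index p r = Suc i\<close>
    by (auto simp: horn_index_def opposite_index_def split: if_splits)
  then obtain m where m: "n = Suc m" using r i(1) by (cases n) auto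
  let ?j = "i"
  have nat: "if ?j < r then p \<noteq> 0 else p = 0 \<or> ?j \<notin> minima (fst F)"
  proof (cases "p = 2")
    case False
    hence ir: "i = Suc r" using c by auto
    have "fst ?E = pullback (fst F) (Suc n) (merge i)"
      using i(3) zF by (metis act_Ex_mk fst_pull i(1) monotone_to_merge)
    hence "pullback (fst F) (Suc n) (merge r) ! i = pullback (fst F) (Suc n) (merge i) ! i"
      by (simp add: extend_def)
    hence "fst F ! r = fst F ! i" using ir i(1) by (simp add: merge_def)
    thus ?thesis using ir by (auto simp: minima_def)
  qed (use c in auto)
  let ?r = "if ?j < r then r - 1 else r" let ?G = "act ?X (Suc m) F (mk m (skip ?j))"
  note fn = face_natural[OF F[unfolded m] p r[unfolded m] _ _ g[unfolded m] nat]
  have ij: "?j \<le> Suc m" "?j \<noteq> r" using i(1) m c by auto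
  have "F = extend p ?r m ?G"
    using fn(1)[OF ij] i(4,5) zF c m by (auto split: if_splits)
  thus ?thesis
    using partner_of_natural_face[OF fn(4)[OF ij] p fn(3)[OF ij] fn(2)[OF ij]] nd m by metis
qed

text \<open>
  The faces that are neither partners nor degenerate: either such a face has passed the step \<open>(p, r)\<close>, which
  lowers the level, or its flag has smaller weight.
\<close>

lemma other_face_rank:
  assumes F: "F \<in> cells (Ex_P P K) n" and s: "state n p r F"
    and j: "j \<le> Suc n" "j \<noteq> horn_index p r"
    and g: "g = act (Ex_P P K) (Suc n) (extend p r n F) (mk n (skip j))"
    and g1: "g \<notin> iota_image P K n" and g2: "\<not> degenerate (Ex_P P K) n g"
    and g3: "\<not> (\<exists>m. n = Suc m \<and> g \<in> partner m ` (cells (Ex_P P K) m - iota_image P K m))"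
  shows "rank n g < rank n F"
proof -
  let ?X = "Ex_P P K"
  have r: "r \<le> n" and p: "p \<le> 2" and gd: "good n (phase p (horn_index p r)) F" using s by (auto simp: state_def)
  note J = Ex_flag[OF F] and mr = monotone_to_merge[OF r]
  have gX: "g \<in> cells ?X n - iota_image P K n"
    using simplicial_setD(2)[OF stratifiedD(1)[OF stratified_Ex] extend_in_Ex[OF F r] skip_simplex_maps] g g1 by simp
  obtain p' r' where g': "g \<in> cells ?X n" "p' \<le> 2" "r' \<le> n" "state n p' r' g"
    "rank n g = (if p' = 0 then rank_bound n + level n p' r' else weight (fst g) * (3 * Suc n) + level n p' r')"
    using obtain_state[OF gX] .
  note Jg = Ex_flag[OF g'(1)]
  have rF: "rank n F = (if p = 0 then rank_bound n + level n p r else weight (fst F) * (3 * Suc n) + level n p r)"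
    by (simp add: rank_def the_state_eq[OF F s])
  \<comment> \<open>Passing a step lowers the level. In phases 1 and 2 the weight takes precedence over it, so that the flag
    must not change.\<close>
  have drop: "rank n g < rank n F"
    if gg: "good n (phase p (opposite_index p r)) g" and J': "p = 0 \<or> fst g = fst F"
  proof -
    have l: "level n p' r' < level n p r" by (rule level_drop[OF Jg g'(4) gg p r])
    show ?thesis
    proof (cases "p = 0")
      case True
      hence F0: "rank n F = rank_bound n + level n p r" using rF by simp
      show ?thesis
      proof (cases "p' = 0")
        case True
        hence "rank n g = rank_bound n + level n p' r'" using g'(5) by simp
        thus ?thesis using F0 l by linarith
      next
        case False
        hence "rank n g < rank_bound n" using g'(5) rank_bounds(1)[OF Jg g'(3), of p'] by (simp only: if_False)
        thus ?thesis using F0 by linarith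
      qed
    next
      case False
      hence "p' \<noteq> 0" using l r by (auto simp: level_def split: if_splits)
      hence "rank n g = weight (fst F) * (3 * Suc n) + level n p' r'" using g'(5) False J' by simp
      moreover have "rank n F = weight (fst F) * (3 * Suc n) + level n p r" using rF False by simp
      ultimately show ?thesis using l by linarith
    qed
  qed
  have gp: "g = pull n (\<lambda>i. phase p (Suc r) (skip j i)) (\<lambda>i. merge r (skip j i)) F"
    unfolding g by (rule face_extend[OF F r])
  have mj: "monotone_to (\<lambda>i. merge r (skip j i)) n n" by (rule monotone_to_comp[OF mr monotone_to_skip])
  show ?thesis
  proof (cases "j = opposite_index p r")
    case True
    have e: "g = pull n (phase p (opposite_index p r)) (\<lambda>i. i) F"
      unfolding g True by (rule face_extend_special(2)[OF F r p])
    have "good n (phase p (opposite_index p r)) g"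
      unfolding good_def e
      by (subst pull_pull_surj[OF J monotone_to_id _ monotone_to_id]) simp_all
    moreover have "fst g = fst F" unfolding e by (simp add: pullback_id[OF flagD(1)[OF J]])
    ultimately show ?thesis by (intro drop) simp_all
  next
    case False
    hence j': "j < r \<or> Suc r < j" using j(2) by (auto simp: horn_index_def opposite_index_def split: if_splits)
    then obtain m where m: "n = Suc m" using r j(1) by (cases n) auto
    define j0 where "j0 = (if j < r then j else j - 1)"
    have j0: "j0 \<le> Suc m" "j0 \<noteq> r" "j = (if j0 < r then j0 else Suc j0)" "j0 < r \<longleftrightarrow> j < r"
    proof -
      show "j0 \<le> Suc m" "j0 \<noteq> r" using j' j(1) r m by (auto simp: j0_def)
      show "j0 < r \<longleftrightarrow> j < r" using j' by (auto simp: j0_def)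
      show "j = (if j0 < r then j0 else Suc j0)" using j' by (auto simp: j0_def)
    qed
    show ?thesis
    proof (cases "if j0 < r then p \<noteq> 0 else p = 0 \<or> j0 \<notin> minima (fst F)")
      case True
      note fn = face_natural[OF F[unfolded m] p r[unfolded m] j0(1,2) gd[unfolded m] True]
      have "g = extend p (if j0 < r then r - 1 else r) m (act ?X (Suc m) F (mk m (skip j0)))"
        unfolding g m by (subst j0(3)) (rule fn(1))
      note ge = this
      have "\<not> degenerate ?X (Suc m) (extend p (if j0 < r then r - 1 else r) m (act ?X (Suc m) F (mk m (skip j0))))"
        using g2 unfolding ge[symmetric] m .
      from partner_of_natural_face[OF fn(4) p fn(3,2) this]
      have "g \<in> partner m ` (cells ?X m - iota_image P K m)" unfolding ge[symmetric] .
      with g3 m show ?thesis by blast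
    next
      case notnat: False
      show ?thesis
      proof (cases "j < r")
        case True
        hence p0: "p = 0" using notnat j0(4) by auto
        have "good n (phase 0 r) g"
          unfolding gp by (rule good_after_pull[OF J mj])
            (use True p0 in \<open>auto simp: phase_def skip_def\<close>)
        thus ?thesis by (intro drop) (simp_all add: p0 opposite_index_def)
      next
        case False
        hence "\<not> j0 < r" using j0(4) by simp
        hence pj: "p \<noteq> 0" "j0 \<in> minima (fst F)" "r < j0" "j = Suc j0" using notnat j0(2,3) by simp_all
        have "good n (\<lambda>_. 1) g"
          unfolding gp by (rule good_after_pull[OF J mj]) (use pj(1) in \<open>auto simp: phase_def compatible_def\<close>)
        hence "good n (phase 0 r') g" by (rule good_mono[OF Jg]) (auto simp: phase_def)
        hence "p' \<noteq> 0" using g'(4) by (cases "p' = 0") (auto simp: state_def opposite_index_def)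
        hence "rank n g = weight (fst g) * (3 * Suc n) + level n p' r'" using g'(5) by simp
        moreover have "rank n F = weight (fst F) * (3 * Suc n) + level n p r" using rF pj(1) by simp
        moreover have "Suc (weight (fst g)) \<le> weight (fst F)"
          using weight_decreases[OF J pj(2,3)] unfolding gp pj(4) fst_pull by (rule Suc_leI)
        hence "Suc (weight (fst g)) * (3 * Suc n) \<le> weight (fst F) * (3 * Suc n)" by (rule mult_le_mono1)
        hence "weight (fst g) * (3 * Suc n) + 3 * Suc n \<le> weight (fst F) * (3 * Suc n)" by simp
        ultimately show ?thesis using level_less[OF g'(3), of p'] by linarith
      qed
    qed
  qed
qed

lemma pairing_Ex: "pairing P (Ex_P P K) (iota_image P K) partner missing_face rank (\<lambda>n. 2 * rank_bound n)"
proof (unfold_locales)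
  let ?X = "Ex_P P K" let ?A = "iota_image P K"
  note S = stratifiedD(1)[OF stratified_Ex[of P K]]
  show "stratified P ?X" by (rule stratified_Ex)
  show "?A n \<subseteq> cells ?X n" for n by (auto simp: iota_image_def)
  show "act ?X n x \<theta> \<in> ?A m" if "x \<in> ?A n" "\<theta> \<in> simplex_maps m n" for x n m \<theta>
    using iota_image_act that .
  fix F n assume F: "F \<in> cells ?X n - ?A n"
  obtain p r where s: "F \<in> cells ?X n" "p \<le> 2" "r \<le> n" "state n p r F" "partner n F = extend p r n F"
    "missing_face n F = horn_index p r"
    "rank n F = (if p = 0 then rank_bound n + level n p r else weight (fst F) * (3 * Suc n) + level n p r)"
    using obtain_state[OF F] .
  have gd: "good n (phase p (horn_index p r)) F" using s(4) by (simp add: state_def)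
  show E: "partner n F \<in> cells ?X (Suc n) - ?A (Suc n)"
    unfolding s(5) by (rule extend_not_image[OF s(1,4)])
  show "admissible P (strat ?X (Suc n) (partner n F)) (missing_face n F)"
  proof -
    have "fst (extend p r n F) \<in> cells (nerve P) (Suc n)" using E s(5) by (simp add: Ex_cells)
    moreover have "strat ?X (Suc n) (extend p r n F) = fst (extend p r n F)"
      by (simp add: Ex_P_def case_prod_unfold)
    ultimately show ?thesis unfolding s(5,6) admissible_def
      using s(3) by (auto simp: extend_def horn_index_def merge_def)
  qed
  show "act ?X (Suc n) (partner n F) (mk n (skip (missing_face n F))) = F"
    unfolding s(5,6) using face_extend_special(1)[OF s(1,3,2)] gd by (simp add: good_def)
  show "degenerate ?X (Suc n) (partner n F)" if d: "degenerate ?X n F"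
  proof -
    obtain m i G where "n = Suc m" "i \<le> m" "G \<in> cells ?X m" "F = act ?X m G (mk (Suc m) (merge i))"
      using Ex_degenerate[OF s(1) d] .
    thus ?thesis using extend_degenerate[of G P K m i r F p] s(3,5) by simp
  qed
  show "degenerate ?X (Suc (Suc n)) (partner (Suc n) (partner n F))"
    unfolding s(5) partner_cell(2)[OF extend_in_Ex[OF s(1,3)] state_extend[OF s(1,4)]]
    by (rule extend_extend_degenerate[OF s(1,3,2)])
  show "missing_face n F = missing_face n F'"
    if F': "F' \<in> cells ?X n - ?A n" and eq: "partner n F = partner n F'" for F'
  proof -
    obtain p' r' where s': "F' \<in> cells ?X n" "p' \<le> 2" "r' \<le> n" "state n p' r' F'" "partner n F' = extend p' r' n F'"
      "missing_face n F' = horn_index p' r'"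
      using obtain_state[OF F'] .
    have "p = p' \<and> opposite_index p r = opposite_index p' r'"
      using state_unique[OF Ex_flag[OF extend_in_Ex[OF s(1,3)]] state_extend[OF s(1,4)]]
        state_extend[OF s'(1,4)] eq unfolding s(5) s'(5) by metis
    thus ?thesis unfolding s(6) s'(6) by (auto simp: horn_index_def opposite_index_def split: if_splits)
  qed
  show "\<exists>m. n = Suc m \<and> F \<in> partner m ` (cells ?X m - ?A m)"
    if "\<not> degenerate ?X n F" "degenerate ?X (Suc n) (partner n F)"
    using extend_nondegenerate[OF s(1,4)] that unfolding s(5) by blast
  show "rank n g < rank n F"
    if "j \<le> Suc n" "j \<noteq> missing_face n F" "g = act ?X (Suc n) (partner n F) (mk n (skip j))" "g \<notin> ?A n"
      "\<not> degenerate ?X n g" "\<not> (\<exists>m. n = Suc m \<and> g \<in> partner m ` (cells ?X m - ?A m))" for j g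
    using other_face_rank[OF s(1,4)] that unfolding s(5,6) by blast
  show "rank n F < 2 * rank_bound n"
    using s(7) rank_bounds[OF Ex_flag[OF s(1)] s(3), of p] by (auto split: if_splits)
qed

section \<open>The image of \<open>\<iota>\<close>\<close>

lemma lv_flag_last_in: "lv_flag J s = map (\<lambda>(\<sigma>, q). last_in J \<sigma> q) s"
  by (simp add: lv_flag_def last_in_def)

lemma nth_lv_flag: "i < length s \<Longrightarrow> lv_flag J s ! i = last_in J (fst (s ! i)) (snd (s ! i))"
  by (simp add: lv_flag_last_in case_prod_unfold)

lemma lv_flag_simplex_maps:
  assumes J: "flag n J" and s: "s \<in> cells (sd_flag J) k"
  shows "lv_flag J s \<in> simplex_maps k n"
proof -
  note S = s[unfolded sd_flag_cells]
  have "lv_flag J s = mk k (\<lambda>i. last_in J (fst (s ! i)) (snd (s ! i)))"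
    using S by (intro nth_equalityI) (auto simp: lv_flag_last_in[unfolded case_prod_unfold] less_Suc_eq_le)
  also have "\<dots> \<in> simplex_maps k n"
  proof (rule mk_simplex_maps)
    fix i assume "i \<le> k"
    thus "last_in J (fst (s ! i)) (snd (s ! i)) \<le> n"
      using last_in(4)[of J "fst (s ! i)" "snd (s ! i)"] S flagD(2)[OF J] by simp
  next
    fix i j assume "i \<le> j" "j \<le> k"
    thus "last_in J (fst (s ! i)) (snd (s ! i)) \<le> last_in J (fst (s ! j)) (snd (s ! j))"
      using S by (intro last_in_mono[OF J]) auto
  qed
  finally show ?thesis .
qed

lemma lv_flag_natural:
  assumes J: "flag n J" and a: "\<alpha> \<in> simplex_maps l n" and s: "s \<in> cells (sd_flag (map ((!) J) \<alpha>)) k"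
  shows "lv_flag J (sd_flag_map \<alpha> s) = map ((!) \<alpha>) (lv_flag (map ((!) J) \<alpha>) s)"
proof -
  have p: "pullback J l ((!) \<alpha>) = map ((!) J) \<alpha>"
    by (rule pullback_simplex_maps[OF a])
  have "last_in J ((!) \<alpha> ` \<sigma>) q = \<alpha> ! last_in (map ((!) J) \<alpha>) \<sigma> q" if "(\<sigma>, q) \<in> set s" for \<sigma> q
    using vertex_image(2)[OF monotone_to_simplex_maps[OF a] _ flagD(2)[OF J], of \<sigma> q]
      vertex_of_cell[OF s that] by (simp add: p)
  thus ?thesis by (auto simp: lv_flag_last_in sd_flag_map_def)
qed

lemma strat_flag:
  assumes "stratified P K" "x \<in> cells K n"
  shows "strat K n x \<in> cells (nerve P) n" "flag n (strat K n x)"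
    "\<theta> \<in> simplex_maps m n \<Longrightarrow> strat K m (act K n x \<theta>) = map ((!) (strat K n x)) \<theta>"
  using simplicial_mapD[OF stratifiedD(2)[OF assms(1)] assms(2)]
  by (auto simp: nerve_def flag_def)

text \<open>
  The formula for \<open>lv\<close> is natural in the flag, so it is constant on the classes that form the left Kan extension.
\<close>

lemma lv_P_class:
  assumes K: "stratified P K" and x: "x \<in> cells K n"
  shows "lv_P K k (sd_rel K k `` {(n, x, s)}) = act K n x (lv_flag (strat K n x) s)"
proof -
  let ?h = "\<lambda>(m, x, s). act K m x (lv_flag (strat K m x) s)"
  have "?h y = ?h (n, x, s)" if "((n, x, s), y) \<in> sd_rel K k" for y
  proof (rule equiv_closure_invariant[OF that[unfolded sd_rel_def], where f = ?h, symmetric])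
    fix a b assume "(a, b) \<in> {((l, act K m x \<alpha>, s), (m, x, sd_flag_map \<alpha> s)) |l m x \<alpha> s.
        x \<in> cells K m \<and> \<alpha> \<in> simplex_maps l m \<and> s \<in> cells (sd_flag (strat K l (act K m x \<alpha>))) k}"
    then obtain l m x \<alpha> s where ab: "a = (l, act K m x \<alpha>, s)" "b = (m, x, sd_flag_map \<alpha> s)"
      "x \<in> cells K m" "\<alpha> \<in> simplex_maps l m" "s \<in> cells (sd_flag (strat K l (act K m x \<alpha>))) k" by blast
    note f = strat_flag[OF K ab(3)]
    have J': "flag l (strat K l (act K m x \<alpha>))"
      by (rule strat_flag(2)[OF K]) (rule simplicial_setD(2)[OF stratifiedD(1)[OF K] ab(3,4)])
    show "?h a = ?h b"
      using simplicial_setD(3)[OF stratifiedD(1)[OF K] ab(3,4) lv_flag_simplex_maps[OF J' ab(5)]]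
        lv_flag_natural[OF f(2) ab(4), of s k] ab(5) f(3)[OF ab(4)] ab(1,2) by simp
  qed
  hence "?h ` (sd_rel K k `` {(n, x, s)}) \<subseteq> {?h (n, x, s)}" by blast
  moreover have "(n, x, s) \<in> sd_rel K k `` {(n, x, s)}"
    by (simp add: sd_rel_def Image_iff equiv_closure_intros(2))
  ultimately have "?h ` (sd_rel K k `` {(n, x, s)}) = {?h (n, x, s)}" by blast
  thus ?thesis unfolding lv_P_def by simp
qed

lemma iota_eq:
  assumes "stratified P K" "x \<in> cells K n"
  shows "iota K n x = (strat K n x, \<lambda>k s. if s \<in> cells (sd_flag (strat K n x)) k
    then act K n x (lv_flag (strat K n x) s) else undefined)"
  by (simp add: iota_def adjunct_def lv_P_class[OF assms] cong: if_cong)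

text \<open>
  A section of \<open>lv\<close> as a simplex of the subdivision. All strata of the flag have to meet its smallest subset, which
  is why the first vertices are added.
\<close>

definition lv_section :: "'p list \<Rightarrow> 'p sd_simplex" where
  "lv_section J = map (\<lambda>i. ({..i} \<union> minima J, J ! i)) [0..<length J]"

lemma lv_section:
  assumes J: "flag n J"
  shows "lv_section J \<in> cells (sd_flag J) n" "lv_flag J (lv_section J) = [0..<Suc n]" "map snd (lv_section J) = J"
    "s \<in> cells (sd_flag J) k \<Longrightarrow> map ((!) (lv_section J)) (lv_flag J s) = map (twist J n (\<lambda>_. 3) (\<lambda>i. i)) s"
proof -
  note len = flagD(1)[OF J] and dim = flagD(2)[OF J]
  have v: "vertex J {i} (J ! i)" "last_in J {i} (J ! i) = i" if "i \<le> n" for i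
    using that dim by (auto simp: vertex_def intro: last_in_eqI)
  have nth: "lv_section J ! i = (fill J 3 {i} i, J ! i)" if "i \<le> n" for i
    unfolding lv_section_def using that len by (subst nth_map) (auto simp: fill_def simp del: upt_Suc)
  have lenb: "length (lv_section J) = Suc n" by (simp add: lv_section_def len)
  have vf: "vertex J (fill J 3 {i} i) (J ! i)" "last_in J (fill J 3 {i} i) (J ! i) = i" if "i \<le> n" for i
    using vertex_fill[OF J v(1)[OF that], of 3] v(2)[OF that] by simp_all
  show "lv_section J \<in> cells (sd_flag J) n"
    unfolding sd_flag_cells
  proof (intro conjI allI impI)
    fix i assume i: "i \<le> n"
    show "vertex J (fst (lv_section J ! i)) (snd (lv_section J ! i))" using vf(1)[OF i] nth[OF i] by simp
    obtain i' where "i' \<in> minima J" "J ! i' = J ! i" using ex_minima[of i J] i dim by auto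
    thus "snd (lv_section J ! i) \<in> (!) J ` fst (lv_section J ! 0)"
      using nth[OF i] nth[of 0] by (auto simp: fill_def image_iff) metis
  next
    fix i j assume "i \<le> j \<and> j \<le> n"
    thus "fst (lv_section J ! i) \<subseteq> fst (lv_section J ! j)" "snd (lv_section J ! i) \<le> snd (lv_section J ! j)"
      using nth flagD(3)[OF J] by (auto simp: fill_def)
  qed (simp add: lenb)
  show "lv_flag J (lv_section J) = [0..<Suc n]"
    by (rule nth_equalityI)
      (auto simp: nth_lv_flag lenb nth vf(2) less_Suc_eq_le lv_flag_last_in simp del: upt_Suc)
  show "map snd (lv_section J) = J"
    using len lenb by (intro nth_equalityI) (auto simp: nth less_Suc_eq_le)
  show "map ((!) (lv_section J)) (lv_flag J s) = map (twist J n (\<lambda>_. 3) (\<lambda>i. i)) s"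
    if s: "s \<in> cells (sd_flag J) k"
  proof -
    have "lv_section J ! last_in J \<sigma> q = twist J n (\<lambda>_. 3) (\<lambda>i. i) (\<sigma>, q)" if "(\<sigma>, q) \<in> set s" for \<sigma> q
      using last_in[OF vertex_of_cell[OF s that]] dim nth[of "last_in J \<sigma> q"]
      by (simp add: twist_def pullback_id[OF len] fill_def)
    thus ?thesis by (auto simp: lv_flag_last_in)
  qed
qed

text \<open>
  The inverse of \<open>\<iota>\<close> on its image.
\<close>

definition evaluate :: "nat \<Rightarrow> ('a, 'p::order) Ex_simplex \<Rightarrow> 'a" where
  "evaluate n F = snd F n (lv_section (fst F))"

lemma iota_in_Ex:
  assumes K: "stratified P K" and x: "x \<in> cells K n"
  shows "iota K n x \<in> cells (Ex_P P K) n"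
proof -
  let ?J = "strat K n x" let ?f = "snd (iota K n x)"
  note J = strat_flag[OF K x] and S = simplicial_setD[OF stratifiedD(1)[OF K] x]
  have f: "?f k s = (if s \<in> cells (sd_flag ?J) k then act K n x (lv_flag ?J s) else undefined)" for k s
    by (simp add: iota_eq[OF K x])
  have "simplicial_map (sd_flag ?J) K ?f"
    unfolding simplicial_map_def
  proof (intro allI ballI conjI)
    fix k s assume s: "s \<in> cells (sd_flag ?J) k"
    note l = lv_flag_simplex_maps[OF J(2) s]
    show "?f k s \<in> cells K k" using S(2)[OF l] s f by simp
    fix k' \<theta> assume t: "\<theta> \<in> simplex_maps k' k"
    have len: "i < length s" if "i \<in> set \<theta>" for i
      using that s t by (auto simp: sd_flag_cells simplex_maps_def)
    have "lv_flag ?J (map ((!) s) \<theta>) = map ((!) (lv_flag ?J s)) \<theta>"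
      unfolding lv_flag_last_in by (rule map_nth_map) (rule len)
    thus "?f k' (act (sd_flag ?J) k s \<theta>) = act K k (?f k s) \<theta>"
      using S(3)[OF l t] s f sd_flag_act[OF s t] by (simp add: sd_flag_def)
  qed
  moreover have "strat K k (?f k s) = strat (sd_flag ?J) k s" if s: "s \<in> cells (sd_flag ?J) k" for k s
  proof -
    have "?J ! last_in ?J \<sigma> q = q" if "(\<sigma>, q) \<in> set s" for \<sigma> q
      by (rule last_in(2)[OF vertex_of_cell[OF s that]])
    hence "map ((!) ?J) (lv_flag ?J s) = map snd s" by (auto simp: lv_flag_last_in)
    thus ?thesis using J(3)[OF lv_flag_simplex_maps[OF J(2) s]] s f by (simp add: sd_flag_def)
  qed
  ultimately have "?f \<in> strat_hom (sd_flag ?J) K" by (simp add: strat_hom_def strat_map_def f)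
  thus ?thesis using J(1) by (simp add: Ex_cells iota_eq[OF K x])
qed

lemma iota_in_image:
  assumes K: "stratified P K" and x: "x \<in> cells K n"
  shows "iota K n x \<in> iota_image P K n" "evaluate n (iota K n x) = x"
proof -
  let ?J = "strat K n x" let ?F = "iota K n x"
  note J = strat_flag(2)[OF K x]
  have fst: "fst ?F = ?J" by (simp add: iota_eq[OF K x])
  have p: "pullback ?J n (\<lambda>i. i) = ?J" by (rule pullback_id[OF flagD(1)[OF J]])
  have "lv_flag ?J (map (twist ?J n (\<lambda>_. 3) (\<lambda>i. i)) s) = lv_flag ?J s" if s: "s \<in> cells (sd_flag ?J) k" for k s
  proof -
    have "last_in ?J (fst (twist ?J n (\<lambda>_. 3) (\<lambda>i. i) (\<sigma>, q))) q = last_in ?J \<sigma> q" if "(\<sigma>, q) \<in> set s" for \<sigma> q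
      using vertex_fill(2)[OF J vertex_of_cell[OF s that]] by (simp add: twist_def p)
    thus ?thesis by (auto simp: lv_flag_last_in case_prod_unfold)
  qed
  moreover have "map (twist ?J n (\<lambda>_. 3) (\<lambda>i. i)) s \<in> cells (sd_flag ?J) k" if "s \<in> cells (sd_flag ?J) k" for k s
    using twist_cells[OF J monotone_to_id compatible_3, of s k] that by (simp add: p)
  ultimately have "good n (\<lambda>_. 3) ?F"
    unfolding good_def pull_def fst by (auto simp: iota_eq[OF K x] p fun_eq_iff)
  thus "?F \<in> iota_image P K n" using iota_in_Ex[OF K x] by (simp add: iota_image_def)
  show "evaluate n ?F = x"
    using lv_section(1,2)[OF J] simplicial_setD(1)[OF stratifiedD(1)[OF K] x]
    by (simp add: evaluate_def iota_eq[OF K x] del: upt_Suc)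
qed

text \<open>
  The idempotent that leaves \<open>F\<close> unchanged is the composite of \<open>lv\<close> with its section. So \<open>F\<close> is determined by its
  value on the section.
\<close>

lemma iota_evaluate:
  assumes K: "stratified P K" and F: "F \<in> iota_image P K n"
  shows "evaluate n F \<in> cells K n" "iota K n (evaluate n F) = F"
proof -
  have FX: "F \<in> cells (Ex_P P K) n" and g: "good n (\<lambda>_. 3) F" using F by (auto simp: iota_image_def)
  let ?J = "fst F"
  note J = Ex_flag[OF FX]
  have hom: "snd F \<in> strat_hom (sd_flag ?J) K" using FX by (simp add: Ex_cells)
  note h = strat_homD[OF hom] and b = lv_section[OF J]
  show x: "evaluate n F \<in> cells K n" unfolding evaluate_def by (rule simplicial_mapD(1)[OF h(1) b(1)])
  have st: "strat K n (evaluate n F) = ?J"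
    using h(2)[OF b(1)] b(3) by (simp add: evaluate_def sd_flag_def)
  have "act K n (evaluate n F) (lv_flag ?J s) = snd F k s" if s: "s \<in> cells (sd_flag ?J) k" for k s
  proof -
    have p: "pullback ?J n (\<lambda>i. i) = ?J" by (rule pullback_id[OF flagD(1)[OF J]])
    have "act K n (evaluate n F) (lv_flag ?J s) = snd F k (map ((!) (lv_section ?J)) (lv_flag ?J s))"
      unfolding evaluate_def using simplicial_mapD(2)[OF h(1) b(1) lv_flag_simplex_maps[OF J s]]
      by (simp add: sd_flag_def)
    also have "\<dots> = snd (pull n (\<lambda>_. 3) (\<lambda>i. i) F) k s"
      using s unfolding b(4)[OF s] by (simp add: pull_def p)
    finally show ?thesis using g by (simp add: good_def)
  qed
  thus "iota K n (evaluate n F) = F"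
    unfolding iota_eq[OF K x] st using h(3) by (auto simp: prod_eq_iff fun_eq_iff)
qed

lemma iota_act:
  assumes K: "stratified P K" and x: "x \<in> cells K n" and t: "\<theta> \<in> simplex_maps m n"
  shows "iota K m (act K n x \<theta>) = act (Ex_P P K) n (iota K n x) \<theta>"
proof -
  note f = strat_flag[OF K x] and S = simplicial_setD[OF stratifiedD(1)[OF K] x]
  let ?J' = "map ((!) (strat K n x)) \<theta>"
  have J': "flag m ?J'" using strat_flag(2)[OF K S(2)[OF t]] f(3)[OF t] by simp
  have "sd_flag_map \<theta> s \<in> cells (sd_flag (strat K n x)) k \<and>
      act K m (act K n x \<theta>) (lv_flag ?J' s) = act K n x (lv_flag (strat K n x) (sd_flag_map \<theta> s))"
    if s: "s \<in> cells (sd_flag ?J') k" for k s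
  proof
    have p: "pullback (strat K n x) m ((!) \<theta>) = ?J'"
      by (rule pullback_simplex_maps[OF t])
    show "sd_flag_map \<theta> s \<in> cells (sd_flag (strat K n x)) k"
      using twist_cells[OF f(2) monotone_to_simplex_maps[OF t] compatible_0, of s k] s p
      by (simp add: map_twist_zero)
    show "act K m (act K n x \<theta>) (lv_flag ?J' s) = act K n x (lv_flag (strat K n x) (sd_flag_map \<theta> s))"
      using S(3)[OF t lv_flag_simplex_maps[OF J' s]] lv_flag_natural[OF f(2) t s] by simp
  qed
  thus ?thesis
    unfolding iota_eq[OF K S(2)[OF t]] iota_eq[OF K x] f(3)[OF t] by (auto simp: Ex_P_def fun_eq_iff)
qed

section \<open>The unit is a trivial cofibration\<close>

theorem proposition3p1:
  fixes P :: "'p::order set" and K :: "('a, 'p) strat_sset"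
  assumes "stratified P K"
  shows "trivial_cofibration TYPE(('a, 'p) Ex_simplex) P K (Ex_P P K) (iota K)"
proof -
  note K = assms
  let ?X = "Ex_P P K" let ?A = "iota_image P K"
  interpret pairing P ?X ?A partner missing_face rank "\<lambda>n. 2 * rank_bound n" by (rule pairing_Ex)
  \<comment> \<open>The lists of stratum labels already form an infinite type, whatever the poset is.\<close>
  have inf: "infinite (UNIV :: ('a, 'p) Ex_simplex set)"
  proof
    assume "finite (UNIV :: ('a, 'p) Ex_simplex set)"
    hence "finite (range (fst :: ('a, 'p) Ex_simplex \<Rightarrow> 'p list))" by (rule finite_imageI)
    thus False using infinite_UNIV_listI[where 'a = 'p] by simp
  qed
  obtain r :: "('a, 'p) Ex_simplex rel" and a b F where seq:
    "transfinite_sequence P r a b F (\<lambda>i j n x. x)"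
    "\<forall>i j. is_successor r i j \<longrightarrow> horn_attachment TYPE(('a, 'p) Ex_simplex) P (F i) (F j) (\<lambda>n x. x)"
    "F a = ?X\<lparr>cells := ?A\<rparr>" "F b = ?X"
    using trivial_cofibration_inclusion[OF inf] .
  have iota_A: "strat_map K (?X\<lparr>cells := ?A\<rparr>) (iota K)"
    unfolding strat_map_def simplicial_map_def
    using iota_in_image(1)[OF K] iota_act[OF K] by (auto simp: iota_eq[OF K] Ex_P_def)
  have iota_X: "strat_map K ?X (iota K)"
    unfolding strat_map_def simplicial_map_def
    using iota_in_Ex[OF K] iota_act[OF K] by (auto simp: iota_eq[OF K] Ex_P_def)
  have eval: "strat_map (?X\<lparr>cells := ?A\<rparr>) K evaluate"
    unfolding strat_map_def simplicial_map_def
  proof (intro conjI allI ballI)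
    fix n F assume "F \<in> cells (?X\<lparr>cells := ?A\<rparr>) n"
    hence F: "F \<in> ?A n" by simp
    note e = iota_evaluate[OF K F]
    show "evaluate n F \<in> cells K n" by (rule e(1))
    have "fst (iota K n (evaluate n F)) = strat K n (evaluate n F)" by (simp add: iota_eq[OF K e(1)])
    hence "strat K n (evaluate n F) = fst F" unfolding e(2) by simp
    thus "strat K n (evaluate n F) = strat (?X\<lparr>cells := ?A\<rparr>) n F" by (simp add: Ex_P_def case_prod_unfold)
    fix m \<theta> assume t: "\<theta> \<in> simplex_maps m n"
    have "evaluate m (act ?X n F \<theta>) = evaluate m (iota K m (act K n (evaluate n F) \<theta>))"
      using iota_act[OF K e(1) t] e(2) by simp
    also have "\<dots> = act K n (evaluate n F) \<theta>"
      by (rule iota_in_image(2)[OF K simplicial_setD(2)[OF stratifiedD(1)[OF K] e(1) t]])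
    finally show "evaluate m (act (?X\<lparr>cells := ?A\<rparr>) n F \<theta>) = act K n (evaluate n F) \<theta>" by simp
  qed
  have id_X: "strat_map ?X ?X (\<lambda>n x. x)" by (simp add: strat_map_def simplicial_map_def)
  \<comment> \<open>The filtration starts at the image of \<open>\<iota>\<close>, which is isomorphic to \<open>K\<close>.\<close>
  have retract: "is_retract K ?X (iota K) (?X\<lparr>cells := ?A\<rparr>) ?X (\<lambda>n x. x)"
    unfolding is_retract_def
    by (intro exI[of _ "iota K"] exI[of _ evaluate] exI[of _ "\<lambda>n x. x"] conjI iota_A eval id_X allI ballI)
      (simp_all add: iota_in_image(2)[OF K] iota_evaluate(2)[OF K])
  show ?thesis
    unfolding trivial_cofibration_def
  proof (intro conjI exI)
    show "transfinite_sequence P r a b F (\<lambda>i j n x. x)" by (rule seq(1))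
    show "\<forall>i j. is_successor r i j \<longrightarrow> horn_attachment TYPE(('a, 'p) Ex_simplex) P (F i) (F j) (\<lambda>n x. x)"
      by (rule seq(2))
    show "is_retract K ?X (iota K) (F a) (F b) (\<lambda>n x. x)" using retract unfolding seq(3,4) .
  qed (rule K stratified_Ex iota_X)+
qed

end
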